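(* The actions $\mathcal S$ and $\mathcal S'$ are consistent of order $h$ with respect to the norm $\|A\|=\|dA\|_{L^2}+\|A\|_{L^2}$. That is, for every smooth $A\in\Omega^1(S)\otimes\mathfrak g$ there is a constant $C>0$ (which may depend on $A$ and on the sequence of meshes, but not on $n$) such that for all $n$ $$\sup_{A'\in X_n\setminus\{0\}}\frac{|D\mathcal S_n(I_nA)A'-D\mathcal S'_n(I_nA)A'|}{\|dA'\|_{L^2(S)}+\|A'\|_{L^2(S)}}\le C\,h_n .$$
   Context: $\mathbb G$ is a compact Lie group, realised as a subgroup of the unitary group of complex $N\times N$ matrices, with Lie algebra $\mathfrak g$ and real scalar product $g\cdot g'=\mathrm{Re}\,\mathrm{tr}(g^{\mathsf H}g')$, where $g^{\mathsf H}$ is the Hermitian conjugate; $\mathbf 1$ is the unit matrix. $S$ is a bounded domain in Euclidean space of dimension $m=3$, covered by the (closed) simplexes of the meshes below; $\Omega^k(S)$ is the space of smooth $k$-forms on $S$ (smooth up to the boundary). The bracket of $\mathfrak g$-valued forms is determined by $[u\otimes g,u'\otimes g']=(u\wedge u')\otimes[g,g']$, and the curvature of a $\mathfrak g$-valued $1$-form $A$ is $\mathcal F(A)=dA+\tfrac12[A,A]$. $(\mathcal T_n)_{n\in\mathbb N}$ is a regular (shape-regular) sequence of simplicial meshes of $S$; $h_T$ is the diameter of a simplex $T$, $h_n=\max_{T\in\mathcal T_n}h_T$, and $h_n\to0$. $\mathcal T_n^k$ is the set of $k$-dimensional simplexes of $\mathcal T_n$, each oriented. $\lambda_i$ is the barycentric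 coordinate map (continuous, piecewise affine, $1$ at vertex $i$, $0$ at other vertexes). For an edge from $i$ to $j$, $\lambda_{ji}=\lambda_i\,d\lambda_j-\lambda_j\,d\lambda_i$; for a face with vertexes ordered $i\to j\to k$ by its orientation, $\lambda_{kji}=2(\lambda_i\,d\lambda_j\wedge d\lambda_k-\lambda_j\,d\lambda_i\wedge d\lambda_k+\lambda_k\,d\lambda_i\wedge d\lambda_j)$. $W^1(\mathcal T_n)$ is the span of the $\lambda_e$, $e\in\mathcal T_n^1$, and $X_n=W^1(\mathcal T_n)\otimes\mathfrak g$. $I_n$ is the interpolant onto Whitney $1$-forms: $I_nA=\sum_{e\in\mathcal T_n^1}(\int_eA)\lambda_e$. For $A\in X_n$, $A_{ji}=\int_{ji}A$ (so $A_{ij}=-A_{ji}$, $A_{ii}=0$) and $U_{ji}=\exp(-A_{ji})$. For each face $f\in\mathcal T_n^2$ an orientation and a distinguished vertex $\dot f$ are chosen; if $f$ has vertexes ordered $i\to j\to k$ with $\dot f=i$, then $F_f=U_{ik}U_{kj}U_{ji}$. Mass matrix: $M_{f_0f_1}(T)=\int_T\lambda_{f_0}\cdot\lambda_{f_1}$ with the Euclidean scalar product of alternating forms. On $X_n$, $$\mathcal S_n(A)=\sum_{T\in\mathcal T_n^3}\int_T|\mathcal F(A)|^2,$$ $$\mathcal S'_n(A)=\sum_{T\in\mathcal T_n^3}\ \sum_{f_0,f_1}M_{f_0f_1}(T)\,\mathrm{Re}\,\mathrm{tr}\big(U_{\dot f_1\dot f_0}(\mathbf 1-F_{f_0}^{\mathsf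 H})U_{\dot f_0\dot f_1}(\mathbf 1-F_{f_1})\big),$$ the inner sum being over pairs of faces $f_0,f_1$ of $T$. $D\mathcal S_n(B)A'$ denotes the derivative of $\mathcal S_n$ at $B$ in direction $A'$. *)

theory Defs
  imports "HOL-Analysis.Analysis"
begin

section \<open>Matrix groups\<close>

definition hconj :: "complex^'n^'m \<Rightarrow> complex^'m^'n"
  where "hconj A = (\<chi> i j. cnj (A $ j $ i))"

text \<open>The product of the type class on vectors is taken componentwise, so the matrix
  exponential is written out with the matrix product.\<close>

definition mexp :: "complex^'n^'n \<Rightarrow> complex^'n^'n"
  where "mexp X = (\<Sum>k. (1 / fact k) *\<^sub>R (((**) X ^^ k) (mat 1)))"

definition commutator :: "complex^'n^'n \<Rightarrow> complex^'n^'n \<Rightarrow> complex^'n^'n"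
  where "commutator X Y = X ** Y - Y ** X"

text \<open>Compact subgroups of the unitary group; by the closed subgroup theorem these are exactly
  the compact Lie groups of unitary matrices.\<close>

definition compact_unitary_group :: "(complex^'n^'n) set \<Rightarrow> bool"
  where "compact_unitary_group G \<longleftrightarrow>
    compact G \<and> (\<forall>g\<in>G. hconj g ** g = mat 1) \<and>
    mat 1 \<in> G \<and> (\<forall>g\<in>G. \<forall>g'\<in>G. g ** g' \<in> G) \<and> (\<forall>g\<in>G. matrix_inv g \<in> G)"

definition lie_algebra :: "(complex^'n^'n) set \<Rightarrow> (complex^'n^'n) set"
  where "lie_algebra G = {X. \<forall>t::real. mexp (t *\<^sub>R X) \<in> G}"

text \<open>The inner product of the type class is the scalar product used on the Lie algebra.\<close>

lemma inner_eq_Re_trace: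
  fixes X Y :: "complex^'n^'n"
  shows "X \<bullet> Y = Re (trace (hconj X ** Y))"
proof -
  have "Re (trace (hconj X ** Y)) = (\<Sum>j\<in>UNIV. \<Sum>i\<in>UNIV. X $ i $ j \<bullet> Y $ i $ j)"
    by (simp add: trace_def hconj_def matrix_matrix_mult_def inner_complex_def)
  also have "\<dots> = (\<Sum>i\<in>UNIV. \<Sum>j\<in>UNIV. X $ i $ j \<bullet> Y $ i $ j)"
    by (rule sum.swap)
  finally show ?thesis
    by (simp add: inner_vec_def)
qed


section \<open>Differential forms on Euclidean space\<close>

type_synonym 'b form1 = "real^3 \<Rightarrow> real^3 \<Rightarrow> 'b"
type_synonym 'b form2 = "real^3 \<Rightarrow> real^3 \<Rightarrow> real^3 \<Rightarrow> 'b"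

text \<open>The function \<open>D [v\<^sub>k, \<dots>, v\<^sub>1]\<close> is the iterated derivative of \<open>f\<close> in the
  directions \<open>v\<^sub>1, \<dots>, v\<^sub>k\<close>: all derivatives exist in \<open>S\<close> and extend continuously to the
  closure.\<close>

definition smooth_up_to_boundary ::
    "'a::euclidean_space set \<Rightarrow> ('a \<Rightarrow> 'b::real_normed_vector) \<Rightarrow> bool"
  where "smooth_up_to_boundary S f \<longleftrightarrow>
    (\<exists>D :: 'a list \<Rightarrow> 'a \<Rightarrow> 'b.
       (\<forall>x\<in>closure S. D [] x = f x) \<and>
       (\<forall>vs. continuous_on (closure S) (D vs)) \<and>
       (\<forall>vs. \<forall>x\<in>S. (D vs has_derivative (\<lambda>v. D (v # vs) x)) (at x)))"

text \<open>Smooth 1-forms on \<open>S\<close> with values in the subspace \<open>V\<close>; values away from the closure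
  of \<open>S\<close> are irrelevant.\<close>

definition smooth_form1 :: "(real^3) set \<Rightarrow> 'b::real_normed_vector set \<Rightarrow> 'b form1 set"
  where "smooth_form1 S V =
    {A. (\<forall>x\<in>closure S. linear (A x) \<and> range (A x) \<subseteq> V) \<and>
        (\<forall>v. smooth_up_to_boundary S (\<lambda>x. A x v))}"

definition wedge :: "(real^3 \<Rightarrow> real) \<Rightarrow> (real^3 \<Rightarrow> real) \<Rightarrow> real^3 \<Rightarrow> real^3 \<Rightarrow> real"
  where "wedge \<alpha> \<beta> u v = \<alpha> u * \<beta> v - \<alpha> v * \<beta> u"

definition ext_d :: "'b::real_normed_vector form1 \<Rightarrow> 'b form2"
  where "ext_d A x u v =
    frechet_derivative (\<lambda>y. A y v) (at x) u - frechet_derivative (\<lambda>y. A y u) (at x) v"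

definition form_bracket :: "(complex^'n^'n) form1 \<Rightarrow> (complex^'n^'n) form1 \<Rightarrow> (complex^'n^'n) form2"
  where "form_bracket A B x u v = commutator (A x u) (B x v) - commutator (A x v) (B x u)"

lemma form_bracket_tensor:
  "form_bracket (\<lambda>x v. \<alpha> x v *\<^sub>R g) (\<lambda>x v. \<beta> x v *\<^sub>R g') x u v =
   wedge (\<alpha> x) (\<beta> x) u v *\<^sub>R commutator g g'"
  by (simp add: form_bracket_def commutator_def wedge_def algebra_simps
      scalar_matrix_assoc[symmetric] matrix_scalar_ac)

definition curvature :: "(complex^'n^'n) form1 \<Rightarrow> (complex^'n^'n) form2"
  where "curvature A x u v = ext_d A x u v + (1/2) *\<^sub>R form_bracket A A x u v"

definition inner1 :: "(real^3 \<Rightarrow> 'b::real_inner) \<Rightarrow> (real^3 \<Rightarrow> 'b) \<Rightarrow> real"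
  where "inner1 \<alpha> \<beta> = (\<Sum>u\<in>Basis. \<alpha> u \<bullet> \<beta> u)"

text \<open>Halving the sum over all ordered pairs of basis vectors gives the sum over the pairs of
  indices \<open>a < b\<close>, so that the forms \<open>dx\<^sub>a \<and> dx\<^sub>b\<close> are orthonormal.\<close>

definition inner2 ::
    "(real^3 \<Rightarrow> real^3 \<Rightarrow> 'b::real_inner) \<Rightarrow> (real^3 \<Rightarrow> real^3 \<Rightarrow> 'b) \<Rightarrow> real"
  where "inner2 \<omega> \<eta> = (\<Sum>u\<in>Basis. \<Sum>v\<in>Basis. \<omega> u v \<bullet> \<eta> u v) / 2"

definition L2_norm1 :: "(real^3) set \<Rightarrow> 'b::real_inner form1 \<Rightarrow> real"
  where "L2_norm1 S A = sqrt (LINT x:S|lebesgue. inner1 (A x) (A x))"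

definition L2_norm2 :: "(real^3) set \<Rightarrow> 'b::real_inner form2 \<Rightarrow> real"
  where "L2_norm2 S F = sqrt (LINT x:S|lebesgue. inner2 (F x) (F x))"

text \<open>The integral of \<open>A\<close> over the segment oriented from \<open>i\<close> to \<open>j\<close>; in keeping with the
  notation \<open>A\<^sub>j\<^sub>i\<close> the end point is the first argument.\<close>

definition edge_integral :: "'b::banach form1 \<Rightarrow> real^3 \<Rightarrow> real^3 \<Rightarrow> 'b"
  where "edge_integral A j i = integral {0..1} (\<lambda>t. A (i + t *\<^sub>R (j - i)) (j - i))"


section \<open>Simplicial meshes\<close>

definition simplexes :: "int \<Rightarrow> (real^3) set set \<Rightarrow> (real^3) set set"
  where "simplexes k \<T> = {T \<in> \<T>. k simplex T}"

definition vertices :: "(real^3) set \<Rightarrow> (real^3) set"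
  where "vertices T = {v. v extreme_point_of T}"

definition mesh_of :: "(real^3) set \<Rightarrow> (real^3) set set \<Rightarrow> bool"
  where "mesh_of S \<T> \<longleftrightarrow>
    simplicial_complex \<T> \<and> \<Union>\<T> = closure S \<and> (\<forall>T\<in>simplexes 3 \<T>. interior T \<subseteq> S)"

definition mesh_size :: "(real^3) set set \<Rightarrow> real"
  where "mesh_size \<T> = Max (diameter ` \<T>)"

definition shape_regular :: "(nat \<Rightarrow> (real^3) set set) \<Rightarrow> bool"
  where "shape_regular \<T> \<longleftrightarrow>
    (\<exists>c>0. \<forall>n. \<forall>T\<in>simplexes 3 (\<T> n). \<exists>z. cball z (c * diameter T) \<subseteq> T)"

text \<open>An orientation of an edge is the ordered pair of its vertices. For a face \<open>f\<close> the triple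
  \<open>(i, j, k)\<close> encodes the orientation \<open>i \<rightarrow> j \<rightarrow> k\<close> together with the distinguished vertex
  \<open>i\<close> of \<open>f\<close>: the six orderings correspond to two orientations and three vertices.\<close>

definition edge_orientation ::
    "(real^3) set set \<Rightarrow> ((real^3) set \<Rightarrow> (real^3) \<times> (real^3)) \<Rightarrow> bool"
  where "edge_orientation \<T> eo \<longleftrightarrow>
    (\<forall>e\<in>simplexes 1 \<T>. case eo e of (i, j) \<Rightarrow> vertices e = {i, j})"

definition face_orientation ::
    "(real^3) set set \<Rightarrow> ((real^3) set \<Rightarrow> (real^3) \<times> (real^3) \<times> (real^3)) \<Rightarrow> bool"
  where "face_orientation \<T> fo \<longleftrightarrow>
    (\<forall>f\<in>simplexes 2 \<T>. case fo f of (i, j, k) \<Rightarrow> vertices f = {i, j, k})"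


section \<open>Whitney forms\<close>

text \<open>The affine function on the whole space which restricts on the tetrahedron \<open>T\<close> to the
  barycentric coordinate of the vertex \<open>i\<close>; it vanishes if \<open>i\<close> is not a vertex of \<open>T\<close>.\<close>

definition bary :: "(real^3) set \<Rightarrow> real^3 \<Rightarrow> real^3 \<Rightarrow> real"
  where "bary T i = (THE f. (\<exists>a b. f = (\<lambda>x. a + b \<bullet> x)) \<and>
                            (\<forall>v\<in>vertices T. f v = (if v = i then 1 else 0)))"

text \<open>The value of the barycentric coordinate map \<open>lam \<T> i\<close> at a point does not depend on the
  tetrahedron that \<open>tet_at\<close> selects there. Its differential is single-valued in the interiors
  of the tetrahedra; elsewhere it is taken from inside the selected tetrahedron. At an inner
  point of an edge every such tetrahedron contains that edge, so the components of
  \<open>dlam \<T> i\<close> tangential to the edge, the only ones that edge integrals see, do not depend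
  on the selection either.\<close>

definition tet_at :: "(real^3) set set \<Rightarrow> real^3 \<Rightarrow> (real^3) set"
  where "tet_at \<T> x = (SOME T. T \<in> simplexes 3 \<T> \<and> x \<in> T)"

definition lam :: "(real^3) set set \<Rightarrow> real^3 \<Rightarrow> real^3 \<Rightarrow> real"
  where "lam \<T> i x = (if x \<in> \<Union>\<T> then bary (tet_at \<T> x) i x else 0)"

definition dlam :: "(real^3) set set \<Rightarrow> real^3 \<Rightarrow> real form1"
  where "dlam \<T> i x v =
    (if x \<in> \<Union>\<T> then frechet_derivative (bary (tet_at \<T> x) i) (at x) v else 0)"

definition whitney1 :: "(real^3) set set \<Rightarrow> (real^3) \<times> (real^3) \<Rightarrow> real form1"
  where "whitney1 \<T> = (\<lambda>(i, j) x v. lam \<T> i x * dlam \<T> j x v - lam \<T> j x * dlam \<T> i x v)"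

definition whitney2 :: "(real^3) set set \<Rightarrow> (real^3) \<times> (real^3) \<times> (real^3) \<Rightarrow> real form2"
  where "whitney2 \<T> = (\<lambda>(i, j, k) x u v.
    2 * (lam \<T> i x * wedge (dlam \<T> j x) (dlam \<T> k x) u v
       - lam \<T> j x * wedge (dlam \<T> i x) (dlam \<T> k x) u v
       + lam \<T> k x * wedge (dlam \<T> i x) (dlam \<T> j x) u v))"

definition W1 :: "(real^3) set set \<Rightarrow> ((real^3) set \<Rightarrow> (real^3) \<times> (real^3)) \<Rightarrow> real form1 set"
  where "W1 \<T> eo =
    {w. \<exists>c :: (real^3) set \<Rightarrow> real. w = (\<lambda>x v. \<Sum>e\<in>simplexes 1 \<T>. c e * whitney1 \<T> (eo e) x v)}"

definition tensor :: "real form1 set \<Rightarrow> 'b::real_vector set \<Rightarrow> 'b form1 set"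
  where "tensor W V =
    {A. \<exists>(m::nat) w g. (\<forall>k<m. w k \<in> W \<and> g k \<in> V) \<and> A = (\<lambda>x v. \<Sum>k<m. w k x v *\<^sub>R g k)}"

text \<open>A member of this space is smooth in the interior of each tetrahedron and tangentially
  continuous, so its weak exterior derivative is given almost everywhere by \<open>ext_d\<close>.\<close>

definition Xspace :: "(complex^'n^'n) set \<Rightarrow> (real^3) set set \<Rightarrow>
    ((real^3) set \<Rightarrow> (real^3) \<times> (real^3)) \<Rightarrow> (complex^'n^'n) form1 set"
  where "Xspace G \<T> eo = tensor (W1 \<T> eo) (lie_algebra G)"

definition interpolant :: "(real^3) set set \<Rightarrow> ((real^3) set \<Rightarrow> (real^3) \<times> (real^3)) \<Rightarrow>
    'b::banach form1 \<Rightarrow> 'b form1"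
  where "interpolant \<T> eo A = (\<lambda>x v. \<Sum>e\<in>simplexes 1 \<T>.
    case eo e of (i, j) \<Rightarrow> whitney1 \<T> (i, j) x v *\<^sub>R edge_integral A j i)"


section \<open>The two actions\<close>

definition action :: "(real^3) set set \<Rightarrow> (complex^'n^'n) form1 \<Rightarrow> real"
  where "action \<T> A =
    (\<Sum>T\<in>simplexes 3 \<T>. LINT x:T|lebesgue. inner2 (curvature A x) (curvature A x))"

definition transport :: "(complex^'n^'n) form1 \<Rightarrow> real^3 \<Rightarrow> real^3 \<Rightarrow> complex^'n^'n"
  where "transport A j i = mexp (- edge_integral A j i)"

definition holonomy ::
    "(complex^'n^'n) form1 \<Rightarrow> (real^3) \<times> (real^3) \<times> (real^3) \<Rightarrow> complex^'n^'n"
  where "holonomy A = (\<lambda>(i, j, k). transport A i k ** transport A k j ** transport A j i)"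

definition mass :: "(real^3) set set \<Rightarrow> (real^3) set \<Rightarrow> (real^3) \<times> (real^3) \<times> (real^3) \<Rightarrow>
    (real^3) \<times> (real^3) \<times> (real^3) \<Rightarrow> real"
  where "mass \<T> T f0 f1 = (LINT x:T|lebesgue. inner2 (whitney2 \<T> f0 x) (whitney2 \<T> f1 x))"

definition faces :: "(real^3) set set \<Rightarrow> (real^3) set \<Rightarrow> (real^3) set set"
  where "faces \<T> T = {f \<in> simplexes 2 \<T>. f face_of T}"

definition lattice_action :: "(real^3) set set \<Rightarrow>
    ((real^3) set \<Rightarrow> (real^3) \<times> (real^3) \<times> (real^3)) \<Rightarrow> (complex^'n^'n) form1 \<Rightarrow> real"
  where "lattice_action \<T> fo A =
    (\<Sum>T\<in>simplexes 3 \<T>. \<Sum>f0\<in>faces \<T> T. \<Sum>f1\<in>faces \<T> T.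
       mass \<T> T (fo f0) (fo f1) *
       Re (trace (transport A (fst (fo f1)) (fst (fo f0)) ** (mat 1 - hconj (holonomy A (fo f0))) **
                  transport A (fst (fo f0)) (fst (fo f1)) ** (mat 1 - holonomy A (fo f1)))))"

definition dir_deriv :: "('b::real_vector form1 \<Rightarrow> real) \<Rightarrow> 'b form1 \<Rightarrow> 'b form1 \<Rightarrow> real"
  where "dir_deriv \<Phi> B A' = deriv (\<lambda>t. \<Phi> (\<lambda>x v. B x v + t *\<^sub>R A' x v)) 0"

end

theory Submission
  imports Defs
begin

text \<open>On a tetrahedron a Whitney 1-form is \<open>x \<mapsto> (v \<mapsto> \<alpha> v + \<beta> (x - z) v)\<close> with \<open>\<alpha>\<close> linear and \<open>\<beta>\<close>
  bilinear and antisymmetric, and its integral along the edge from \<open>i\<close> to \<open>j\<close> is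
  \<open>\<alpha> (j - i) + \<beta> (i - z) (j - i)\<close>. For the interpolant of a smooth form both parts are bounded
  uniformly in the mesh. Consider the perturbation of the interpolant by \<open>t\<close> times a discrete form. Up to
  an error whose derivative at \<open>t = 0\<close> is \<open>O(h\<^sup>4)\<close> times the size of the perturbation on the
  tetrahedron \<open>T\<close>, the contributions of \<open>T\<close> to the two actions both equal the volume of \<open>T\<close> times the
  squared norm of the constant 2-form \<open>\<Omega> u v = 2 \<beta> u v + [\<alpha> u, \<alpha> v]\<close>: for the first
  action \<open>\<Omega>\<close> is the curvature at \<open>z\<close>; for the second one the holonomy of a face is
  \<open>1 - \<Omega> (j - i) (k - i) / 2 + O(h\<^sup>3)\<close>, and Whitney 2-forms reproduce constant
  2-forms. Summing over the tetrahedra with the Cauchy-Schwarz inequality gives the claim.\<close>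

section \<open>Uniform estimates for values and first variations\<close>

text \<open>The perturbation is controlled only through integral norms of its values and of its
  exterior derivative, so its pointwise smallness must not enter. Hence its size \<open>N\<close> is
  kept apart from \<open>h\<close>, and of the dependence on \<open>t\<close> only the first
  derivative at 0 is estimated. On a tetrahedron a Whitney 1-form is determined by its value at one
  point and its constant exterior derivative; therefore the volume times the square of
  \<open>N\<close> is bounded by the squared norms over the tetrahedron. The order 4 is dictated by
  the claim: three powers of \<open>h\<close> become the volume by shape regularity, and the fourth
  is the rate. For the lattice action this fixes the accuracy of the holonomy. Whitney 2-forms have
  size \<open>1/h^2\<close>, so the mass matrix has size \<open>1/h\<close>, and a product of two
  holonomy defects, each of order 2, must be known up to order 5; this forces the expansion up to
  order 3, commutator included. Of the common value of the two actions only differentiability is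
  used, since it cancels. The interpolation error of the smooth form never appears, because both
  actions are expanded at the interpolant itself.\<close>

text \<open>Here \<open>h\<close> is the mesh width and \<open>N\<close> the size of the perturbation in whose direction the
  derivative at \<open>0\<close> is taken; the constant is uniform over the index set \<open>I\<close>. Orders add
  up in products, so that expansions and their derivatives are estimated in one go.\<close>

definition jet_O :: "'i set \<Rightarrow> ('i \<Rightarrow> real) \<Rightarrow> ('i \<Rightarrow> real) \<Rightarrow> nat \<Rightarrow>
    ('i \<Rightarrow> real \<Rightarrow> 'b::real_normed_vector) \<Rightarrow> bool"
  where "jet_O I h N k f \<longleftrightarrow>
    (\<forall>i\<in>I. 0 \<le> h i \<and> 0 \<le> N i) \<and> (\<exists>H. \<forall>i\<in>I. h i \<le> H) \<and>
    (\<exists>K\<ge>0. \<forall>i\<in>I. \<exists>f'. (f i has_vector_derivative f') (at 0) \<and>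
       norm (f i 0) \<le> K * h i ^ k \<and> norm f' \<le> K * h i ^ k * N i)"

lemma jet_O_cong:
  assumes "jet_O I h N k f" "\<And>i t. i \<in> I \<Longrightarrow> f i t = g i t"
  shows "jet_O I h N k g"
proof -
  have "f i = g i" if "i \<in> I" for i using assms(2) that by auto
  then show ?thesis using assms(1) unfolding jet_O_def by simp
qed

lemma jet_O_E:
  assumes "jet_O I h N k f"
  obtains K f' where "K \<ge> 0"
    "\<And>i. i \<in> I \<Longrightarrow> (f i has_vector_derivative f' i) (at 0)"
    "\<And>i. i \<in> I \<Longrightarrow> norm (f i 0) \<le> K * h i ^ k" "\<And>i. i \<in> I \<Longrightarrow> norm (f' i) \<le> K * h i ^ k * N i"
proof -
  from assms obtain K where "K \<ge> 0" "\<forall>i\<in>I. \<exists>f'. (f i has_vector_derivative f') (at 0) \<and>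
       norm (f i 0) \<le> K * h i ^ k \<and> norm f' \<le> K * h i ^ k * N i" unfolding jet_O_def by blast
  moreover from bchoice[OF this(2)] obtain f' where "\<forall>i\<in>I. (f i has_vector_derivative f' i) (at 0) \<and>
       norm (f i 0) \<le> K * h i ^ k \<and> norm (f' i) \<le> K * h i ^ k * N i" by blast
  ultimately show thesis using that[of K f'] by blast
qed

lemma jet_O_I:
  assumes "\<And>i. i \<in> I \<Longrightarrow> 0 \<le> h i \<and> 0 \<le> N i \<and> h i \<le> H"
    and "\<And>i. i \<in> I \<Longrightarrow> (f i has_vector_derivative f' i) (at 0)"
    and "\<And>i. i \<in> I \<Longrightarrow> norm (f i 0) \<le> K * h i ^ k" "\<And>i. i \<in> I \<Longrightarrow> norm (f' i) \<le> K * h i ^ k * N i"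
  shows "jet_O I h N k f"
proof -
  \<comment> \<open>\<open>K\<close> may be negative here; its absolute value serves as the constant
    that the definition asks for.\<close>
  have "K * h i ^ k \<le> \<bar>K\<bar> * h i ^ k" "K * h i ^ k * N i \<le> \<bar>K\<bar> * h i ^ k * N i" if "i \<in> I" for i
    using assms(1)[OF that] by (auto intro!: mult_right_mono)
  then have "\<exists>K\<ge>0. \<forall>i\<in>I. \<exists>f'. (f i has_vector_derivative f') (at 0) \<and>
       norm (f i 0) \<le> K * h i ^ k \<and> norm f' \<le> K * h i ^ k * N i"
    using assms(2-4) by (intro exI[of _ "\<bar>K\<bar>"]) (meson abs_ge_zero order_trans)
  then show ?thesis using assms(1) unfolding jet_O_def by blast
qed

lemma jet_O_scale:
  assumes "jet_O I h N k f"
  obtains H where "\<And>i. i \<in> I \<Longrightarrow> 0 \<le> h i \<and> 0 \<le> N i \<and> h i \<le> H"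
  using assms unfolding jet_O_def by blast

text \<open>By the product rule each of the two summands of the derivative contains the derivative
  of exactly one factor, so \<open>N\<close> enters once while the powers of \<open>h\<close>
  multiply. The factor 2 in the constant counts these summands.\<close>

lemma jet_O_bilinear:
  assumes b: "bounded_bilinear pr" and f: "jet_O I h N k f" and g: "jet_O I h N l g"
  shows "jet_O I h N (k + l) (\<lambda>i t. pr (f i t) (g i t))"
proof -
  obtain H where H: "\<And>i. i \<in> I \<Longrightarrow> 0 \<le> h i \<and> 0 \<le> N i \<and> h i \<le> H" using jet_O_scale[OF f] by blast
  obtain K f' where F: "K \<ge> 0" "\<And>i. i \<in> I \<Longrightarrow> (f i has_vector_derivative f' i) (at 0)"
    "\<And>i. i \<in> I \<Longrightarrow> norm (f i 0) \<le> K * h i ^ k" "\<And>i. i \<in> I \<Longrightarrow> norm (f' i) \<le> K * h i ^ k * N i"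
    using jet_O_E[OF f] by blast
  obtain L g' where G: "L \<ge> 0" "\<And>i. i \<in> I \<Longrightarrow> (g i has_vector_derivative g' i) (at 0)"
    "\<And>i. i \<in> I \<Longrightarrow> norm (g i 0) \<le> L * h i ^ l" "\<And>i. i \<in> I \<Longrightarrow> norm (g' i) \<le> L * h i ^ l * N i"
    using jet_O_E[OF g] by blast
  obtain c where c: "c > 0" "\<And>a b. norm (pr a b) \<le> norm a * norm b * c"
    using bounded_bilinear.pos_bounded[OF b] by blast
  have le: "norm (pr x y) \<le> X * Y * c" if "norm x \<le> X" "norm y \<le> Y" for x y X Y
    using c(2)[of x y] mult_mono[OF that order_trans[OF norm_ge_zero that(1)] norm_ge_zero] c(1)
    by (meson less_imp_le mult_right_mono order_trans)
  show ?thesis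
  proof (rule jet_O_I[where I=I and h=h and N=N, OF H, where K="2*c*K*L"])
    fix i assume i: "i \<in> I"
    show "((\<lambda>t. pr (f i t) (g i t)) has_vector_derivative pr (f i 0) (g' i) + pr (f' i) (g i 0)) (at 0)"
      using bounded_bilinear.has_vector_derivative[OF b F(2) G(2), OF i i] by simp
    have "0 \<le> c * K * L * h i ^ (k + l)" using c F(1) G(1) H[OF i] by simp
    then show "norm (pr (f i 0) (g i 0)) \<le> 2*c*K*L * h i ^ (k + l)"
      using le[OF F(3) G(3), OF i i] by (simp add: power_add mult_ac)
    show "norm (pr (f i 0) (g' i) + pr (f' i) (g i 0)) \<le> 2*c*K*L * h i ^ (k + l) * N i"
      using norm_triangle_le[OF add_mono[OF le[OF F(3) G(4)] le[OF F(4) G(3)]], OF i i i i]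
      by (simp add: power_add mult_ac)
  qed
qed

lemma jet_O_add:
  assumes f: "jet_O I h N k f" and g: "jet_O I h N k g"
  shows "jet_O I h N k (\<lambda>i t. f i t + g i t)"
proof -
  obtain H where H: "\<And>i. i \<in> I \<Longrightarrow> 0 \<le> h i \<and> 0 \<le> N i \<and> h i \<le> H" using jet_O_scale[OF f] by blast
  obtain K f' where F: "K \<ge> 0" "\<And>i. i \<in> I \<Longrightarrow> (f i has_vector_derivative f' i) (at 0)"
    "\<And>i. i \<in> I \<Longrightarrow> norm (f i 0) \<le> K * h i ^ k" "\<And>i. i \<in> I \<Longrightarrow> norm (f' i) \<le> K * h i ^ k * N i"
    using jet_O_E[OF f] by blast
  obtain L g' where G: "L \<ge> 0" "\<And>i. i \<in> I \<Longrightarrow> (g i has_vector_derivative g' i) (at 0)"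
    "\<And>i. i \<in> I \<Longrightarrow> norm (g i 0) \<le> L * h i ^ k" "\<And>i. i \<in> I \<Longrightarrow> norm (g' i) \<le> L * h i ^ k * N i"
    using jet_O_E[OF g] by blast
  show ?thesis
    by (rule jet_O_I[where I=I and h=h and N=N, OF H has_vector_derivative_add[OF F(2) G(2)], where K="K + L"])
      (use norm_triangle_le[OF add_mono[OF F(3) G(3)]] norm_triangle_le[OF add_mono[OF F(4) G(4)]]
        in \<open>simp_all add: distrib_right\<close>)
qed

text \<open>The source of all basic estimates: the parts of a discrete form on a tetrahedron are
  affine in \<open>t\<close>, with \<open>a\<close> coming from the interpolant and \<open>b\<close>
  from the perturbation, whose bound carries the factor \<open>N\<close>.\<close>

lemma jet_O_affine:
  assumes "\<And>i. i \<in> I \<Longrightarrow> 0 \<le> h i \<and> 0 \<le> N i \<and> h i \<le> H"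
    and "\<And>i. i \<in> I \<Longrightarrow> norm (a i) \<le> K * h i ^ k"
    and "\<And>i. i \<in> I \<Longrightarrow> norm (b i) \<le> K * h i ^ k * N i"
  shows "jet_O I h N k (\<lambda>i t. a i + t *\<^sub>R b i)"
  by (rule jet_O_I[where I=I and h=h and N=N, OF assms(1), where f'=b and K=K]) (auto simp: assms intro!: derivative_eq_intros)

lemma jet_O_const:
  assumes f: "jet_O I h N k f"
  shows "jet_O I h N 0 (\<lambda>i t. c)"
proof -
  obtain H where H: "\<And>i. i \<in> I \<Longrightarrow> 0 \<le> h i \<and> 0 \<le> N i \<and> h i \<le> H" using jet_O_scale[OF f] by blast
  show ?thesis using jet_O_affine[where I=I and h=h and N=N, OF H, where a="\<lambda>i. c" and K="norm c" and k=0 and b="\<lambda>i. 0"] H by simp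
qed

text \<open>This is the product rule for \<open>c *\<^sub>R L x\<close> with the constant first
  factor 1.\<close>

lemma jet_O_linear:
  assumes "bounded_linear L" and f: "jet_O I h N k f"
  shows "jet_O I h N k (\<lambda>i t. L (f i t))"
  using jet_O_bilinear[OF bounded_bilinear.comp[OF bounded_bilinear_scaleR bounded_linear_ident assms(1)]
      jet_O_const[OF f, of 1] f] by simp

lemma jet_O_minus: "jet_O I h N k f \<Longrightarrow> jet_O I h N k (\<lambda>i t. - f i t)"
  by (rule jet_O_linear[OF bounded_linear_minus[OF bounded_linear_ident]])

lemma jet_O_diff:
  assumes "jet_O I h N k f" "jet_O I h N k g"
  shows "jet_O I h N k (\<lambda>i t. f i t - g i t)"
  using jet_O_add[OF assms(1) jet_O_minus[OF assms(2)]] by simp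

lemma jet_O_cmult: "jet_O I h N k f \<Longrightarrow> jet_O I h N k (\<lambda>i t. c *\<^sub>R f i t)"
  by (rule jet_O_linear[OF bounded_linear_scaleR_right])

lemma jet_O_pull:
  assumes f: "jet_O I h N k f" and p: "\<And>j. j \<in> J \<Longrightarrow> p j \<in> I"
  shows "jet_O J (\<lambda>j. h (p j)) (\<lambda>j. N (p j)) k (\<lambda>j. f (p j))"
  using f p unfolding jet_O_def by metis

text \<open>The weight is constant in \<open>t\<close> but may grow as \<open>h\<close> tends to 0.
  It is meant for the mass matrix, whose entries have size \<open>1/h\<close>; multiplying by
  \<open>h i ^ l\<close> states the loss of order without negative powers.\<close>

lemma jet_O_weight:
  assumes f: "jet_O I h N l f" and w: "\<And>i. i \<in> I \<Longrightarrow> \<bar>w i\<bar> * h i ^ l \<le> C * h i ^ k"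
  shows "jet_O I h N k (\<lambda>i t. w i *\<^sub>R f i t)"
proof -
  obtain H where H: "\<And>i. i \<in> I \<Longrightarrow> 0 \<le> h i \<and> 0 \<le> N i \<and> h i \<le> H" using jet_O_scale[OF f] by blast
  obtain K f' where F: "K \<ge> 0" "\<And>i. i \<in> I \<Longrightarrow> (f i has_vector_derivative f' i) (at 0)"
    "\<And>i. i \<in> I \<Longrightarrow> norm (f i 0) \<le> K * h i ^ l" "\<And>i. i \<in> I \<Longrightarrow> norm (f' i) \<le> K * h i ^ l * N i"
    using jet_O_E[OF f] by blast
  show ?thesis
  proof (rule jet_O_I[where I=I and h=h and N=N, OF H, where K="K * C"])
    fix i assume i: "i \<in> I"
    show "((\<lambda>t. w i *\<^sub>R f i t) has_vector_derivative w i *\<^sub>R f' i) (at 0)"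
      using bounded_linear.has_vector_derivative[OF bounded_linear_scaleR_right F(2)[OF i]] by simp
    have w: "K * (\<bar>w i\<bar> * h i ^ l) \<le> K * (C * h i ^ k)" by (rule mult_left_mono[OF w[OF i] F(1)])
    then show "norm (w i *\<^sub>R f i 0) \<le> K * C * h i ^ k"
      using mult_left_mono[OF F(3)[OF i] abs_ge_zero[of "w i"]] by (simp add: mult_ac)
    have "K * (\<bar>w i\<bar> * h i ^ l) * N i \<le> K * (C * h i ^ k) * N i" using H[OF i] w by (intro mult_right_mono) auto
    then show "norm (w i *\<^sub>R f' i) \<le> K * C * h i ^ k * N i"
      using mult_left_mono[OF F(4)[OF i] abs_ge_zero[of "w i"]] by (simp add: mult_ac)
  qed
qed

text \<open>Surplus powers of \<open>h\<close> are absorbed by the common bound \<open>H\<close>;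
  for this \<open>jet_O\<close> includes the boundedness of \<open>h\<close>.\<close>

lemma jet_O_mono:
  assumes f: "jet_O I h N l f" and kl: "k \<le> l"
  shows "jet_O I h N k f"
proof -
  obtain H where H: "\<And>i. i \<in> I \<Longrightarrow> 0 \<le> h i \<and> 0 \<le> N i \<and> h i \<le> H" using jet_O_scale[OF f] by blast
  have "jet_O I h N k (\<lambda>i t. 1 *\<^sub>R f i t)"
  proof (rule jet_O_weight[OF f])
    fix i assume i: "i \<in> I"
    have "h i ^ l = h i ^ (l - k) * h i ^ k" using kl by (simp flip: power_add)
    also have "\<dots> \<le> H ^ (l - k) * h i ^ k" using H[OF i] by (intro mult_right_mono power_mono) auto
    finally show "\<bar>1\<bar> * h i ^ l \<le> H ^ (l - k) * h i ^ k" by simp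
  qed
  then show ?thesis by simp
qed

text \<open>A bound \<open>m\<close> on the number of summands that is common to all indices keeps
  the constant uniform.\<close>

lemma jet_O_sum:
  assumes f: "jet_O (Sigma I F) (\<lambda>p. h (fst p)) (\<lambda>p. N (fst p)) k (\<lambda>p. f (fst p) (snd p))"
    and F: "\<And>i. i \<in> I \<Longrightarrow> finite (F i) \<and> F i \<noteq> {} \<and> card (F i) \<le> m"
  shows "jet_O I h N k (\<lambda>i t. \<Sum>j\<in>F i. f i j t)"
proof -
  obtain H where "\<And>p. p \<in> Sigma I F \<Longrightarrow> 0 \<le> h (fst p) \<and> 0 \<le> N (fst p) \<and> h (fst p) \<le> H" using jet_O_scale[OF f] by blast
  \<comment> \<open>Nonemptiness of \<open>F i\<close> provides a pair with first component
    \<open>i\<close>, from which the conditions on \<open>h i\<close> and \<open>N i\<close> are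
    read off.\<close>
  then have H: "0 \<le> h i \<and> 0 \<le> N i \<and> h i \<le> H" if "i \<in> I" for i using F[OF that] that by fastforce
  obtain K f' where D: "K \<ge> 0"
    "\<And>p. p \<in> Sigma I F \<Longrightarrow> (f (fst p) (snd p) has_vector_derivative f' p) (at 0)"
    "\<And>p. p \<in> Sigma I F \<Longrightarrow> norm (f (fst p) (snd p) 0) \<le> K * h (fst p) ^ k"
    "\<And>p. p \<in> Sigma I F \<Longrightarrow> norm (f' p) \<le> K * h (fst p) ^ k * N (fst p)"
    using jet_O_E[OF f] by blast
  show ?thesis
  proof (rule jet_O_I[where I=I and h=h and N=N, OF H, where K="m * K" and f'="\<lambda>i. \<Sum>j\<in>F i. f' (i, j)"])
    fix i assume i: "i \<in> I"
    have m: "real (card (F i)) \<le> real m" using F[OF i] by simp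
    have p: "(i, j) \<in> Sigma I F" if "j \<in> F i" for j using i that by simp
    show "((\<lambda>t. \<Sum>j\<in>F i. f i j t) has_vector_derivative (\<Sum>j\<in>F i. f' (i, j))) (at 0)"
      by (intro has_vector_derivative_sum) (use D(2)[OF p] in simp)
    have "norm (\<Sum>j\<in>F i. f i j 0) \<le> (\<Sum>j\<in>F i. K * h i ^ k)" by (intro sum_norm_le) (use D(3)[OF p] in simp)
    also have "\<dots> \<le> real m * (K * h i ^ k)" using m D(1) H[OF i] by (simp add: mult_right_mono)
    finally show "norm (\<Sum>j\<in>F i. f i j 0) \<le> m * K * h i ^ k" by (simp add: mult.assoc)
    have "norm (\<Sum>j\<in>F i. f' (i, j)) \<le> (\<Sum>j\<in>F i. K * h i ^ k * N i)" by (intro sum_norm_le) (use D(4)[OF p] in simp)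
    also have "\<dots> \<le> real m * (K * h i ^ k * N i)" using m D(1) H[OF i] by (simp add: mult_right_mono)
    finally show "norm (\<Sum>j\<in>F i. f' (i, j)) \<le> m * K * h i ^ k * N i" by (simp add: mult.assoc)
  qed
qed

section \<open>Matrices and the matrix exponential\<close>

lemma norm_matrix_sq:
  fixes X :: "complex^'n^'m"
  shows "(norm X)\<^sup>2 = (\<Sum>i\<in>UNIV. \<Sum>j\<in>UNIV. (norm (X $ i $ j))\<^sup>2)"
  by (simp add: norm_vec_def L2_set_def sum_nonneg)

lemma norm_hconj [simp]: "norm (hconj X) = norm X"
proof -
  have "(norm (hconj X))\<^sup>2 = (norm X)\<^sup>2"
    unfolding norm_matrix_sq by (simp add: hconj_def) (rule sum.swap)
  then show ?thesis by simp
qed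

text \<open>The norm of the vector type is the Frobenius norm, so Cauchy-Schwarz for each entry,
  summed over the entries, gives the bound.\<close>

lemma norm_matrix_mult_le:
  fixes X :: "complex^'n^'m" and Y :: "complex^'k^'n"
  shows "norm (X ** Y) \<le> norm X * norm Y"
proof -
  have 1: "(norm ((X ** Y) $ i $ j))\<^sup>2 \<le> (\<Sum>k\<in>UNIV. (norm (X $ i $ k))\<^sup>2) * (\<Sum>k\<in>UNIV. (norm (Y $ k $ j))\<^sup>2)" for i j
  proof -
    have "norm ((X ** Y) $ i $ j) \<le> (\<Sum>k\<in>UNIV. norm (X $ i $ k) * norm (Y $ k $ j))"
      unfolding matrix_matrix_mult_def by (auto intro!: sum_norm_le simp: norm_mult)
    then have "(norm ((X ** Y) $ i $ j))\<^sup>2 \<le> (\<Sum>k\<in>UNIV. norm (X $ i $ k) * norm (Y $ k $ j))\<^sup>2"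
      by (intro power_mono) auto
    also have "\<dots> \<le> (\<Sum>k\<in>UNIV. (norm (X $ i $ k))\<^sup>2) * (\<Sum>k\<in>UNIV. (norm (Y $ k $ j))\<^sup>2)"
      by (rule Cauchy_Schwarz_ineq_sum)
    finally show ?thesis .
  qed
  have "(norm (X ** Y))\<^sup>2 \<le> (\<Sum>i\<in>UNIV. \<Sum>j\<in>UNIV. (\<Sum>k\<in>UNIV. (norm (X $ i $ k))\<^sup>2) * (\<Sum>k\<in>UNIV. (norm (Y $ k $ j))\<^sup>2))"
    unfolding norm_matrix_sq[of "X ** Y"] by (intro sum_mono 1)
  also have "\<dots> = (\<Sum>i\<in>UNIV. \<Sum>k\<in>UNIV. (norm (X $ i $ k))\<^sup>2) * (\<Sum>j\<in>UNIV. \<Sum>k\<in>UNIV. (norm (Y $ k $ j))\<^sup>2)"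
    by (simp add: sum_product)
  also have "(\<Sum>j\<in>UNIV. \<Sum>k\<in>UNIV. (norm (Y $ k $ j))\<^sup>2) = (\<Sum>k\<in>UNIV. \<Sum>j\<in>UNIV. (norm (Y $ k $ j))\<^sup>2)"
    by (rule sum.swap)
  finally have "(norm (X ** Y))\<^sup>2 \<le> (norm X * norm Y)\<^sup>2"
    by (simp add: norm_matrix_sq power_mult_distrib)
  then show ?thesis by (rule power2_le_imp_le) simp
qed

lemma bounded_bilinear_matrix_mult:
  "bounded_bilinear ((**) :: complex^'n^'m \<Rightarrow> complex^'k^'n \<Rightarrow> complex^'k^'m)"
proof
  fix r :: real and a a' :: "complex^'n^'m" and b b' :: "complex^'k^'n"
  show "(a + a') ** b = a ** b + a' ** b"
    by (simp add: matrix_matrix_mult_def vec_eq_iff sum.distrib distrib_right)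
  show "a ** (b + b') = a ** b + a ** b'" by (rule matrix_add_ldistrib)
  show "(r *\<^sub>R a) ** b = r *\<^sub>R (a ** b)" by (simp add: scalar_matrix_assoc)
  show "a ** (r *\<^sub>R b) = r *\<^sub>R (a ** b)" by (simp add: matrix_scalar_ac scalar_matrix_assoc)
  show "\<exists>K. \<forall>(a :: complex^'n^'m) (b :: complex^'k^'n). norm (a ** b) \<le> norm a * norm b * K"
    using norm_matrix_mult_le by (metis mult.right_neutral)
qed

interpretation mm: bounded_bilinear "(**) :: complex^'n^'m \<Rightarrow> complex^'k^'n \<Rightarrow> complex^'k^'m"
  by (rule bounded_bilinear_matrix_mult)

lemmas mm_simps = mm.add_left mm.add_right mm.diff_left mm.diff_right mm.minus_left mm.minus_right
  mm.scaleR_left mm.scaleR_right matrix_mul_assoc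

lemma bounded_linear_hconj: "bounded_linear (hconj :: complex^'n^'m \<Rightarrow> complex^'m^'n)"
proof
  fix r :: real and a b :: "complex^'n^'m"
  show "hconj (a + b) = hconj a + hconj b" by (simp add: hconj_def vec_eq_iff)
  show "hconj (r *\<^sub>R a) = r *\<^sub>R hconj a" by (simp add: hconj_def vec_eq_iff)
  show "\<exists>K. \<forall>a :: complex^'n^'m. norm (hconj a) \<le> norm a * K" by (auto intro!: exI[of _ 1])
qed

lemma hconj_mat_1 [simp]: "hconj (mat 1) = mat 1"
  by (simp add: hconj_def vec_eq_iff mat_def)

lemma bounded_linear_Re_trace: "bounded_linear (\<lambda>X :: complex^'n^'n. Re (trace X))"
proof -
  have "linear (\<lambda>X :: complex^'n^'n. Re (trace X))"
    by (auto intro!: linearI simp: trace_def sum.distrib scaleR_sum_right sum_distrib_left)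
  then show ?thesis by (simp add: linear_conv_bounded_linear)
qed

lemma bounded_bilinear_commutator:
  "bounded_bilinear (commutator :: complex^'n^'n \<Rightarrow> complex^'n^'n \<Rightarrow> complex^'n^'n)"
proof
  fix r :: real and a a' b b' :: "complex^'n^'n"
  show "commutator (a + a') b = commutator a b + commutator a' b"
    "commutator a (b + b') = commutator a b + commutator a b'"
    "commutator (r *\<^sub>R a) b = r *\<^sub>R commutator a b"
    "commutator a (r *\<^sub>R b) = r *\<^sub>R commutator a b"
    unfolding commutator_def by (simp_all add: mm_simps algebra_simps)
  have "norm (commutator a b) \<le> norm a * norm b * 2" for a b :: "complex^'n^'n"
    unfolding commutator_def
    using norm_triangle_ineq4[of "a ** b" "b ** a"] norm_matrix_mult_le[of a b] norm_matrix_mult_le[of b a]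
    by (simp add: mult_ac)
  then show "\<exists>K. \<forall>(a :: complex^'n^'n) b. norm (commutator a b) \<le> norm a * norm b * K" by blast
qed

section \<open>Power series of the matrix exponential and its Taylor remainder\<close>

abbreviation mpow :: "complex^'n^'n \<Rightarrow> nat \<Rightarrow> complex^'n^'n"
  where "mpow X k \<equiv> ((**) X ^^ k) (mat 1)"

text \<open>The directional derivative of the matrix power. As matrices do not commute, it is given
  by the recursion of the product rule.\<close>

primrec dmpow :: "complex^'n^'n \<Rightarrow> nat \<Rightarrow> complex^'n^'n \<Rightarrow> complex^'n^'n" where
  "dmpow X 0 Y = 0"
| "dmpow X (Suc k) Y = X ** dmpow X k Y + Y ** mpow X k"

lemma has_derivative_mpow: "((\<lambda>X. mpow X k) has_derivative dmpow X k) (at X within s)"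
proof (induction k)
  case 0
  have "dmpow X 0 = (\<lambda>Y. 0)" by (simp add: fun_eq_iff)
  then show ?case by simp
next
  case (Suc k)
  show ?case using mm.FDERIV[OF has_derivative_ident Suc] by simp
qed

lemma norm_mpow_le: "norm (mpow X k) \<le> norm (mat 1 :: complex^'n^'n) * norm (X :: complex^'n^'n) ^ k"
proof (induction k)
  case (Suc k)
  have "norm (mpow X (Suc k)) \<le> norm X * norm (mpow X k)" by (simp add: norm_matrix_mult_le)
  also have "\<dots> \<le> norm X * (norm (mat 1 :: complex^'n^'n) * norm X ^ k)" by (intro mult_left_mono Suc) auto
  finally show ?case by (simp add: mult_ac)
qed simp

text \<open>Unfolding the recursion gives \<open>Suc k\<close> products, each with one factor
  \<open>Y\<close> and \<open>k\<close> factors \<open>X\<close>. Starting at \<open>Suc k\<close>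
  avoids the exponent \<open>k - 1\<close>. The norm of \<open>mat 1\<close> remains, since the
  Frobenius norm of the unit matrix need not be 1.\<close>

lemma norm_dmpow_le:
  "norm (dmpow X (Suc k) Y) \<le> norm (mat 1 :: complex^'n^'n) * Suc k * norm (X :: complex^'n^'n) ^ k * norm Y"
proof (induction k)
  case 0
  show ?case using norm_matrix_mult_le[of Y "mat 1"] by (simp add: mm.zero_right mult_ac)
next
  case (Suc k)
  let ?c = "norm (mat 1 :: complex^'n^'n)"
  have "norm (X ** dmpow X (Suc k) Y) \<le> norm X * norm (dmpow X (Suc k) Y)" by (rule norm_matrix_mult_le)
  also have "\<dots> \<le> norm X * (?c * Suc k * norm X ^ k * norm Y)" by (intro mult_left_mono Suc) auto
  finally have 1: "norm (X ** dmpow X (Suc k) Y) \<le> norm X * (?c * Suc k * norm X ^ k * norm Y)" .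
  have "norm (Y ** mpow X (Suc k)) \<le> norm Y * norm (mpow X (Suc k))" by (rule norm_matrix_mult_le)
  also have "\<dots> \<le> norm Y * (?c * norm X ^ Suc k)" by (intro mult_left_mono norm_mpow_le) auto
  finally have 2: "norm (Y ** mpow X (Suc k)) \<le> norm Y * (?c * norm X ^ Suc k)" .
  have "norm (dmpow X (Suc (Suc k)) Y) \<le> norm (X ** dmpow X (Suc k) Y) + norm (Y ** mpow X (Suc k))"
    by (simp only: dmpow.simps(2)[of X "Suc k"] norm_triangle_ineq)
  then show ?case using 1 2 by (simp add: algebra_simps)
qed

text \<open>Taylor remainder of third order. The quadratic terms are kept apart because the
  commutator in the curvature arises from them.\<close>

definition mexp_rem :: "complex^'n^'n \<Rightarrow> complex^'n^'n"
  where "mexp_rem X = mexp X - (mat 1 + X + (1/2) *\<^sub>R (X ** X))"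

text \<open>The tail of the series, with the index shifted by 3, is dominated by
  \<open>norm X ^ 3\<close> times the scalar exponential series, and its derivative, taken term by
  term, by \<open>norm X ^ 2 * norm Y\<close> times the same series, up to the norm of
  \<open>mat 1\<close>. Uniform convergence of the derivatives on a ball justifies differentiating
  term by term, and on the ball \<open>exp (norm X)\<close> is bounded by a constant.\<close>

lemma mexp_rem_estimate:
  fixes R :: real
  obtains C D where "C \<ge> 0"
    "\<And>X :: complex^'n^'n. norm X < R \<Longrightarrow> (mexp_rem has_derivative D X) (at X)"
    "\<And>X :: complex^'n^'n. norm X < R \<Longrightarrow> norm (mexp_rem X) \<le> C * norm X ^ 3"
    "\<And>(X :: complex^'n^'n) Y. norm X < R \<Longrightarrow> norm (D X Y) \<le> C * norm X ^ 2 * norm Y"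
proof -
  let ?c = "norm (mat 1 :: complex^'n^'n)"
  let ?S = "ball (0 :: complex^'n^'n) R"
  define f where "f k X = (1 / fact (k+3)) *\<^sub>R mpow X (k+3)" for k and X :: "complex^'n^'n"
  define f' where "f' k X Y = (1 / fact (k+3)) *\<^sub>R dmpow X (k+3) Y" for k and X Y :: "complex^'n^'n"
  define D where "D X Y = (\<Sum>k. f' k X Y)" for X Y
  have fact_le: "1 / fact (k+m) \<le> (1 / fact k :: real)" for k m :: nat
    by (intro divide_left_mono) (auto simp: fact_mono)
  \<comment> \<open>Separates the factor \<open>k + 3\<close>, which cancels against the number of
    summands in the derivative of the power.\<close>
  have ff: "(fact (k+3) :: real) = real (k+3) * fact (k+2)" for k
    by (simp add: numeral_3_eq_3 algebra_simps)
  have f'_le: "norm (f' k X Y) \<le> (?c * norm X ^ 2 * norm Y) * (norm X ^ k / fact k)" for k X Y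
  proof -
    have "norm (f' k X Y) \<le> (1 / fact (k+3)) * (?c * real (k+3) * norm X ^ (k+2) * norm Y)"
    proof -
      have 3: "Suc (k+2) = k+3" by simp
      have "norm (dmpow X (k+3) Y) \<le> ?c * real (k+3) * norm X ^ (k+2) * norm Y"
        using norm_dmpow_le[of X "k+2" Y] unfolding 3 .
      then have "(1 / fact (k+3)) * norm (dmpow X (k+3) Y)
          \<le> (1 / fact (k+3)) * (?c * real (k+3) * norm X ^ (k+2) * norm Y)"
        by (rule mult_left_mono) simp
      then show ?thesis by (simp only: f'_def norm_scaleR) simp
    qed
    also have "\<dots> = (1 / fact (k+2)) * (?c * norm X ^ (k+2) * norm Y)"
    proof -
      have "1 / (a * b) * (c * a * u * v) = 1 / b * (c * u * v)" if "a \<noteq> 0" for a b c u v :: real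
        using that by simp
      then show ?thesis unfolding ff by simp
    qed
    also have "\<dots> \<le> (1 / fact k) * (?c * norm X ^ (k+2) * norm Y)"
      by (intro mult_right_mono fact_le) auto
    finally show ?thesis by (simp add: power_add power2_eq_square mult_ac)
  qed
  have f_le: "norm (f k X) \<le> (?c * norm X ^ 3) * (norm X ^ k / fact k)" for k X
  proof -
    have "norm (f k X) \<le> (1 / fact (k+3)) * (?c * norm X ^ (k+3))"
      unfolding f_def using norm_mpow_le[where X=X and k="k+3"] by (simp add: divide_right_mono)
    also have "\<dots> \<le> (1 / fact k) * (?c * norm X ^ (k+3))"
      by (intro mult_right_mono fact_le) auto
    finally show ?thesis by (simp add: power_add power3_eq_cube mult_ac)
  qed
  have exps: "(\<lambda>k. x ^ k / fact k) sums exp x" for x :: real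
    using exp_converges[of x] by (simp add: divide_inverse mult_ac)
  have expsm: "summable (\<lambda>k. a * (x ^ k / fact k))" for a x :: real
    using exps[of x] by (intro summable_mult) (auto simp: sums_iff)
  have expsu: "(\<Sum>k. a * (x ^ k / fact k)) = a * exp x" for a x :: real
    using exps[of x] by (subst suminf_mult) (auto simp: sums_iff)
  have sf': "summable (\<lambda>k. f' k X Y)" for X Y
    by (rule summable_comparison_test'[OF expsm f'_le])
  have sf: "summable (\<lambda>k. f k X)" for X
    by (rule summable_comparison_test'[OF expsm f_le])
  have nD: "norm (D X Y) \<le> (?c * norm X ^ 2 * norm Y) * exp (norm X)" for X Y
    unfolding D_def using norm_suminf_le[OF f'_le expsm] expsu by metis
  have nf: "norm (\<Sum>k. f k X) \<le> (?c * norm X ^ 3) * exp (norm X)" for X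
    using norm_suminf_le[OF f_le expsm] expsu by metis
  have rem: "mexp_rem X = (\<Sum>k. f k X)" for X
  proof -
    let ?g = "\<lambda>k. (1 / fact k) *\<^sub>R mpow X k"
    have "summable ?g" using sf[of X] unfolding f_def by (subst (asm) summable_iff_shift)
    then have "mexp X = (\<Sum>k. f k X) + (\<Sum>k<3. ?g k)"
      unfolding mexp_def f_def by (rule suminf_split_initial_segment)
    then show ?thesis by (simp add: mexp_rem_def numeral_3_eq_3)
  qed
  \<comment> \<open>On the ball the majorant at radius \<open>R\<close> does not depend on
    \<open>X\<close>, so one tail index works for all \<open>X\<close> and \<open>Y\<close>.\<close>
  have uni: "\<forall>\<^sub>F n in sequentially. \<forall>X\<in>?S. \<forall>Y. norm (sum (\<lambda>i. f' i X Y) {..<n} - D X Y) \<le> e * norm Y"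
    if e: "e > 0" for e
  proof -
    let ?r = "\<lambda>k. (?c * R ^ 2) * (R ^ k / fact k)"
    obtain n0 where n0: "\<And>n. n \<ge> n0 \<Longrightarrow> norm (\<Sum>i. ?r (i + n)) < e"
      using suminf_exist_split[OF e expsm] by blast
    have "norm (sum (\<lambda>i. f' i X Y) {..<n} - D X Y) \<le> e * norm Y" if n: "n \<ge> n0" and X: "norm X < R" for n X Y
    proof -
      have "D X Y = (\<Sum>i. f' (i+n) X Y) + sum (\<lambda>i. f' i X Y) {..<n}"
        unfolding D_def by (rule suminf_split_initial_segment[OF sf'])
      then have "norm (sum (\<lambda>i. f' i X Y) {..<n} - D X Y) = norm (\<Sum>i. f' (i+n) X Y)"
        by (simp add: norm_minus_commute)
      also have "\<dots> \<le> (\<Sum>i. ?r (i+n) * norm Y)"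
      proof (rule norm_suminf_le)
        show "norm (f' (i+n) X Y) \<le> ?r (i+n) * norm Y" for i
        proof -
          have "norm X ^ 2 * norm X ^ (i+n) \<le> R ^ 2 * R ^ (i+n)"
            using X by (intro mult_mono power_mono) auto
          then have "(?c / fact (i+n) * norm Y) * (norm X ^ 2 * norm X ^ (i+n)) \<le> (?c / fact (i+n) * norm Y) * (R ^ 2 * R ^ (i+n))"
            by (intro mult_left_mono) auto
          then show ?thesis using f'_le[of "i+n" X Y] by (simp add: mult_ac)
        qed
        show "summable (\<lambda>i. ?r (i+n) * norm Y)"
          by (intro summable_mult2 summable_ignore_initial_segment expsm)
      qed
      also have "\<dots> = (\<Sum>i. ?r (i+n)) * norm Y"
        by (rule suminf_mult2[symmetric]) (intro summable_ignore_initial_segment expsm)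
      also have "\<dots> \<le> e * norm Y"
        using n0[OF n] by (intro mult_right_mono) auto
      finally show ?thesis .
    qed
    then show ?thesis unfolding eventually_sequentially by (intro exI[of _ n0]) auto
  qed
  have der: "(mexp_rem has_derivative D X) (at X)" if X: "norm X < R" for X
  proof -
    have fd: "(f k has_derivative f' k X) (at X within ?S)" for k X
      unfolding f_def f'_def by (intro has_derivative_scaleR_right has_derivative_mpow)
    have "\<exists>g. \<forall>x\<in>?S. (\<lambda>n. f n x) sums (g x) \<and> (g has_derivative D x) (at x within ?S)"
      using has_derivative_series[of ?S f f' D X "\<Sum>n. f n X"] fd uni X sf
      by (auto simp: summable_sums_iff)
    then obtain g where g: "\<And>x. x \<in> ?S \<Longrightarrow> (\<lambda>n. f n x) sums (g x) \<and> (g has_derivative D x) (at x within ?S)"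
      by blast
    have "(g has_derivative D X) (at X)"
      using g[of X] X at_within_open[of X ?S] by simp
    then show ?thesis
      by (rule has_derivative_transform_within_open[of _ _ _ _ ?S]) (use X g in \<open>auto simp: rem sums_iff\<close>)
  qed
  show thesis
  proof (rule that[of "?c * exp R" D])
    show "0 \<le> ?c * exp R" by simp
    show "(mexp_rem has_derivative D X) (at X)" if "norm X < R" for X using der that .
    show "norm (mexp_rem X) \<le> ?c * exp R * norm X ^ 3" if "norm X < R" for X :: "complex^'n^'n"
    proof -
      have "(?c * norm X ^ 3) * exp (norm X) \<le> (?c * norm X ^ 3) * exp R"
        using that by (intro mult_left_mono) auto
      then show ?thesis using nf[of X] by (simp add: rem mult_ac)
    qed
    show "norm (D X Y) \<le> ?c * exp R * norm X ^ 2 * norm Y" if "norm X < R" for X Y :: "complex^'n^'n"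
    proof -
      have "(?c * norm X ^ 2 * norm Y) * exp (norm X) \<le> (?c * norm X ^ 2 * norm Y) * exp R"
        using that by (intro mult_left_mono) auto
      then show ?thesis using nD[of X Y] by (simp add: mult_ac)
    qed
  qed
qed

text \<open>Chain rule: the derivative of the remainder is quadratically small in
  \<open>x i 0\<close> and linear in the derivative of \<open>x\<close>, which together is of order
  3 with one factor \<open>N\<close>.\<close>

lemma jet_O_mexp_rem:
  fixes x :: "'i \<Rightarrow> real \<Rightarrow> complex^'n^'n"
  assumes x: "jet_O I h N 1 x"
  shows "jet_O I h N 3 (\<lambda>i t. mexp_rem (x i t))"
proof -
  obtain H where H: "\<And>i. i \<in> I \<Longrightarrow> 0 \<le> h i \<and> 0 \<le> N i \<and> h i \<le> H" using jet_O_scale[OF x] by blast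
  obtain K x' where X: "K \<ge> 0" "\<And>i. i \<in> I \<Longrightarrow> (x i has_vector_derivative x' i) (at 0)"
    "\<And>i. i \<in> I \<Longrightarrow> norm (x i 0) \<le> K * h i ^ 1" "\<And>i. i \<in> I \<Longrightarrow> norm (x' i) \<le> K * h i ^ 1 * N i"
    using jet_O_E[OF x] by blast
  \<comment> \<open>All \<open>x i 0\<close> have norm at most \<open>K * H\<close>; adding 1 puts
    them inside the open ball, with the same constant \<open>C\<close> for every index.\<close>
  obtain C and D :: "complex^'n^'n \<Rightarrow> complex^'n^'n \<Rightarrow> complex^'n^'n" where C: "C \<ge> 0"
    and D: "\<And>X. norm X < K * H + 1 \<Longrightarrow> (mexp_rem has_derivative D X) (at X)"
    and rem: "\<And>X :: complex^'n^'n. norm X < K * H + 1 \<Longrightarrow> norm (mexp_rem X) \<le> C * norm X ^ 3"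
    and D_le: "\<And>X Y. norm X < K * H + 1 \<Longrightarrow> norm (D X Y) \<le> C * norm X ^ 2 * norm Y"
    using mexp_rem_estimate[of "K * H + 1"] by metis
  show ?thesis
  proof (rule jet_O_I[where I=I and h=h and N=N, OF H, where K="C * K ^ 3"])
    fix i assume i: "i \<in> I"
    have x: "norm (x i 0) \<le> K * h i" "norm (x' i) \<le> K * h i * N i" using X(3,4)[OF i] by auto
    have "K * h i \<le> K * H" using X(1) H[OF i] by (intro mult_left_mono) auto
    with x have n: "norm (x i 0) < K * H + 1" by linarith
    have "((\<lambda>t. mexp_rem (x i t)) has_derivative (\<lambda>s. D (x i 0) (s *\<^sub>R x' i))) (at 0)"
      using has_derivative_compose[OF X(2)[OF i, unfolded has_vector_derivative_def] D[OF n]] .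
    then show "((\<lambda>t. mexp_rem (x i t)) has_vector_derivative D (x i 0) (x' i)) (at 0)"
      unfolding has_vector_derivative_def
      using linear_simps(5)[OF has_derivative_bounded_linear[OF D[OF n]]] by simp
    have p: "norm (x i 0) ^ k \<le> (K * h i) ^ k" for k using x by (intro power_mono) auto
    show "norm (mexp_rem (x i 0)) \<le> C * K ^ 3 * h i ^ 3"
      using rem[OF n] mult_left_mono[OF p[of 3] C] by (simp add: power_mult_distrib)
    have "C * norm (x i 0) ^ 2 * norm (x' i) \<le> C * (K * h i) ^ 2 * (K * h i * N i)"
      using C p[of 2] x X(1) H[OF i] by (intro mult_mono) auto
    then show "norm (D (x i 0) (x' i)) \<le> C * K ^ 3 * h i ^ 3 * N i"
      using D_le[OF n, of "x' i"] by (simp add: power2_eq_square power3_eq_cube mult_ac)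
  qed
qed

text \<open>The second order part of the product of exponentials is half the square of \<open>x + y + z\<close>,
  which is of fourth order, plus half the commutators; as \<open>z = (x + y + z) - x - y\<close>, all of these but
  the commutator of \<open>x\<close> and \<open>y\<close> involve the small sum.\<close>

lemma jet_O_holonomy:
  fixes x y z :: "'i \<Rightarrow> real \<Rightarrow> complex^'n^'n"
  assumes x: "jet_O I h N 1 x" and y: "jet_O I h N 1 y" and z: "jet_O I h N 1 z"
    and s: "jet_O I h N 2 (\<lambda>i t. x i t + y i t + z i t)"
  shows "jet_O I h N 3 (\<lambda>i t. mat 1 - mexp (- z i t) ** mexp (- y i t) ** mexp (- x i t)
    - (x i t + y i t + z i t) - (1/2) *\<^sub>R commutator (x i t) (y i t))"
proof -
  note bil = jet_O_bilinear[OF bounded_bilinear_matrix_mult]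
  note bic = jet_O_bilinear[OF bounded_bilinear_commutator]
  define q where "q w = mat 1 - w + (1/2) *\<^sub>R (w ** w)" for w :: "complex^'n^'n"
  define r where "r w = mexp_rem (- w)" for w :: "complex^'n^'n"
  have e: "mexp (- w) = q w + r w" for w :: "complex^'n^'n"
    by (simp add: q_def r_def mexp_rem_def mm.minus_left mm.minus_right)
  have q: "jet_O I h N 0 (\<lambda>i t. q (w i t))" and r: "jet_O I h N 3 (\<lambda>i t. r (w i t))"
    and e0: "jet_O I h N 0 (\<lambda>i t. mexp (- w i t))" and whitney2_tet: "jet_O I h N 2 (\<lambda>i t. w i t ** w i t)"
    if w: "jet_O I h N 1 w" for w :: "'i \<Rightarrow> real \<Rightarrow> complex^'n^'n"
  proof -
    show whitney2_tet: "jet_O I h N 2 (\<lambda>i t. w i t ** w i t)" using bil[OF w w] by (simp add: numeral_2_eq_2)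
    show q: "jet_O I h N 0 (\<lambda>i t. q (w i t))" unfolding q_def
      by (intro jet_O_add jet_O_diff jet_O_cmult jet_O_const[OF w] jet_O_mono[OF w] jet_O_mono[OF whitney2_tet]) auto
    show r: "jet_O I h N 3 (\<lambda>i t. r (w i t))" unfolding r_def
      by (intro jet_O_mexp_rem jet_O_minus w)
    show "jet_O I h N 0 (\<lambda>i t. mexp (- w i t))" unfolding e
      by (intro jet_O_add q jet_O_mono[OF r]) auto
  qed
  define s' where "s' = (\<lambda>i t. x i t + y i t + z i t)"
  have s': "jet_O I h N 2 s'" using s by (simp add: s'_def)
  \<comment> \<open>The exponentials are replaced by their quadratic parts one at a time; each of
    the three differences has one cubic remainder and otherwise bounded factors.\<close>
  have 1: "jet_O I h N 3 (\<lambda>i t. r (z i t) ** mexp (- y i t) ** mexp (- x i t))"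
    using bil[OF bil[OF r[OF z] e0[OF y]] e0[OF x]] by simp
  have 2: "jet_O I h N 3 (\<lambda>i t. q (z i t) ** r (y i t) ** mexp (- x i t))"
    using bil[OF bil[OF q[OF z] r[OF y]] e0[OF x]] by simp
  have 3: "jet_O I h N 3 (\<lambda>i t. q (z i t) ** q (y i t) ** r (x i t))"
    using bil[OF bil[OF q[OF z] q[OF y]] r[OF x]] by simp
  have 4: "jet_O I h N 3 (\<lambda>i t. s' i t ** s' i t)"
    using jet_O_mono[OF bil[OF s' s'], of 3] by simp
  have 5: "jet_O I h N 3 (\<lambda>i t. commutator (s' i t) (x i t + y i t))"
    using bic[OF s' jet_O_add[OF x y]] by simp
  \<comment> \<open>The terms of degree at most two of the product of \<open>q u\<close> and
    \<open>q v\<close>.\<close>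
  define p where "p u v = mat 1 - u - v + (1/2) *\<^sub>R (u ** u) + (1/2) *\<^sub>R (v ** v) + u ** v"
    for u v :: "complex^'n^'n"
  have q0: "jet_O I h N 0 (\<lambda>i t. q (x i t))" by (rule q[OF x])
  have lin2: "jet_O I h N 2 (\<lambda>i t. w i t ** w' i t)"
    if "jet_O I h N 1 w" "jet_O I h N 1 w'" for w w' :: "'i \<Rightarrow> real \<Rightarrow> complex^'n^'n"
    using bil[OF that] by (simp add: numeral_2_eq_2)
  have b12: "jet_O I h N 3 (\<lambda>i t. w i t ** w' i t)"
    if "jet_O I h N 1 w" "jet_O I h N 2 w'" for w w' :: "'i \<Rightarrow> real \<Rightarrow> complex^'n^'n"
    using bil[OF that] by (simp add: numeral_3_eq_3)
  have b21: "jet_O I h N 3 (\<lambda>i t. w i t ** w' i t)"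
    if "jet_O I h N 2 w" "jet_O I h N 1 w'" for w w' :: "'i \<Rightarrow> real \<Rightarrow> complex^'n^'n"
    using bil[OF that] by (simp add: numeral_3_eq_3)
  have qua: "jet_O I h N 3 (\<lambda>i t. w i t ** w' i t)"
    if "jet_O I h N 2 w" "jet_O I h N 2 w'" for w w' :: "'i \<Rightarrow> real \<Rightarrow> complex^'n^'n"
    using jet_O_mono[OF bil[OF that], of 3] by simp
  have qq: "jet_O I h N 3 (\<lambda>i t. q (z i t) ** q (y i t) - p (z i t) (y i t))"
  proof -
    have "jet_O I h N 3 (\<lambda>i t. - (1/2) *\<^sub>R (z i t ** (y i t ** y i t)) - (1/2) *\<^sub>R ((z i t ** z i t) ** y i t)
      + (1/4) *\<^sub>R ((z i t ** z i t) ** (y i t ** y i t)))"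
      by (intro jet_O_add jet_O_diff jet_O_cmult b12 b21 qua lin2 x y z)
    then show ?thesis
      by (rule jet_O_cong) (simp add: p_def q_def mm_simps algebra_simps)
  qed
  have 6: "jet_O I h N 3 (\<lambda>i t. (q (z i t) ** q (y i t) - p (z i t) (y i t)) ** q (x i t))"
    using bil[OF qq q0] by simp
  have 7: "jet_O I h N 3 (\<lambda>i t. p (z i t) (y i t) ** q (x i t)
     - (mat 1 - s' i t + (1/2) *\<^sub>R (x i t ** x i t + y i t ** y i t + z i t ** z i t)
        + z i t ** y i t + z i t ** x i t + y i t ** x i t))"
  proof -
    \<comment> \<open>The purely quadratic part of \<open>p\<close>: its products with
      \<open>x\<close> and with the square of \<open>x\<close> are of order at least 3.\<close>
    define p2 where "p2 i t = (1/2) *\<^sub>R (z i t ** z i t) + (1/2) *\<^sub>R (y i t ** y i t) + z i t ** y i t" for i t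
    have p2: "jet_O I h N 2 p2" unfolding p2_def
      by (intro jet_O_add jet_O_cmult lin2 y z)
    have "jet_O I h N 3 (\<lambda>i t. - (p2 i t ** x i t) + (1/2) *\<^sub>R (p2 i t ** (x i t ** x i t))
       - (1/2) *\<^sub>R ((z i t + y i t) ** (x i t ** x i t)))"
      by (intro jet_O_add jet_O_diff jet_O_minus jet_O_cmult b21 b12 qua lin2 p2 x y z)
    then show ?thesis
      by (rule jet_O_cong) (simp add: p_def p2_def q_def s'_def mm_simps algebra_simps)
  qed
  have "jet_O I h N 3 (\<lambda>i t.
     - (r (z i t) ** mexp (- y i t) ** mexp (- x i t)) - q (z i t) ** r (y i t) ** mexp (- x i t)
     - q (z i t) ** q (y i t) ** r (x i t)
     - (q (z i t) ** q (y i t) - p (z i t) (y i t)) ** q (x i t)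
     - (p (z i t) (y i t) ** q (x i t)
     - (mat 1 - s' i t + (1/2) *\<^sub>R (x i t ** x i t + y i t ** y i t + z i t ** z i t)
        + z i t ** y i t + z i t ** x i t + y i t ** x i t))
     - (1/2) *\<^sub>R (s' i t ** s' i t) - (1/2) *\<^sub>R commutator (s' i t) (x i t + y i t))"
    by (intro jet_O_add jet_O_diff jet_O_minus jet_O_cmult 1 2 3 4 5 6 7)
  then show ?thesis
  proof (rule jet_O_cong)
    fix i t
    define a b c where "a = x i t" and "b = y i t" and "c = z i t"
    have 1: "mexp (- c) ** mexp (- b) ** mexp (- a) = r c ** mexp (- b) ** mexp (- a) +
       q c ** r b ** mexp (- a) + q c ** q b ** r a + (q c ** q b - p c b) ** q a + p c b ** q a"
      by (simp add: e mm_simps algebra_simps)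
    have 2: "(a ** a + b ** b + c ** c) = (1/2) *\<^sub>R (a ** a + b ** b + c ** c) + (1/2) *\<^sub>R (a ** a + b ** b + c ** c)"
      by (simp flip: scaleR_left_distrib)
    \<comment> \<open>Each mixed product is cut into halves: one half is cancelled by the square of
      the sum, the other is completed to a commutator.\<close>
    have h: "u = (1/2) *\<^sub>R u + (1/2) *\<^sub>R u" for u :: "complex^'n^'n" by (simp flip: scaleR_left_distrib)
    have 3: "(1/2) *\<^sub>R (a ** a + b ** b + c ** c) + c ** b + c ** a + b ** a
       - (1/2) *\<^sub>R ((a + b + c) ** (a + b + c)) - (1/2) *\<^sub>R commutator (a + b + c) (a + b)
       = - (1/2) *\<^sub>R commutator a b"
      unfolding commutator_def
      by (subst h[of "c ** b"], subst h[of "c ** a"], subst h[of "b ** a"]) (simp add: mm_simps algebra_simps)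
    show "- (r (z i t) ** mexp (- y i t) ** mexp (- x i t)) - q (z i t) ** r (y i t) ** mexp (- x i t)
     - q (z i t) ** q (y i t) ** r (x i t)
     - (q (z i t) ** q (y i t) - p (z i t) (y i t)) ** q (x i t)
     - (p (z i t) (y i t) ** q (x i t)
     - (mat 1 - s' i t + (1/2) *\<^sub>R (x i t ** x i t + y i t ** y i t + z i t ** z i t)
        + z i t ** y i t + z i t ** x i t + y i t ** x i t))
     - (1/2) *\<^sub>R (s' i t ** s' i t) - (1/2) *\<^sub>R commutator (s' i t) (x i t + y i t)
     = mat 1 - mexp (- z i t) ** mexp (- y i t) ** mexp (- x i t)
    - (x i t + y i t + z i t) - (1/2) *\<^sub>R commutator (x i t) (y i t)"
      unfolding s'_def a_def[symmetric] b_def[symmetric] c_def[symmetric] 1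
      using 3 by (simp add: algebra_simps)
  qed
qed

section \<open>Barycentric coordinates\<close>

lemma vertices_tetrahedron:
  assumes "3 simplex T"
  shows "finite (vertices T)" "card (vertices T) = 4" "\<not> affine_dependent (vertices T)"
    "T = convex hull (vertices T)" "affine hull (vertices T) = UNIV"
proof -
  obtain C where C: "finite C" "\<not> affine_dependent C" "int (card C) = 3 + 1" "T = convex hull C"
    using assms by (auto simp: simplex)
  then have V: "vertices T = C"
    by (auto simp: vertices_def extreme_point_of_convex_hull_affine_independent)
  have "affine hull C = UNIV"
    by (rule affine_hull_UNIV) (use C in \<open>simp add: aff_dim_affine_independent\<close>)
  then show "finite (vertices T)" "card (vertices T) = 4" "\<not> affine_dependent (vertices T)"
    "T = convex hull (vertices T)" "affine hull (vertices T) = UNIV" unfolding V using C by simp_all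
qed

text \<open>The edge vectors at a vertex \<open>p\<close> are linearly independent, so a linear
  functional can be prescribed on them. Uniqueness holds because two such affine functions agree on
  the affine hull of the vertices, which is the whole space. If \<open>i\<close> is not a vertex,
  the function is 0.\<close>

lemma bary_ex1:
  assumes T: "3 simplex T"
  shows "\<exists>!f. (\<exists>a b. f = (\<lambda>x. a + b \<bullet> x)) \<and> (\<forall>v\<in>vertices T. f v = (if v = i then 1 else 0 :: real))"
proof (rule ex_ex1I)
  note V = vertices_tetrahedron[OF T]
  \<comment> \<open>With \<open>p\<close> different from \<open>i\<close> the prescribed value at
    \<open>p\<close> is 0, as it must be for a linear functional of \<open>x - p\<close>.\<close>
  obtain p where p: "p \<in> vertices T" "p \<noteq> i"
  proof -
    have "\<not> vertices T \<subseteq> {i}"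
      using card_mono[of "{i}" "vertices T"] V(2) by auto
    then show thesis using that by blast
  qed
  have "independent ((\<lambda>x. -p + x) ` (vertices T - {p}))"
    using V(3) affine_dependent_iff_dependent2[OF p(1)] by simp
  then obtain g :: "real^3 \<Rightarrow> real" where g: "linear g"
    "\<And>x. x \<in> (\<lambda>x. -p + x) ` (vertices T - {p}) \<Longrightarrow> g x = (if x = i - p then 1 else 0)"
    using linear_independent_extend[of "(\<lambda>x. -p + x) ` (vertices T - {p})" "\<lambda>x. if x = i - p then 1 else 0 :: real"] by metis
  have gi: "g x = adjoint g 1 \<bullet> x" for x
    using adjoint_works[OF g(1), of x 1] by (simp add: inner_commute)
  have "(\<lambda>x. g (x - p)) = (\<lambda>x. - (adjoint g 1 \<bullet> p) + adjoint g 1 \<bullet> x)"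
    by (simp add: gi inner_diff_right fun_eq_iff)
  moreover have "g (v - p) = (if v = i then 1 else 0)" if "v \<in> vertices T" for v
  proof (cases "v = p")
    case True
    then show ?thesis using p linear_0[OF g(1)] by simp
  next
    case False
    then have "-p + v \<in> (\<lambda>x. -p + x) ` (vertices T - {p})" using that by blast
    from g(2)[OF this] show ?thesis by (simp add: algebra_simps)
  qed
  ultimately show "\<exists>f. (\<exists>a b. f = (\<lambda>x. a + b \<bullet> x)) \<and> (\<forall>v\<in>vertices T. f v = (if v = i then 1 else 0 :: real))"
    by blast
next
  fix f g :: "real^3 \<Rightarrow> real"
  assume f: "(\<exists>a b. f = (\<lambda>x. a + b \<bullet> x)) \<and> (\<forall>v\<in>vertices T. f v = (if v = i then 1 else 0))"
    and g: "(\<exists>a b. g = (\<lambda>x. a + b \<bullet> x)) \<and> (\<forall>v\<in>vertices T. g v = (if v = i then 1 else 0))"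
  obtain a b a' b' where ab: "f = (\<lambda>x. a + b \<bullet> x)" "g = (\<lambda>x. a' + b' \<bullet> x)" using f g by blast
  have "vertices T \<subseteq> {x. (b - b') \<bullet> x = a' - a}"
  proof
    fix x assume "x \<in> vertices T"
    then have "f x = g x" using f g by simp
    then show "x \<in> {x. (b - b') \<bullet> x = a' - a}" by (simp add: ab inner_diff_left)
  qed
  then have "affine hull (vertices T) \<subseteq> {x. (b - b') \<bullet> x = a' - a}"
    by (rule hull_minimal) (rule affine_hyperplane)
  then have c: "(b - b') \<bullet> x = a' - a" for x using vertices_tetrahedron(5)[OF T] by auto
  show "f = g"
  proof
    show "f x = g x" for x using c[of x] by (simp add: ab inner_diff_left)
  qed
qed

definition bgrad :: "(real^3) set \<Rightarrow> real^3 \<Rightarrow> real^3"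
  where "bgrad T i = (SOME b. \<exists>a. bary T i = (\<lambda>x. a + b \<bullet> x))"

context
  fixes T :: "(real^3) set"
  assumes T: "3 simplex T"
begin

lemma bary_affine: "bary T i x = bary T i y + bgrad T i \<bullet> (x - y)"
proof -
  have "\<exists>a. bary T i = (\<lambda>x. a + bgrad T i \<bullet> x)"
  proof -
    have "\<exists>b a. bary T i = (\<lambda>x. a + b \<bullet> x)"
      using theI'[OF bary_ex1[OF T], of i] unfolding bary_def[symmetric] by blast
    then show ?thesis unfolding bgrad_def by (rule someI_ex)
  qed
  then obtain a where "bary T i = (\<lambda>x. a + bgrad T i \<bullet> x)" ..
  then have "bary T i x = a + bgrad T i \<bullet> x" "bary T i y = a + bgrad T i \<bullet> y" by (rule fun_cong)+
  then show ?thesis by (simp only: inner_diff_right)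
qed

lemma bary_vertex: "v \<in> vertices T \<Longrightarrow> bary T i v = (if v = i then 1 else 0)"
  using theI'[OF bary_ex1[OF T], of i] unfolding bary_def[symmetric] by blast

lemma bary_comb:
  assumes "sum u (vertices T) = 1"
  shows "bary T i (\<Sum>v\<in>vertices T. u v *\<^sub>R v) = (if i \<in> vertices T then u i else 0)"
proof -
  have b: "bary T i y = bary T i 0 + bgrad T i \<bullet> y" for y using bary_affine[of i y 0] by simp
  have "(\<Sum>v\<in>vertices T. u v * bary T i v) = (\<Sum>v\<in>vertices T. u v * bary T i 0 + bgrad T i \<bullet> (u v *\<^sub>R v))"
  proof (rule sum.cong)
    fix v
    show "u v * bary T i v = u v * bary T i 0 + bgrad T i \<bullet> (u v *\<^sub>R v)"
      unfolding b[of v] by (simp add: distrib_left)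
  qed simp
  also have "\<dots> = sum u (vertices T) * bary T i 0 + bgrad T i \<bullet> (\<Sum>v\<in>vertices T. u v *\<^sub>R v)"
    by (simp only: sum.distrib sum_distrib_right inner_sum_right)
  also have "\<dots> = bary T i (\<Sum>v\<in>vertices T. u v *\<^sub>R v)"
    using b[of "\<Sum>v\<in>vertices T. u v *\<^sub>R v"] assms by simp
  finally have "bary T i (\<Sum>v\<in>vertices T. u v *\<^sub>R v) = (\<Sum>v\<in>vertices T. u v * bary T i v)" ..
  also have "\<dots> = (\<Sum>v\<in>vertices T. if v = i then u v else 0)"
    by (rule sum.cong) (simp_all add: bary_vertex)
  also have "\<dots> = (if i \<in> vertices T then u i else 0)"
    by (rule sum.delta) (rule vertices_tetrahedron(1)[OF T])
  finally show ?thesis .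
qed

lemma bary_recover: "sum (\<lambda>v. bary T v x) (vertices T) = 1" "(\<Sum>v\<in>vertices T. bary T v x *\<^sub>R v) = x"
proof -
  have "x \<in> affine hull (vertices T)" using vertices_tetrahedron(5)[OF T] by simp
  then obtain u where u: "sum u (vertices T) = 1" "(\<Sum>v\<in>vertices T. u v *\<^sub>R v) = x"
    unfolding affine_hull_finite[OF vertices_tetrahedron(1)[OF T]] by blast
  have b: "bary T v x = u v" if "v \<in> vertices T" for v using bary_comb[OF u(1), of v] that by (simp add: u(2))
  have "sum (\<lambda>v. bary T v x) (vertices T) = sum u (vertices T)" by (rule sum.cong) (simp_all add: b)
  then show "sum (\<lambda>v. bary T v x) (vertices T) = 1" by (simp add: u)
  have "(\<Sum>v\<in>vertices T. bary T v x *\<^sub>R v) = (\<Sum>v\<in>vertices T. u v *\<^sub>R v)"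
    by (rule sum.cong) (simp_all add: b)
  then show "(\<Sum>v\<in>vertices T. bary T v x *\<^sub>R v) = x" by (simp add: u)
qed

lemma bary_bounds:
  assumes "x \<in> T"
  shows "0 \<le> bary T i x" "bary T i x \<le> 1"
proof -
  obtain u where u: "\<forall>v\<in>vertices T. 0 \<le> u v" "sum u (vertices T) = 1" "(\<Sum>v\<in>vertices T. u v *\<^sub>R v) = x"
  proof -
    have "x \<in> convex hull (vertices T)"
      by (rule subst[of T _ "\<lambda>W. x \<in> W", OF vertices_tetrahedron(4)[OF T] assms])
    then show thesis using that unfolding convex_hull_finite[OF vertices_tetrahedron(1)[OF T]] by blast
  qed
  then have "bary T i x = (if i \<in> vertices T then u i else 0)" using bary_comb[OF u(2), of i] by simp
  moreover have "u i \<le> 1" if "i \<in> vertices T"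
    using member_le_sum[of i "vertices T" u] u that vertices_tetrahedron(1)[OF T] by auto
  ultimately show "0 \<le> bary T i x" "bary T i x \<le> 1" using u(1) by auto
qed

lemma bgrad_sum: "sum (bgrad T) (vertices T) = 0"
proof -
  have "(\<Sum>v\<in>vertices T. bgrad T v) \<bullet> x = 0" for x
  proof -
    have b: "bary T v x = bary T v 0 + bgrad T v \<bullet> x" for v using bary_affine[of v x 0] by simp
    have "(\<Sum>v\<in>vertices T. bary T v x) = (\<Sum>v\<in>vertices T. bary T v 0) + (\<Sum>v\<in>vertices T. bgrad T v \<bullet> x)"
      by (simp only: b sum.distrib)
    then show ?thesis by (simp add: bary_recover(1) inner_sum_left)
  qed
  from this[of "sum (bgrad T) (vertices T)"] show ?thesis by simp
qed

text \<open>Subtracting the barycentric representations of \<open>p + x\<close> and of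
  \<open>p\<close> leaves the gradients as coefficients; as these sum to 0, any base point may be
  subtracted from the vertices. In this way linear and bilinear maps are recovered from their values
  on edge vectors.\<close>

lemma bgrad_recover: "(\<Sum>v\<in>vertices T. (bgrad T v \<bullet> x) *\<^sub>R (v - p)) = x"
proof -
  have b: "bary T v (p + x) = bary T v p + bgrad T v \<bullet> x" for v using bary_affine[of v "p + x" p] by simp
  have "x = (\<Sum>v\<in>vertices T. bary T v (p + x) *\<^sub>R v) - (\<Sum>v\<in>vertices T. bary T v p *\<^sub>R v)"
    by (simp add: bary_recover(2))
  also have "\<dots> = (\<Sum>v\<in>vertices T. (bgrad T v \<bullet> x) *\<^sub>R v)"
    by (simp only: b sum.distrib scaleR_left_distrib add_diff_cancel_left')
  also have "\<dots> = (\<Sum>v\<in>vertices T. (bgrad T v \<bullet> x) *\<^sub>R (v - p)) + (sum (bgrad T) (vertices T) \<bullet> x) *\<^sub>R p"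
    by (simp add: algebra_simps sum.distrib sum_subtractf inner_sum_left scaleR_sum_left)
  finally show ?thesis by (simp add: bgrad_sum)
qed

lemma bgrad_diff: "v \<in> vertices T \<Longrightarrow> w \<in> vertices T \<Longrightarrow>
    bgrad T i \<bullet> (v - w) = (if v = i then 1 else 0) - (if w = i then 1 else 0)"
  using bary_affine[of i v w] by (simp add: bary_vertex)

text \<open>Along the diameter of the ball in the direction of the gradient, which has length
  \<open>2 * r\<close>, the coordinate is affine with slope \<open>norm (bgrad T i)\<close> and
  stays between 0 and 1.\<close>

lemma bgrad_bound:
  assumes r: "cball z r \<subseteq> T" "r > 0"
  shows "norm (bgrad T i) \<le> 1 / (2 * r)"
proof (cases "bgrad T i = 0")
  case False
  define e where "e = (r / norm (bgrad T i)) *\<^sub>R bgrad T i"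
  have "norm e = r" using False r by (simp add: e_def)
  then have "z + e \<in> T" "z - e \<in> T" using r by (auto simp: subset_iff dist_norm)
  then have "bary T i (z + e) \<le> 1" "0 \<le> bary T i (z - e)" by (auto intro: bary_bounds)
  moreover have "bary T i (z + e) = bary T i (z - e) + bgrad T i \<bullet> (2 *\<^sub>R e)"
    using bary_affine[of i "z + e" "z - e"] by (simp add: scaleR_2)
  moreover have "bgrad T i \<bullet> (2 *\<^sub>R e) = 2 * r * norm (bgrad T i)"
    using False by (simp add: e_def power2_norm_eq_inner[symmetric] power2_eq_square)
  ultimately have "2 * r * norm (bgrad T i) \<le> 1" by linarith
  then show ?thesis using r by (simp add: field_simps)
qed (use r in simp)

lemma frechet_derivative_bary: "frechet_derivative (bary T i) (at x) v = bgrad T i \<bullet> v"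
proof -
  have eq: "(\<lambda>x. bary T i 0 + bgrad T i \<bullet> x) = bary T i"
  proof
    show "bary T i 0 + bgrad T i \<bullet> x = bary T i x" for x using bary_affine[of i x 0] by simp
  qed
  have "((\<lambda>x. bary T i 0 + bgrad T i \<bullet> x) has_derivative (\<lambda>v. 0 + bgrad T i \<bullet> v)) (at x)"
    by (intro has_derivative_add has_derivative_const bounded_linear_imp_has_derivative
        bounded_linear_inner_right)
  then have "(bary T i has_derivative (\<lambda>v. 0 + bgrad T i \<bullet> v)) (at x)" unfolding eq .
  from frechet_derivative_at[OF this, symmetric] show ?thesis by simp
qed

lemma diameter_tetrahedron_pos: "diameter T > 0"
proof -
  have "\<not> vertices T \<subseteq> {p}" for p
    using card_mono[of "{p}" "vertices T"] vertices_tetrahedron(2)[OF T] by auto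
  then obtain p q where pq: "p \<in> vertices T" "q \<in> vertices T" "p \<noteq> q" by blast
  then have "p \<in> T" "q \<in> T" by (auto simp: vertices_def extreme_point_of_def)
  then have "norm (p - q) \<le> diameter T"
    using diameter_bounded_bound[of T p q] compact_simplex[OF T] by (simp add: compact_imp_bounded dist_norm)
  then show ?thesis using pq by (metis zero_less_norm_iff right_minus_eq less_le_trans)
qed

lemma tetrahedron_interior: "interior T \<noteq> {}" "closure (interior T) = T"
proof -
  have "rel_interior T \<noteq> {}"
    using diameter_tetrahedron_pos convex_simplex[OF T] by (auto simp: rel_interior_eq_empty)
  moreover have "affine hull T = UNIV" by (rule affine_hull_UNIV) (simp add: aff_dim_simplex[OF T])
  ultimately show "interior T \<noteq> {}" using interior_rel_interior_gen[of T] aff_dim_simplex[OF T] by simp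
  then show "closure (interior T) = T"
    using convex_closure_interior[OF convex_simplex[OF T]] closed_simplex[OF T] by simp
qed

end

section \<open>Whitney forms on a single tetrahedron\<close>

lemma simplexesD: "T \<in> simplexes k \<T> \<Longrightarrow> k simplex T" "T \<in> simplexes k \<T> \<Longrightarrow> T \<in> \<T>"
  by (auto simp: simplexes_def)

context
  fixes S :: "(real^3) set" and \<T> T
  assumes mesh: "mesh_of S \<T>" and TT: "T \<in> simplexes 3 \<T>"
begin

lemma mesh_face: "T' \<in> \<T> \<Longrightarrow> T \<inter> T' face_of T \<and> T \<inter> T' face_of T'"
  using mesh TT unfolding mesh_of_def simplicial_complex_def
  by (metis inf.commute simplexesD(2))

text \<open>The intersection is a common face. It meets the interior of \<open>T\<close> and hence
  is all of \<open>T\<close>; then \<open>T\<close> is a face of \<open>T'\<close> that meets the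
  interior of \<open>T'\<close>, and hence is all of \<open>T'\<close>.\<close>

lemma mesh_interior_unique:
  assumes T': "T' \<in> simplexes 3 \<T>" and x: "x \<in> interior T" "x \<in> T'"
  shows "T' = T"
proof -
  have f: "T \<inter> T' face_of T" "T \<inter> T' face_of T'" using mesh_face T' by (auto simp: simplexes_def)
  have TT': "T \<inter> T' = T"
    using face_of_disjoint_interior[OF f(1)] x interior_subset by blast
  then have "T face_of T'" using f by simp
  moreover have "T \<inter> interior T' \<noteq> {}"
    using TT' x interior_mono[of T T'] interior_subset by blast
  ultimately show ?thesis using face_of_disjoint_interior by metis
qed

lemma tet_at_interior: "x \<in> interior T \<Longrightarrow> tet_at \<T> x = T"
  unfolding tet_at_def using mesh_interior_unique TT interior_subset[of T]
  by (intro some_equality) auto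

lemma lam_interior: "x \<in> interior T \<Longrightarrow> lam \<T> i x = bary T i x"
  using interior_subset[of T] TT by (auto simp: lam_def tet_at_interior simplexes_def)

lemma dlam_interior: "x \<in> interior T \<Longrightarrow> dlam \<T> i x v = bgrad T i \<bullet> v"
  using interior_subset[of T] TT
  by (auto simp: dlam_def tet_at_interior simplexes_def frechet_derivative_bary)

lemma tet_at_in: "x \<in> T \<Longrightarrow> tet_at \<T> x \<in> simplexes 3 \<T> \<and> x \<in> tet_at \<T> x"
  unfolding tet_at_def using TT by (rule_tac someI[where x=T]) simp

lemma vertices_subset: "v \<in> vertices T \<Longrightarrow> v \<in> T"
  by (auto simp: vertices_def extreme_point_of_def)

text \<open>The tetrahedron selected at an inner point of the edge need not be \<open>T\<close>, but
  its intersection with \<open>T\<close> is a face of both. A face that contains an inner point of a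
  segment contains the end points, so \<open>i\<close> and \<open>j\<close> are vertices of the
  selected tetrahedron too.\<close>

lemma lam_edge:
  assumes ij: "i \<in> vertices T" "j \<in> vertices T" "i \<noteq> j" and t: "0 < t" "t < 1"
  defines "x \<equiv> i + t *\<^sub>R (j - i)"
  shows "lam \<T> k x = (if k = i then 1 - t else if k = j then t else 0)"
    and "dlam \<T> k x (j - i) = (if k = i then -1 else if k = j then 1 else 0)"
proof -
  have conv: "convex T" using convex_simplex simplexesD(1)[OF TT] by blast
  have xo: "x \<in> open_segment i j"
    unfolding x_def in_segment using ij t by (auto intro!: exI[of _ t] simp: algebra_simps)
  have xT: "x \<in> T"
    using xo conv ij vertices_subset by (meson convex_contains_open_segment subsetD)
  define T' where "T' = tet_at \<T> x"
  have T': "T' \<in> simplexes 3 \<T>" "x \<in> T'" using tet_at_in[OF xT] by (auto simp: T'_def)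
  have f: "T \<inter> T' face_of T" "T \<inter> T' face_of T'" using mesh_face T' by (auto simp: simplexes_def)
  have "i \<in> T \<inter> T' \<and> j \<in> T \<inter> T'"
    using f(1) xo xT T'(2) ij vertices_subset unfolding face_of_def by blast
  then have ij': "i \<in> vertices T'" "j \<in> vertices T'"
    using extreme_point_of_face[OF f(1)] extreme_point_of_face[OF f(2)] ij by (auto simp: vertices_def)
  have T3: "3 simplex T'" using T' simplexesD by blast
  have xU: "x \<in> \<Union>\<T>" using xT TT by (auto simp: simplexes_def)
  have g: "bgrad T' k \<bullet> (j - i) = (if k = i then -1 else if k = j then 1 else 0)"
    using bgrad_diff[OF T3 ij'(2,1), of k] ij by auto
  then show "dlam \<T> k x (j - i) = (if k = i then -1 else if k = j then 1 else 0)"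
    using xU by (simp add: dlam_def frechet_derivative_bary[OF T3] flip: T'_def)
  have "bary T' k x = bary T' k i + t * (bgrad T' k \<bullet> (j - i))"
    using bary_affine[OF T3, of k x i] by (simp add: x_def)
  then show "lam \<T> k x = (if k = i then 1 - t else if k = j then t else 0)"
    using xU g bary_vertex[OF T3 ij'(1), of k] ij(3) by (auto simp: lam_def T'_def[symmetric])
qed

lemma dlam_zero: "x \<in> T \<Longrightarrow> dlam \<T> k x 0 = 0"
  using tet_at_in[of x] by (auto simp: dlam_def simplexesD(1) frechet_derivative_bary)

end

section \<open>Whitney 1-forms split into the value at a centre and the exterior derivative\<close>

definition whitney_centre :: "(real^3) set \<Rightarrow> real^3 \<Rightarrow> (real^3) \<times> (real^3) \<Rightarrow> real^3 \<Rightarrow> real"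
  where "whitney_centre T z = (\<lambda>(k, l) v. bary T k z * (bgrad T l \<bullet> v) - bary T l z * (bgrad T k \<bullet> v))"

text \<open>The wedge product of the two barycentric differentials, which is half the exterior
  derivative of the Whitney form.\<close>

definition whitney_half_d :: "(real^3) set \<Rightarrow> (real^3) \<times> (real^3) \<Rightarrow> real^3 \<Rightarrow> real^3 \<Rightarrow> real"
  where "whitney_half_d T = (\<lambda>(k, l) u v. (bgrad T k \<bullet> u) * (bgrad T l \<bullet> v) - (bgrad T l \<bullet> u) * (bgrad T k \<bullet> v))"

lemma whitney_centre_linear: "whitney_centre T z e (u + v) = whitney_centre T z e u + whitney_centre T z e v" "whitney_centre T z e (r *\<^sub>R v) = r * whitney_centre T z e v"
  by (auto simp: whitney_centre_def inner_add_right algebra_simps split: prod.splits)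

lemma whitney_half_d_bilinear: "whitney_half_d T e (u + u') v = whitney_half_d T e u v + whitney_half_d T e u' v"
  "whitney_half_d T e u (v + v') = whitney_half_d T e u v + whitney_half_d T e u v'" "whitney_half_d T e (r *\<^sub>R u) v = r * whitney_half_d T e u v"
  "whitney_half_d T e u (r *\<^sub>R v) = r * whitney_half_d T e u v"
  by (auto simp: whitney_half_d_def inner_add_right algebra_simps split: prod.splits)

lemma whitney_half_d_antisym: "whitney_half_d T e u v = - whitney_half_d T e v u"
  by (auto simp: whitney_half_d_def split: prod.splits)

lemma whitney1_interior:
  assumes mesh: "mesh_of S \<T>" and T: "T \<in> simplexes 3 \<T>" and x: "x \<in> interior T"
  shows "whitney1 \<T> e x v = whitney_centre T z e v + whitney_half_d T e (x - z) v"
proof (cases e)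
  case (Pair k l)
  define d where "d = x - z"
  have "bary T k x = bary T k z + bgrad T k \<bullet> d" "bary T l x = bary T l z + bgrad T l \<bullet> d"
    using bary_affine simplexesD(1)[OF T] unfolding d_def by blast+
  then show ?thesis unfolding d_def[symmetric]
    by (simp add: Pair whitney1_def lam_interior[OF mesh T x] dlam_interior[OF mesh T x] whitney_centre_def whitney_half_d_def algebra_simps)
qed

text \<open>By antisymmetry the tangential component does not change along the segment, so the
  affine expression may be evaluated at the start point \<open>i\<close>. The end points are
  excluded because the tetrahedron selected there may not contain the segment.\<close>

lemma whitney1_edge:
  assumes mesh: "mesh_of S \<T>" and T: "T \<in> simplexes 3 \<T>"
    and ij: "i \<in> vertices T" "j \<in> vertices T" and t: "0 < t" "t < 1"
  shows "whitney1 \<T> e (i + t *\<^sub>R (j - i)) (j - i) = whitney_centre T z e (j - i) + whitney_half_d T e (i - z) (j - i)"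
proof (cases "i = j")
  case True
  have "whitney_centre T z e 0 = 0" "whitney_half_d T e (i - z) 0 = 0"
    by (auto simp: whitney_centre_def whitney_half_d_def split: prod.splits)
  moreover have "whitney1 \<T> e i 0 = 0"
    using dlam_zero[OF mesh T vertices_subset[OF mesh T ij(1)]] by (auto simp: whitney1_def split: prod.splits)
  ultimately show ?thesis using True by simp
next
  case False
  obtain k l where e: "e = (k, l)" by (cases e)
  have T3: "3 simplex T" using T simplexesD by blast
  have a: "bary T k i = bary T k z + bgrad T k \<bullet> (i - z)" "bary T l i = bary T l z + bgrad T l \<bullet> (i - z)"
    using bary_affine T3 by blast+
  have g: "bgrad T k \<bullet> (j - i) = (if k = i then -1 else if k = j then 1 else 0)"
    "bgrad T l \<bullet> (j - i) = (if l = i then -1 else if l = j then 1 else 0)"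
    using bgrad_diff[OF T3 ij(2,1)] False by auto
  have "whitney_centre T z e (j - i) + whitney_half_d T e (i - z) (j - i)
      = bary T k i * (bgrad T l \<bullet> (j - i)) - bary T l i * (bgrad T k \<bullet> (j - i))"
    by (simp add: e whitney_centre_def whitney_half_d_def a algebra_simps)
  also have "\<dots> = whitney1 \<T> e (i + t *\<^sub>R (j - i)) (j - i)"
    using False by (simp add: e g whitney1_def lam_edge[OF mesh T ij False t] bary_vertex[OF T3 ij(1)])
  finally show ?thesis by simp
qed

text \<open>The interpolant and all members of \<open>Xspace\<close> have this form, so the
  perturbed interpolant moves along a line in the space of edge coefficients.\<close>

definition wcomb :: "(real^3) set set \<Rightarrow> ((real^3) set \<Rightarrow> (real^3) \<times> (real^3)) \<Rightarrow> ((real^3) set \<Rightarrow> 'b) \<Rightarrow> 'b::real_vector form1"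
  where "wcomb \<T> eo c = (\<lambda>x v. \<Sum>e\<in>simplexes 1 \<T>. whitney1 \<T> (eo e) x v *\<^sub>R c e)"

definition centre_part :: "(real^3) set set \<Rightarrow> ((real^3) set \<Rightarrow> (real^3) \<times> (real^3)) \<Rightarrow> (real^3) set \<Rightarrow> real^3 \<Rightarrow>
    ((real^3) set \<Rightarrow> 'b) \<Rightarrow> real^3 \<Rightarrow> 'b::real_vector"
  where "centre_part \<T> eo T z c v = (\<Sum>e\<in>simplexes 1 \<T>. whitney_centre T z (eo e) v *\<^sub>R c e)"

definition half_d :: "(real^3) set set \<Rightarrow> ((real^3) set \<Rightarrow> (real^3) \<times> (real^3)) \<Rightarrow> (real^3) set \<Rightarrow>
    ((real^3) set \<Rightarrow> 'b) \<Rightarrow> real^3 \<Rightarrow> real^3 \<Rightarrow> 'b::real_vector"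
  where "half_d \<T> eo T c u v = (\<Sum>e\<in>simplexes 1 \<T>. whitney_half_d T (eo e) u v *\<^sub>R c e)"

lemma centre_part_linear: "linear (centre_part \<T> eo T z c)"
  by (rule linearI) (auto simp: centre_part_def whitney_centre_linear sum.distrib scaleR_sum_right algebra_simps)

lemma half_d_linear: "linear (half_d \<T> eo T c u)" "linear (\<lambda>u. half_d \<T> eo T c u v)"
  by (rule linearI; auto simp: half_d_def whitney_half_d_bilinear sum.distrib scaleR_sum_right algebra_simps)+

lemma half_d_antisym: "half_d \<T> eo T c u v = - half_d \<T> eo T c v u"
  unfolding half_d_def by (subst whitney_half_d_antisym) (simp add: sum_negf)

lemma half_d_diag: "half_d \<T> eo T c x x = 0"
proof -
  have "whitney_half_d T e x x = 0" for e by (cases e) (simp add: whitney_half_d_def)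
  then show ?thesis by (simp add: half_d_def)
qed

text \<open>Stokes' theorem on a triangle: the constant 2-form \<open>2 *\<^sub>R half_d\<close>
  integrates to \<open>half_d\<close> of the two edge vectors, because a triangle is half a
  parallelogram.\<close>

lemma edge_loop:
  "(centre_part \<T> eo T z c (q - p) + half_d \<T> eo T c (p - z) (q - p)) + (centre_part \<T> eo T z c (s - q) + half_d \<T> eo T c (q - z) (s - q))
     + (centre_part \<T> eo T z c (p - s) + half_d \<T> eo T c (s - z) (p - s)) = half_d \<T> eo T c (q - p) (s - p)"
proof -
  define X Y W where "X = q - p" and "Y = s - p" and "W = p - z"
  have e: "q - z = W + X" "s - z = W + Y" "s - q = Y - X" "p - s = - Y" "q - p = X" "s - p = Y" "p - z = W"
    by (auto simp: X_def Y_def W_def)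
  note ln = linear_add[OF centre_part_linear] linear_diff[OF centre_part_linear] linear_neg[OF centre_part_linear]
    linear_add[OF half_d_linear(1)] linear_diff[OF half_d_linear(1)] linear_neg[OF half_d_linear(1)]
    linear_add[OF half_d_linear(2)] linear_diff[OF half_d_linear(2)] linear_neg[OF half_d_linear(2)]
  show ?thesis unfolding e by (simp add: ln half_d_diag)
qed

lemma centre_part_add_scale: "centre_part \<T> eo T z (\<lambda>e. c e + t *\<^sub>R c' e) v = centre_part \<T> eo T z c v + t *\<^sub>R centre_part \<T> eo T z c' v"
  by (simp add: centre_part_def algebra_simps sum.distrib scaleR_sum_right)

lemma half_d_add_scale: "half_d \<T> eo T (\<lambda>e. c e + t *\<^sub>R c' e) u v = half_d \<T> eo T c u v + t *\<^sub>R half_d \<T> eo T c' u v"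
  by (simp add: half_d_def algebra_simps sum.distrib scaleR_sum_right)

lemma wcomb_add_scale: "wcomb \<T> eo (\<lambda>e. c e + t *\<^sub>R c' e) x v = wcomb \<T> eo c x v + t *\<^sub>R wcomb \<T> eo c' x v"
  by (simp add: wcomb_def algebra_simps sum.distrib scaleR_sum_right)

lemma wcomb_interior:
  assumes "mesh_of S \<T>" "T \<in> simplexes 3 \<T>" "x \<in> interior T"
  shows "wcomb \<T> eo c x v = centre_part \<T> eo T z c v + half_d \<T> eo T c (x - z) v"
  by (simp add: wcomb_def centre_part_def half_d_def whitney1_interior[OF assms, where z=z] scaleR_left_distrib sum.distrib)

lemma edge_integral_wcomb:
  fixes c :: "(real^3) set \<Rightarrow> 'b::banach"
  assumes "mesh_of S \<T>" "T \<in> simplexes 3 \<T>" "i \<in> vertices T" "j \<in> vertices T"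
  shows "edge_integral (wcomb \<T> eo c) j i = centre_part \<T> eo T z c (j - i) + half_d \<T> eo T c (i - z) (j - i)"
proof -
  let ?w = "centre_part \<T> eo T z c (j - i) + half_d \<T> eo T c (i - z) (j - i)"
  have "wcomb \<T> eo c (i + t *\<^sub>R (j - i)) (j - i) = ?w" if "t \<in> {0<..<1}" for t
    using that by (simp add: wcomb_def centre_part_def half_d_def whitney1_edge[OF assms, where z=z] scaleR_left_distrib sum.distrib)
  \<comment> \<open>The formula for the integrand may fail at the two end points of the parameter
    interval, which form a null set.\<close>
  then have "edge_integral (wcomb \<T> eo c) j i = integral {0..1::real} (\<lambda>t. ?w)"
    unfolding edge_integral_def
    by (intro integral_spike[of "{0,1}"]) auto
  then show ?thesis by simp
qed

lemma ext_d_wcomb: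
  fixes c :: "(real^3) set \<Rightarrow> 'b::euclidean_space"
  assumes "mesh_of S \<T>" "T \<in> simplexes 3 \<T>" "x \<in> interior T"
  shows "ext_d (wcomb \<T> eo c) x u v = 2 *\<^sub>R half_d \<T> eo T c u v"
proof -
  have "frechet_derivative (\<lambda>y. wcomb \<T> eo c y v) (at x) u = half_d \<T> eo T c u v" for u v
  proof -
    have bl: "bounded_linear (\<lambda>y. half_d \<T> eo T c y v)"
      using half_d_linear(2) linear_conv_bounded_linear by blast
    have "((\<lambda>y. centre_part \<T> eo T 0 c v + half_d \<T> eo T c y v) has_derivative (\<lambda>u. half_d \<T> eo T c u v)) (at x)"
      using has_derivative_add[OF has_derivative_const bounded_linear_imp_has_derivative[OF bl]] by simp
    then have "((\<lambda>y. wcomb \<T> eo c y v) has_derivative (\<lambda>u. half_d \<T> eo T c u v)) (at x)"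
      by (rule has_derivative_transform_within_open[of _ _ _ _ "interior T"])
        (use assms in \<open>auto simp: wcomb_interior[OF assms(1,2), where z=0]\<close>)
    then show ?thesis by (metis frechet_derivative_at)
  qed
  then show ?thesis
    unfolding ext_d_def using half_d_antisym[of \<T> eo T c v u] by (simp add: scaleR_2)
qed

lemma curvature_wcomb:
  fixes c :: "(real^3) set \<Rightarrow> complex^'n^'n"
  assumes "mesh_of S \<T>" "T \<in> simplexes 3 \<T>" "x \<in> interior T"
  shows "curvature (wcomb \<T> eo c) x u v = 2 *\<^sub>R half_d \<T> eo T c u v +
    commutator (centre_part \<T> eo T z c u + half_d \<T> eo T c (x - z) u) (centre_part \<T> eo T z c v + half_d \<T> eo T c (x - z) v)"
proof -
  \<comment> \<open>The two terms of the bracket of \<open>A\<close> with itself agree, which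
    cancels the factor one half in the curvature.\<close>
  have "form_bracket A A x u v = 2 *\<^sub>R commutator (A x u) (A x v)" for A :: "(complex^'n^'n) form1"
    by (simp add: form_bracket_def commutator_def scaleR_2)
  then show ?thesis
    by (simp add: curvature_def ext_d_wcomb[OF assms] wcomb_interior[OF assms, where z=z])
qed

section \<open>Integrals over a mesh\<close>

lemma lebesgue_integral_spike:
  fixes F G :: "real^3 \<Rightarrow> real"
  assumes N: "negligible N" and F: "integrable lebesgue F" and G: "\<And>x. x \<notin> N \<Longrightarrow> G x = F x"
  shows "integrable lebesgue G" "(LINT x|lebesgue. G x) = (LINT x|lebesgue. F x)"
proof -
  have ai: "f absolutely_integrable_on UNIV \<longleftrightarrow> integrable lebesgue f" for f :: "real^3 \<Rightarrow> real"
    by (simp add: set_integrable_def)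
  have "F absolutely_integrable_on UNIV" using F ai by blast
  then have "G absolutely_integrable_on UNIV"
    by (rule absolutely_integrable_spike[OF _ N]) (use G in auto)
  then show G': "integrable lebesgue G" using ai by blast
  have e: "(LINT x|lebesgue. f x) = integral UNIV f" if "integrable lebesgue f" for f :: "real^3 \<Rightarrow> real"
    using has_integral_integral_lebesgue[OF that] by (simp add: integral_unique)
  show "(LINT x|lebesgue. G x) = (LINT x|lebesgue. F x)"
    unfolding e[OF G'] e[OF F] by (rule integral_spike[OF N]) (use G in auto)
qed

lemma set_integrable_compact:
  fixes f :: "real^3 \<Rightarrow> real"
  assumes "compact T" "continuous_on T f"
  shows "set_integrable lebesgue T f"
proof -
  have "integrable lborel (\<lambda>x. indicator T x *\<^sub>R f x)" by (rule borel_integrable_compact[OF assms])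
  then show ?thesis unfolding set_integrable_def
    by (subst integrable_completion) (auto simp: borel_measurable_integrable)
qed

text \<open>The boundary of a convex set is negligible. Whitney forms are given by polynomials only
  in the interior of a tetrahedron, and this lemma replaces them by the continuous
  extensions.\<close>

lemma set_integral_interior:
  fixes f g :: "real^3 \<Rightarrow> real"
  assumes T: "compact T" "convex T" and g: "continuous_on T g" and fg: "\<And>x. x \<in> interior T \<Longrightarrow> f x = g x"
  shows "set_integrable lebesgue T f" "(LINT x:T|lebesgue. f x) = (LINT x:T|lebesgue. g x)"
proof -
  have fr: "negligible (frontier T)" by (rule negligible_convex_frontier[OF T(2)])
  have "closed T" using T by (simp add: compact_imp_closed)
  then have e: "indicator T x *\<^sub>R f x = indicator T x *\<^sub>R g x" if "x \<notin> frontier T" for x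
    using that fg[of x] by (cases "x \<in> interior T") (auto simp: frontier_def)
  note spike = lebesgue_integral_spike[OF fr set_integrable_compact[OF T(1) g, unfolded set_integrable_def] e]
  show "set_integrable lebesgue T f" unfolding set_integrable_def by (rule spike(1))
  show "(LINT x:T|lebesgue. f x) = (LINT x:T|lebesgue. g x)"
    unfolding set_lebesgue_integral_def by (rule spike(2))
qed

text \<open>The boundaries of the tetrahedra and the simplexes of lower dimension form a negligible
  set; every other point of \<open>S\<close> lies in the interior of exactly one
  tetrahedron.\<close>

lemma mesh_integral:
  fixes f :: "real^3 \<Rightarrow> real"
  assumes mesh: "mesh_of S \<T>" and g: "\<And>T. T \<in> simplexes 3 \<T> \<Longrightarrow> continuous_on T (g T)"
    and fg: "\<And>T x. T \<in> simplexes 3 \<T> \<Longrightarrow> x \<in> interior T \<Longrightarrow> f x = g T x"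
  shows "(LINT x:S|lebesgue. f x) = (\<Sum>T\<in>simplexes 3 \<T>. LINT x:T|lebesgue. g T x)"
proof -
  define M where "M = simplexes 3 \<T>"
  define N where "N = (\<Union>T\<in>M. frontier T) \<union> \<Union>(\<T> - M)"
  have fin: "finite \<T>" "finite M" using mesh unfolding mesh_of_def simplicial_complex_def M_def simplexes_def by auto
  have cl: "closed T" "compact T" "convex T" if "T \<in> M" for T
    using that closed_simplex compact_simplex convex_simplex unfolding M_def simplexes_def by auto
  have "negligible W" if W: "W \<in> \<T> - M" for W
  proof -
    obtain n where n: "n simplex W" using W mesh unfolding mesh_of_def simplicial_complex_def by blast
    then have "n \<noteq> 3" using W by (auto simp: M_def simplexes_def)
    then have "interior W = {}" using aff_dim_simplex[OF n] low_dim_interior[of W] by simp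
    then show ?thesis using negligible_convex_interior convex_simplex[OF n] by blast
  qed
  then have N: "negligible N" unfolding N_def using fin cl
    by (intro negligible_Un negligible_Union) (auto intro: negligible_convex_frontier)
  let ?F = "\<lambda>x. \<Sum>T\<in>M. indicator T x *\<^sub>R g T x"
  have int: "integrable lebesgue (\<lambda>x. indicator T x *\<^sub>R g T x)" if "T \<in> M" for T
    using set_integrable_compact[OF cl(2)[OF that] g] that unfolding M_def set_integrable_def by auto
  have F: "integrable lebesgue ?F" by (intro Bochner_Integration.integrable_sum int)
  have e: "indicator S x *\<^sub>R f x = ?F x" if x: "x \<notin> N" for x
  proof (cases "\<exists>T\<in>M. x \<in> interior T")
    case True
    then obtain T where T: "T \<in> M" "x \<in> interior T" by blast
    then have xT: "x \<in> T" using interior_subset by blast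
    have "x \<in> S" using mesh T unfolding mesh_of_def M_def by auto
    moreover have "?F x = (\<Sum>T'\<in>M. if T' = T then g T x else 0)"
    proof (rule sum.cong)
      fix T' assume "T' \<in> M"
      then have "x \<in> T' \<longleftrightarrow> T' = T"
        using mesh_interior_unique[OF mesh T(1)[unfolded M_def] _ T(2), of T'] xT by (auto simp: M_def)
      then show "indicator T' x *\<^sub>R g T' x = (if T' = T then g T x else 0)" using xT by (cases "T' = T") auto
    qed simp
    ultimately show ?thesis using fg[of T x] T fin by (simp add: M_def)
  next
    case False
    have "x \<notin> T" if "T \<in> M" for T
      using that False x cl(1)[OF that] unfolding N_def frontier_def by auto
    moreover have "x \<notin> W" if "W \<in> \<T> - M" for W using that x by (auto simp: N_def)
    ultimately have "x \<notin> \<Union>\<T>" "?F x = 0" by (auto simp: M_def simplexes_def)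
    moreover have "S \<subseteq> \<Union>\<T>" using mesh closure_subset[of S] unfolding mesh_of_def by simp
    ultimately have "x \<notin> S" "?F x = 0" by auto
    then show ?thesis by simp
  qed
  have "(LINT x:S|lebesgue. f x) = (LINT x|lebesgue. ?F x)"
    unfolding set_lebesgue_integral_def by (rule lebesgue_integral_spike(2)[OF N F e])
  also have "\<dots> = (\<Sum>T\<in>M. LINT x:T|lebesgue. g T x)"
    unfolding set_lebesgue_integral_def by (rule Bochner_Integration.integral_sum) (rule int)
  finally show ?thesis by (simp add: M_def)
qed

lemma set_integral_abs_le:
  fixes f :: "real^3 \<Rightarrow> real"
  assumes "compact T" "continuous_on T f" "\<And>x. x \<in> T \<Longrightarrow> \<bar>f x\<bar> \<le> B"
  shows "\<bar>LINT x:T|lebesgue. f x\<bar> \<le> B * measure lebesgue T"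
proof -
  have "T \<in> lmeasurable" using assms(1) by (rule lmeasurable_compact)
  then have ms: "T \<in> sets lebesgue" "emeasure lebesgue T < \<infinity>" by (auto simp: fmeasurable_def)
  have "\<bar>LINT x:T|lebesgue. f x\<bar> \<le> (LINT x:T|lebesgue. \<bar>f x\<bar>)"
    using set_integral_norm_bound[OF set_integrable_compact[OF assms(1,2)]] by simp
  also have "\<dots> \<le> (LINT x:T|lebesgue. B)"
  proof (rule set_integral_mono)
    show "set_integrable lebesgue T (\<lambda>x. \<bar>f x\<bar>)"
      by (intro set_integrable_compact continuous_on_rabs assms)
    show "set_integrable lebesgue T (\<lambda>x. B)"
      by (intro set_integrable_compact continuous_intros assms)
  qed (use assms in auto)
  also have "\<dots> = B * measure lebesgue T" using ms by (simp add: set_lebesgue_integral_def)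
  finally show ?thesis .
qed

lemma set_integral_const:
  "compact T \<Longrightarrow> (LINT x:T|lebesgue. B :: real) = B * measure lebesgue (T :: (real^3) set)"
  using lmeasurable_compact[of T] by (auto simp: set_lebesgue_integral_def fmeasurable_def)

lemma polynomial_at_0:
  fixes c :: "nat \<Rightarrow> real"
  shows "(\<Sum>m<5. 0 ^ m * c m) = c 0"
    and "((\<lambda>t. \<Sum>m<5. t ^ m * c m) has_vector_derivative c 1) (at 0)"
proof -
  have s: "(\<Sum>m<5. a m) = a 0 + a 1 + a 2 + a 3 + (a 4 :: real)" for a :: "nat \<Rightarrow> real"
    by (simp add: eval_nat_numeral)
  show "(\<Sum>m<5. 0 ^ m * c m) = c 0" by (simp add: s)
  have "((\<lambda>t. c 0 + t * c 1 + t ^ 2 * c 2 + t ^ 3 * c 3 + t ^ 4 * c 4) has_real_derivative c 1) (at 0)"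
    by (auto intro!: derivative_eq_intros)
  then show "((\<lambda>t. \<Sum>m<5. t ^ m * c m) has_vector_derivative c 1) (at 0)"
    by (simp add: s has_real_derivative_iff_has_vector_derivative)
qed

text \<open>The squared curvature is a polynomial of degree four in \<open>t\<close>.
  Differentiation under the integral sign thus reduces to integrating its five coefficients, and the
  derivative at 0 is the linear one.\<close>

lemma has_vector_derivative_polynomial_integral:
  fixes c :: "nat \<Rightarrow> real^3 \<Rightarrow> real"
  assumes T: "compact T" and c: "\<And>m. m < 5 \<Longrightarrow> continuous_on T (c m)"
    and f: "\<And>x t. x \<in> T \<Longrightarrow> f x t = (\<Sum>m<5. t ^ m * c m x)"
  shows "((\<lambda>t. LINT x:T|lebesgue. f x t) has_vector_derivative (LINT x:T|lebesgue. c 1 x)) (at 0)"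
proof -
  have "(LINT x:T|lebesgue. f x t) = (\<Sum>m<5. t ^ m * (LINT x:T|lebesgue. c m x))" for t
  proof -
    have "(LINT x:T|lebesgue. f x t) = (LINT x:T|lebesgue. (\<Sum>m<5. t ^ m * c m x))"
      unfolding set_lebesgue_integral_def by (rule Bochner_Integration.integral_cong) (auto simp: f indicator_def)
    also have "\<dots> = (LINT x|lebesgue. (\<Sum>m<5. t ^ m * (indicator T x *\<^sub>R c m x)))"
      unfolding set_lebesgue_integral_def
      by (rule Bochner_Integration.integral_cong) (auto simp: indicator_def)
    also have "\<dots> = (\<Sum>m<5. LINT x|lebesgue. t ^ m * (indicator T x *\<^sub>R c m x))"
      using set_integrable_compact[OF T c] unfolding set_integrable_def
      by (intro Bochner_Integration.integral_sum integrable_mult_right) auto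
    finally show ?thesis by (simp add: set_lebesgue_integral_def)
  qed
  moreover have "((\<lambda>t. \<Sum>m<5. t ^ m * (LINT x:T|lebesgue. c m x)) has_vector_derivative (LINT x:T|lebesgue. c 1 x)) (at 0)"
    by (rule polynomial_at_0)
  ultimately show ?thesis by simp
qed

text \<open>Estimates that are uniform in the points of \<open>T i\<close> are integrated over a set
  of volume \<open>O(h^3)\<close>, which gains three orders. The polynomial dependence on
  \<open>t\<close> makes the derivative of the integral the integral of the derivatives.\<close>

lemma jet_O_integral:
  fixes f :: "'i \<Rightarrow> real^3 \<Rightarrow> real \<Rightarrow> real"
  assumes f: "jet_O (Sigma I T) (\<lambda>p. h (fst p)) (\<lambda>p. N (fst p)) k (\<lambda>p. f (fst p) (snd p))"
    and T: "\<And>i. i \<in> I \<Longrightarrow> compact (T i) \<and> T i \<noteq> {} \<and> measure lebesgue (T i) \<le> V * h i ^ 3"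
    and poly: "\<And>i. i \<in> I \<Longrightarrow> \<exists>c. (\<forall>m<5. continuous_on (T i) (c m)) \<and>
       (\<forall>x\<in>T i. \<forall>t. f i x t = (\<Sum>m<5. t ^ m * c m x))"
  shows "jet_O I h N (k + 3) (\<lambda>i t. LINT x:T i|lebesgue. f i x t)"
proof -
  obtain H where "\<And>p. p \<in> Sigma I T \<Longrightarrow> 0 \<le> h (fst p) \<and> 0 \<le> N (fst p) \<and> h (fst p) \<le> H"
    using jet_O_scale[OF f] by blast
  then have H: "0 \<le> h i \<and> 0 \<le> N i \<and> h i \<le> H" if "i \<in> I" for i using T[OF that] that by fastforce
  obtain K f' where K: "K \<ge> 0"
    "\<And>p. p \<in> Sigma I T \<Longrightarrow> (f (fst p) (snd p) has_vector_derivative f' p) (at 0)"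
    "\<And>p. p \<in> Sigma I T \<Longrightarrow> norm (f (fst p) (snd p) 0) \<le> K * h (fst p) ^ k"
    "\<And>p. p \<in> Sigma I T \<Longrightarrow> norm (f' p) \<le> K * h (fst p) ^ k * N (fst p)"
    using jet_O_E[OF f] by blast
  show ?thesis
  proof (rule jet_O_I[where I=I and h=h and N=N, OF H, where K="K * V"])
    fix i assume i: "i \<in> I"
    note hN = H[OF i] and Ti = T[OF i]
    define c where "c = (SOME c. (\<forall>m<5. continuous_on (T i) (c m)) \<and> (\<forall>x\<in>T i. \<forall>t. f i x t = (\<Sum>m<5. t ^ m * c m x)))"
    have c: "\<And>m. m < 5 \<Longrightarrow> continuous_on (T i) (c m)" "\<And>x t. x\<in>T i \<Longrightarrow> f i x t = (\<Sum>m<5. t ^ m * c m x)"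
      using someI_ex[OF poly[OF i]] unfolding c_def[symmetric] by blast+
    have f0: "f i x 0 = c 0 x" if "x \<in> T i" for x
      using c(2)[OF that, of 0] polynomial_at_0(1)[of "\<lambda>m. c m x"] by simp
    \<comment> \<open>Uniqueness of the derivative transfers the pointwise bound on
      \<open>f'\<close> to the linear coefficient.\<close>
    have fc: "f' (i, x) = c 1 x" if x: "x \<in> T i" for x
    proof -
      have "f i x = (\<lambda>t. \<Sum>m<5. t ^ m * c m x)" using c(2)[OF x] by auto
      then have "(f i x has_vector_derivative c 1 x) (at 0)" using polynomial_at_0(2)[of "\<lambda>m. c m x"] by simp
      then show ?thesis using vector_derivative_unique_at K(2)[of "(i, x)"] i x by force
    qed
    have b: "\<bar>c 0 x\<bar> \<le> K * h i ^ k" "\<bar>c 1 x\<bar> \<le> K * h i ^ k * N i" if x: "x \<in> T i" for x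
      using K(3,4)[of "(i, x)"] i x f0[OF x] fc[OF x] by auto
    have vol: "a * measure lebesgue (T i) \<le> a * (V * h i ^ 3)" if "a \<ge> 0" for a
      using Ti that by (intro mult_left_mono) auto
    have "\<bar>LINT x:T i|lebesgue. f i x 0\<bar> = \<bar>LINT x:T i|lebesgue. c 0 x\<bar>"
      unfolding set_lebesgue_integral_def
      by (intro arg_cong[where f=abs] Bochner_Integration.integral_cong) (auto simp: f0 indicator_def)
    also have "\<dots> \<le> (K * h i ^ k) * measure lebesgue (T i)"
      by (rule set_integral_abs_le) (use Ti c b in auto)
    also have "\<dots> \<le> (K * h i ^ k) * (V * h i ^ 3)" using K(1) hN by (intro vol) simp
    finally show "norm (LINT x:T i|lebesgue. f i x 0) \<le> K * V * h i ^ (k + 3)" by (simp add: power_add mult_ac)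
    have "\<bar>LINT x:T i|lebesgue. c 1 x\<bar> \<le> (K * h i ^ k * N i) * measure lebesgue (T i)"
      by (rule set_integral_abs_le) (use Ti c b in auto)
    also have "\<dots> \<le> (K * h i ^ k * N i) * (V * h i ^ 3)" using K(1) hN by (intro vol) simp
    finally have d: "norm (LINT x:T i|lebesgue. c 1 x) \<le> K * V * h i ^ (k + 3) * N i" by (simp add: power_add mult_ac)
    have D: "((\<lambda>t. LINT x:T i|lebesgue. f i x t) has_vector_derivative (LINT x:T i|lebesgue. c 1 x)) (at 0)"
      by (rule has_vector_derivative_polynomial_integral) (use Ti c in auto)
    \<comment> \<open>The coefficients are chosen for one \<open>i\<close> at a time, so the
      derivative is passed on as an expression that makes sense for all \<open>i\<close>.\<close>
    show "((\<lambda>t. LINT x:T i|lebesgue. f i x t) has_vector_derivative vector_derivative (\<lambda>t. LINT x:T i|lebesgue. f i x t) (at 0)) (at 0)"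
      "norm (vector_derivative (\<lambda>t. LINT x:T i|lebesgue. f i x t) (at 0)) \<le> K * V * h i ^ (k + 3) * N i"
      unfolding vector_derivative_at[OF D] by (fact D d)+
  qed
qed

lemma measure_cball_3: "r \<ge> 0 \<Longrightarrow> measure lebesgue (cball (z :: real^3) r) = unit_ball_vol 3 * r ^ 3"
  by (simp add: content_cball)

text \<open>The first bound replaces \<open>h^3\<close> by the volume when errors are summed over
  the mesh; the second one bounds integrals over a tetrahedron.\<close>

lemma tetrahedron_volume:
  fixes T :: "(real^3) set"
  assumes T: "3 simplex T" and z: "cball z r \<subseteq> T" "r \<ge> 0"
  shows "unit_ball_vol 3 * r ^ 3 \<le> measure lebesgue T"
    "measure lebesgue T \<le> unit_ball_vol 3 * diameter T ^ 3"
proof -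
  have m: "T \<in> lmeasurable" "cball z s \<in> lmeasurable" for s
    using lmeasurable_compact compact_simplex[OF T] by auto
  show "unit_ball_vol 3 * r ^ 3 \<le> measure lebesgue T"
    using measure_mono_fmeasurable[OF z(1) fmeasurableD[OF m(2)] m(1)] measure_cball_3[OF z(2), of z] by simp
  have "z \<in> T" using z by auto
  then have sub: "T \<subseteq> cball z (diameter T)"
    using diameter_bounded_bound[of T z] compact_simplex[OF T] by (auto simp: compact_imp_bounded)
  show "measure lebesgue T \<le> unit_ball_vol 3 * diameter T ^ 3"
    using measure_mono_fmeasurable[OF sub fmeasurableD[OF m(1)] m(2)]
      measure_cball_3[of "diameter T" z] diameter_tetrahedron_pos[OF T] by simp
qed

section \<open>The interpolant of a smooth form\<close>

lemma norm_le_sum_Basis: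
  fixes f :: "real^3 \<Rightarrow> 'b::real_normed_vector"
  assumes f: "linear f" and B: "\<And>u. u \<in> Basis \<Longrightarrow> norm (f u) \<le> B"
  shows "norm (f v) \<le> 3 * B * norm v"
proof -
  have "f v = (\<Sum>u\<in>Basis. (v \<bullet> u) *\<^sub>R f u)"
    by (subst euclidean_representation[of v, symmetric]) (simp only: linear_sum[OF f] linear_scale[OF f])
  also have "norm \<dots> \<le> (\<Sum>u\<in>(Basis :: (real^3) set). norm v * B)"
    by (intro sum_norm_le) (use B Basis_le_norm in \<open>auto intro!: mult_mono\<close>)
  finally show ?thesis by (simp add: mult_ac)
qed

text \<open>By compactness the values and first derivatives are bounded for arguments in the basis,
  and linearity reduces all other arguments to these. \<open>S\<close> need not be convex, so the
  Lipschitz bound is restricted to convex sets \<open>T\<close>: the mean value inequality applies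
  in the interior, and continuity extends it to the closure.\<close>

lemma smooth_form1_bounds:
  fixes A :: "'b::real_normed_vector form1"
  assumes A: "A \<in> smooth_form1 S V" and S: "open S" "bounded S"
  obtains L where "L \<ge> 0" "\<And>x v. x \<in> closure S \<Longrightarrow> norm (A x v) \<le> L * norm v"
    "\<And>T x y v. convex T \<Longrightarrow> interior T \<subseteq> S \<Longrightarrow> closure (interior T) = T \<Longrightarrow> x \<in> T \<Longrightarrow> y \<in> T \<Longrightarrow>
       norm (A x v - A y v) \<le> L * norm (x - y) * norm v"
    "\<And>v. continuous_on (closure S) (\<lambda>x. A x v)"
proof -
  have lin: "linear (A x)" if "x \<in> closure S" for x using A that by (auto simp: smooth_form1_def)
  have "\<exists>D. (\<forall>x\<in>closure S. D [] x = A x v) \<and> (\<forall>vs. continuous_on (closure S) (D vs)) \<and>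
       (\<forall>vs. \<forall>x\<in>S. (D vs has_derivative (\<lambda>v. D (v # vs) x)) (at x))" for v
    using A unfolding smooth_form1_def smooth_up_to_boundary_def by blast
  from choice[OF allI[OF this]] obtain D where
    D': "\<forall>v. (\<forall>x\<in>closure S. D v [] x = A x v) \<and> (\<forall>vs. continuous_on (closure S) (D v vs)) \<and>
       (\<forall>vs. \<forall>x\<in>S. (D v vs has_derivative (\<lambda>w. D v (w # vs) x)) (at x))" ..
  have D: "\<And>v x. x \<in> closure S \<Longrightarrow> D v [] x = A x v"
    "\<And>v vs. continuous_on (closure S) (D v vs)"
    "\<And>v vs x. x \<in> S \<Longrightarrow> (D v vs has_derivative (\<lambda>w. D v (w # vs) x)) (at x)"
    using D' by blast+
  have cS: "compact (closure S)" using S by (simp add: compact_closure)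
  have bdd: "\<exists>B. \<forall>x\<in>closure S. norm (D v vs x) \<le> B" for v vs
    using compact_imp_bounded[OF compact_continuous_image[OF D(2)[of v vs] cS]] unfolding bounded_iff by simp
  define B where "B v vs = (SOME B. \<forall>x\<in>closure S. norm (D v vs x) \<le> B)" for v vs
  have B: "norm (D v vs x) \<le> B v vs" if "x \<in> closure S" for v vs x
    using someI_ex[OF bdd, of v vs] that unfolding B_def by blast
  define M where "M = (\<Sum>u\<in>Basis. \<bar>B u []\<bar>) + (\<Sum>u\<in>Basis. \<Sum>w\<in>Basis. \<bar>B u [w]\<bar>)"
  have M0: "M \<ge> 0" unfolding M_def by (intro add_nonneg_nonneg sum_nonneg) auto
  have M1: "\<bar>B u []\<bar> \<le> M" if "u \<in> Basis" for u
  proof -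
    have "\<bar>B u []\<bar> \<le> (\<Sum>u\<in>Basis. \<bar>B u []\<bar>)" by (rule member_le_sum[OF that]) auto
    also have "\<dots> \<le> M" unfolding M_def by (rule le_add_same_cancel1[THEN iffD2]) (intro sum_nonneg abs_ge_zero)
    finally show ?thesis .
  qed
  have M2: "\<bar>B u [w]\<bar> \<le> M" if "u \<in> Basis" "w \<in> Basis" for u w
  proof -
    have "\<bar>B u [w]\<bar> \<le> (\<Sum>w\<in>Basis. \<bar>B u [w]\<bar>)" by (rule member_le_sum[OF that(2)]) auto
    also have "\<dots> \<le> (\<Sum>u\<in>Basis. \<Sum>w\<in>Basis. \<bar>B u [w]\<bar>)"
      by (rule member_le_sum[OF that(1)]) (auto intro: sum_nonneg)
    also have "\<dots> \<le> M" unfolding M_def by (rule le_add_same_cancel2[THEN iffD2]) (intro sum_nonneg abs_ge_zero)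
    finally show ?thesis .
  qed
  show thesis
  \<comment> \<open>Two passages from basis vectors to general vectors, one for the direction of
    differentiation and one for \<open>v\<close>, contribute a factor 3 each.\<close>
  proof (rule that[of "9 * M"])
    show "9 * M \<ge> 0" using M0 by simp
    show "norm (A x v) \<le> 9 * M * norm v" if x: "x \<in> closure S" for x v
    proof -
      have "norm (A x u) \<le> M" if "u \<in> Basis" for u
        using B[OF x, of u "[]"] D(1)[OF x, of u] M1[OF that] by simp
      then have "norm (A x v) \<le> 3 * M * norm v" by (rule norm_le_sum_Basis[OF lin[OF x]])
      also have "\<dots> \<le> 9 * M * norm v" using M0 by (intro mult_right_mono) auto
      finally show ?thesis .
    qed
    show "continuous_on (closure S) (\<lambda>x. A x v)" for v
      using D(2)[of v "[]"] D(1) by (simp cong: continuous_on_cong)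
    fix T x y v assume T: "convex T" "interior T \<subseteq> S" "closure (interior T) = T" and xy: "x \<in> T" "y \<in> T"
    have TS: "T \<subseteq> closure S" using closure_mono[OF T(2)] T(3) by simp
    have "norm (A x u - A y u) \<le> 3 * M * norm (x - y)" if u: "u \<in> Basis" for u
    proof -
      have "(3 * M)-lipschitz_on (interior T) (D u [])"
      proof (rule lipschitz_onI)
        fix a b assume ab: "a \<in> interior T" "b \<in> interior T"
        have "norm (D u [] a - D u [] b) \<le> 3 * M * norm (a - b)"
        proof (rule differentiable_bound[OF convex_interior[OF T(1)]])
          fix p assume p: "p \<in> interior T"
          then have pS: "p \<in> S" "p \<in> closure S" using T closure_subset by auto
          show der: "(D u [] has_derivative (\<lambda>w. D u [w] p)) (at p within interior T)"
            using D(3)[OF pS(1), of u "[]"] by (rule has_derivative_at_withinI)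
          have l: "linear (\<lambda>w. D u [w] p)" using has_derivative_linear[OF D(3)[OF pS(1), of u "[]"]] .
          show "onorm (\<lambda>w. D u [w] p) \<le> 3 * M"
          proof (rule onorm_le)
            show "norm (D u [w] p) \<le> 3 * M * norm w" for w
            proof (rule norm_le_sum_Basis[OF l])
              show "norm (D u [w] p) \<le> M" if "w \<in> Basis" for w
                using B[OF pS(2), of u "[w]"] M2[OF u that] by simp
            qed
          qed
        qed (use ab in auto)
        then show "dist (D u [] a) (D u [] b) \<le> 3 * M * dist a b" by (simp add: dist_norm)
      qed (use M0 in simp)
      then have "(3 * M)-lipschitz_on T (D u [])"
        using lipschitz_on_closure[of "3 * M" "interior T" "D u []"] T(3) continuous_on_subset[OF D(2) TS] by simp
      from lipschitz_onD[OF this xy] show ?thesis 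
        unfolding dist_norm D(1)[OF subsetD[OF TS xy(1)]] D(1)[OF subsetD[OF TS xy(2)]] .
    qed
    then have "norm (A x v - A y v) \<le> 3 * (3 * M * norm (x - y)) * norm v"
      by (intro norm_le_sum_Basis[of "\<lambda>v. A x v - A y v"] linear_compose_sub lin) (use xy TS in auto)
    then show "norm (A x v - A y v) \<le> 9 * M * norm (x - y) * norm v" by simp
  qed
qed

lemma interpolant_wcomb:
  "interpolant \<T> eo A = wcomb \<T> eo (\<lambda>e. case eo e of (i, j) \<Rightarrow> edge_integral A j i)"
  by (auto simp: interpolant_def wcomb_def fun_eq_iff split: prod.splits intro!: sum.cong)

lemma whitney1_on_edge:
  assumes mesh: "mesh_of S \<T>" and T: "T \<in> simplexes 3 \<T>"
    and ij: "i \<in> vertices T" "j \<in> vertices T" "i \<noteq> j" and t: "0 < t" "t < 1"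
  shows "whitney1 \<T> e (i + t *\<^sub>R (j - i)) (j - i) = (if e = (i, j) then 1 else if e = (j, i) then -1 else 0)"
  by (cases e) (use ij(3) in \<open>auto simp: whitney1_def lam_edge[OF mesh T ij t]\<close>)

text \<open>Edge integrals are dual to Whitney forms: only the summand of the edge itself survives,
  as an edge is determined by its end points. Two cases arise because \<open>eo\<close> may orient
  the edge either way.\<close>

lemma edge_integral_wcomb_edge:
  fixes c :: "(real^3) set \<Rightarrow> 'b::banach"
  assumes mesh: "mesh_of S \<T>" and T: "T \<in> simplexes 3 \<T>" and eo: "edge_orientation \<T> eo"
    and ij: "i \<in> vertices T" "j \<in> vertices T" "i \<noteq> j"
  defines "e0 \<equiv> convex hull {i, j}"
  shows "eo e0 = (i, j) \<and> edge_integral (wcomb \<T> eo c) j i = c e0 \<or>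
         eo e0 = (j, i) \<and> edge_integral (wcomb \<T> eo c) i j = c e0"
proof -
  have T3: "3 simplex T" using T simplexesD by blast
  note V = vertices_tetrahedron[OF T3]
  have "e0 face_of T"
  proof -
    have "convex hull {i, j} face_of convex hull (vertices T)"
      unfolding face_of_convex_hull_affine_independent[OF V(3)] using ij by (intro exI[of _ "{i, j}"]) simp
    then show ?thesis unfolding e0_def V(4)[symmetric] .
  qed
  moreover have "\<forall>F S. S \<in> \<T> \<and> F face_of S \<longrightarrow> F \<in> \<T>"
    using mesh unfolding mesh_of_def simplicial_complex_def by simp
  ultimately have "e0 \<in> \<T>" using simplexesD(2)[OF T] by blast
  moreover have "1 simplex e0" using one_simplex_segment[OF ij(3)] by (simp add: e0_def segment_convex_hull)
  ultimately have e0: "e0 \<in> simplexes 1 \<T>" by (simp add: simplexes_def)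
  have v0: "vertices e0 = {i, j}" by (auto simp: e0_def vertices_def extreme_point_of_convex_hull_2)
  have uniq: "e = e0" if e: "e \<in> simplexes 1 \<T>" "eo e = (i, j) \<or> eo e = (j, i)" for e
  proof -
    have ve: "vertices e = {i, j}"
      using bspec[OF eo[unfolded edge_orientation_def] e(1)] e(2) by (elim disjE) (simp_all add: insert_commute)
    obtain C where C: "\<not> affine_dependent C" "e = convex hull C"
      using e(1) by (auto simp: simplexes_def simplex_def)
    have "vertices (convex hull C) = C"
      using C(1) by (auto simp: vertices_def extreme_point_of_convex_hull_affine_independent)
    then have "C = {i, j}" using ve unfolding C(2) by simp
    then show ?thesis unfolding e0_def using C(2) by simp
  qed
  have fin: "finite (simplexes 1 \<T>)" using mesh unfolding mesh_of_def simplicial_complex_def simplexes_def by auto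
  have *: "edge_integral (wcomb \<T> eo c) q p = c e0"
    if pq: "p \<in> vertices T" "q \<in> vertices T" "p \<noteq> q" "{p, q} = {i, j}" and e: "eo e0 = (p, q)" for p q
  proof -
    have "wcomb \<T> eo c (p + t *\<^sub>R (q - p)) (q - p) = c e0" if t: "0 < t" "t < 1" for t
    proof -
      have "wcomb \<T> eo c (p + t *\<^sub>R (q - p)) (q - p) = (\<Sum>e\<in>simplexes 1 \<T>. if e = e0 then c e0 else 0)"
        unfolding wcomb_def
      proof (rule sum.cong)
        fix e' assume e': "e' \<in> simplexes 1 \<T>"
        show "whitney1 \<T> (eo e') (p + t *\<^sub>R (q - p)) (q - p) *\<^sub>R c e' = (if e' = e0 then c e0 else 0)"
        proof (cases "e' = e0")
          case True
          then show ?thesis by (simp add: whitney1_on_edge[OF mesh T pq(1-3) t] e)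
        next
          case False
          then have "eo e' \<noteq> (i, j)" "eo e' \<noteq> (j, i)" using uniq[OF e'] by blast+
          then have "eo e' \<noteq> (p, q)" "eo e' \<noteq> (q, p)" using pq(4) by (auto simp only: doubleton_eq_iff)
          then show ?thesis using False by (simp add: whitney1_on_edge[OF mesh T pq(1-3) t])
        qed
      qed simp
      then show ?thesis using fin e0 by simp
    qed
    then have "edge_integral (wcomb \<T> eo c) q p = integral {0..1::real} (\<lambda>t. c e0)"
      unfolding edge_integral_def by (intro integral_spike[of "{0,1}"]) auto
    then show ?thesis by simp
  qed
  have "eo e0 = (i, j) \<or> eo e0 = (j, i)"
  proof -
    obtain k l where kl: "eo e0 = (k, l)" by (cases "eo e0")
    then have "{i, j} = {k, l}" using bspec[OF eo[unfolded edge_orientation_def] e0] v0 by simp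
    then show ?thesis unfolding kl by (simp only: doubleton_eq_iff prod.inject) blast
  qed
  then show ?thesis using *[of i j] *[of j i] ij by auto
qed

text \<open>By the Lipschitz bound the integrand differs from its value at the start point by at
  most \<open>L * h\<close> times the length of the edge.\<close>

lemma edge_integral_approx:
  fixes A :: "'b::banach form1"
  assumes T: "convex T" "i \<in> T" "j \<in> T" and d: "norm (j - i) \<le> h"
    and c: "continuous_on T (\<lambda>x. A x (j - i))"
    and L: "L \<ge> 0" "\<And>x y v. x \<in> T \<Longrightarrow> y \<in> T \<Longrightarrow> norm (A x v - A y v) \<le> L * norm (x - y) * norm v"
  shows "norm (edge_integral A j i - A i (j - i)) \<le> L * h ^ 2"
proof -
  have in_T: "i + t *\<^sub>R (j - i) \<in> T" if "t \<in> {0..1}" for t :: real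
  proof -
    have "(1 - t) *\<^sub>R i + t *\<^sub>R j \<in> T" using that T by (intro convexD_alt) auto
    then show ?thesis by (simp add: algebra_simps)
  qed
  have c': "continuous_on {0..1} (\<lambda>t. A (i + t *\<^sub>R (j - i)) (j - i))"
    by (rule continuous_on_compose2[OF c]) (use in_T in \<open>auto intro!: continuous_intros\<close>)
  then have co: "continuous_on {0..1} (\<lambda>t. A (i + t *\<^sub>R (j - i)) (j - i) - A i (j - i))"
    by (intro continuous_intros)
  have "norm (integral {0..1} (\<lambda>t. A (i + t *\<^sub>R (j - i)) (j - i) - A i (j - i))) \<le> L * h ^ 2 * (1 - 0)"
  proof (rule integral_bound[OF _ co])
    fix t :: real assume t: "t \<in> {0..1}"
    have h0: "h \<ge> 0" using d norm_ge_zero order_trans by blast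
    have "norm (A (i + t *\<^sub>R (j - i)) (j - i) - A i (j - i)) \<le> L * norm (t *\<^sub>R (j - i)) * norm (j - i)"
      using L(2)[OF in_T[OF t] T(2)] by simp
    also have "\<dots> \<le> L * (1 * h) * h"
      using L(1) d t h0 by (intro mult_mono mult_left_mono) (auto intro: mult_left_le_one_le[THEN order_trans])
    finally show "norm (A (i + t *\<^sub>R (j - i)) (j - i) - A i (j - i)) \<le> L * h ^ 2"
      by (simp add: power2_eq_square mult_ac)
  qed auto
  moreover have "integral {0..1} (\<lambda>t. A (i + t *\<^sub>R (j - i)) (j - i) - A i (j - i)) = edge_integral A j i - A i (j - i)"
    unfolding edge_integral_def
    by (subst Henstock_Kurzweil_Integration.integral_diff) (use c' in \<open>auto intro: integrable_continuous_real\<close>)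
  ultimately show ?thesis by simp
qed

lemma interpolant_bounds:
  fixes A :: "'b::euclidean_space form1" and z :: "real^3"
  assumes mesh: "mesh_of S \<T>" and TT: "T \<in> simplexes 3 \<T>" and eo: "edge_orientation \<T> eo"
    and z: "cball z (r * diameter T) \<subseteq> T" "r > 0" and H: "diameter T \<le> H"
    and lin: "\<And>x. x \<in> closure S \<Longrightarrow> linear (A x)"
    and L: "L \<ge> 0" "\<And>x v. x \<in> closure S \<Longrightarrow> norm (A x v) \<le> L * norm v"
      "\<And>x y v. x \<in> T \<Longrightarrow> y \<in> T \<Longrightarrow> norm (A x v - A y v) \<le> L * norm (x - y) * norm v"
    and cont: "\<And>v. continuous_on (closure S) (\<lambda>x. A x v)"
  defines "b \<equiv> \<lambda>e. case eo e of (i, j) \<Rightarrow> edge_integral A j i"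
  shows "norm (half_d \<T> eo T b u v) \<le> 32 * L / r ^ 2 * norm u * norm v"
    and "norm (centre_part \<T> eo T z b v) \<le> 2 / r * (L + 2 * L * H + 32 * L / r ^ 2 * H) * norm v"
proof -
  have T: "3 simplex T" using TT simplexesD by blast
  note V = vertices_tetrahedron[OF T]
  define h where "h = diameter T"
  have h0: "h > 0" using diameter_tetrahedron_pos[OF T] by (simp add: h_def)
  have TS: "T \<subseteq> closure S" using mesh TT by (auto simp: mesh_of_def simplexes_def)
  have dist: "norm (x - y) \<le> h" if "x \<in> T" "y \<in> T" for x y
    using diameter_bounded_bound[of T x y] that compact_simplex[OF T] by (simp add: compact_imp_bounded h_def dist_norm)
  have VT: "v \<in> T" if "v \<in> vertices T" for v using vertices_subset[OF mesh TT that] .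
  have zT: "z \<in> T" using z h0 by (auto simp: h_def)
  define eps where "eps i j = centre_part \<T> eo T z b (j - i) + half_d \<T> eo T b (i - z) (j - i)" for i j
  note bx = half_d_diag[of \<T> eo T b]
  have eps_anti: "eps j i = - eps i j" for i j
  proof -
    have 1: "centre_part \<T> eo T z b (i - j) = - centre_part \<T> eo T z b (j - i)"
      using linear_neg[OF centre_part_linear, of \<T> eo T z b "j - i"] by simp
    have 2: "half_d \<T> eo T b (j - z) (i - j) = half_d \<T> eo T b (i - z) (i - j) + half_d \<T> eo T b (j - i) (i - j)"
    proof -
      have "j - z = (i - z) + (j - i)" by simp
      then show ?thesis by (simp only: linear_add[OF half_d_linear(2)])
    qed
    have 3: "half_d \<T> eo T b x (i - j) = - half_d \<T> eo T b x (j - i)" for x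
      using linear_neg[OF half_d_linear(1), of \<T> eo T b x "j - i"] by simp
    show ?thesis unfolding eps_def 1 2 by (simp add: 3 bx)
  qed
  have e1: "norm (edge_integral A j i - A i (j - i)) \<le> L * h ^ 2" if "i \<in> vertices T" "j \<in> vertices T" for i j
    by (rule edge_integral_approx[OF convex_simplex[OF T] VT VT dist _ L(1,3)])
      (use that VT continuous_on_subset[OF cont TS] in auto)
  have l2: "norm (A x w - A y w) \<le> L * h ^ 2" if "x \<in> T" "y \<in> T" "norm w \<le> h" for x y w
  proof -
    have "norm (A x w - A y w) \<le> L * norm (x - y) * norm w" by (rule L(3)) (use that in auto)
    also have "\<dots> \<le> L * h * h" using L(1) dist that h0 by (intro mult_mono mult_left_mono) auto
    finally show ?thesis by (simp add: power2_eq_square)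
  qed
  \<comment> \<open>The factor 2 covers the reversed orientation, where the form is frozen at
    \<open>j\<close> and moving to \<open>i\<close> costs another \<open>L * h ^ 2\<close>.\<close>
  have approx: "norm (eps i j - A i (j - i)) \<le> 2 * L * h ^ 2" if ij: "i \<in> vertices T" "j \<in> vertices T" for i j
  proof (cases "i = j")
    case True
    have "A i 0 = 0" using linear_0[OF lin] VT ij TS by auto
    moreover have "eps i i = 0" by (simp add: eps_def linear_0[OF centre_part_linear] linear_0[OF half_d_linear(1)])
    ultimately show ?thesis using True L(1) by simp
  next
    case False
    have e: "edge_integral (wcomb \<T> eo b) q p = eps p q" if "p \<in> vertices T" "q \<in> vertices T" for p q
      unfolding eps_def by (rule edge_integral_wcomb[OF mesh TT that])
    from edge_integral_wcomb_edge[OF mesh TT eo ij False, of b]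
    consider "eps i j = edge_integral A j i" | "eps j i = edge_integral A i j"
      unfolding e[OF ij] e[OF ij(2,1)] by (auto simp: b_def)
    then show ?thesis
    proof cases
      case 1
      have "0 \<le> L * h ^ 2" using L(1) by simp
      then show ?thesis using e1[OF ij] unfolding 1 by linarith
    next
      case 2
      have n: "A j (i - j) = - A j (j - i)"
        using linear_neg[OF lin, of j "j - i"] VT[OF ij(2)] TS by auto
      have "eps i j - A i (j - i) = - (edge_integral A i j - A j (i - j)) + (A j (j - i) - A i (j - i))"
        using eps_anti[of i j] 2 n by simp
      also have "norm \<dots> \<le> norm (edge_integral A i j - A j (i - j)) + norm (A j (j - i) - A i (j - i))"
        using norm_triangle_ineq[of "- (edge_integral A i j - A j (i - j))"] by (simp only: norm_minus_cancel)
      also have "\<dots> \<le> L * h ^ 2 + L * h ^ 2"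
        using e1[OF ij(2,1)] l2[of j i "j - i"] VT ij dist by (intro add_mono) auto
      finally show ?thesis by simp
    qed
  qed
  obtain p where p: "p \<in> vertices T" using V(2) by (metis card.empty equals0I zero_neq_numeral)
  \<comment> \<open>The constant 8 counts three edges with error \<open>2 * L * h ^ 2\<close> each
    and two changes of the base point to \<open>p\<close>.\<close>
  have loop: "norm (half_d \<T> eo T b (j - p) (k - p)) \<le> 8 * L * h ^ 2" if jk: "j \<in> vertices T" "k \<in> vertices T" for j k
  proof -
    have "eps p j + eps j k + eps k p = half_d \<T> eo T b (j - p) (k - p)"
      unfolding eps_def by (rule edge_loop)
    moreover have "A p (j - p) + A p (k - j) + A p (p - k) = 0"
    proof -
      have l: "linear (A p)" using lin VT[OF p] TS by auto
      have "A p (j - p) + A p (k - j) + A p (p - k) = A p ((j - p) + (k - j) + (p - k))"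
        by (simp only: linear_add[OF l])
      also have "(j - p) + (k - j) + (p - k) = 0" by simp
      finally show ?thesis using linear_0[OF l] by simp
    qed
    ultimately have "half_d \<T> eo T b (j - p) (k - p) = (eps p j - A p (j - p)) + (eps j k - A j (k - j)) + (eps k p - A k (p - k))
       + (A j (k - j) - A p (k - j)) + (A k (p - k) - A p (p - k))" by (simp add: algebra_simps)
    also have "norm \<dots> \<le> 2 * L * h ^ 2 + 2 * L * h ^ 2 + 2 * L * h ^ 2 + L * h ^ 2 + L * h ^ 2"
      by (intro norm_triangle_mono approx l2 dist VT jk p)
    finally show ?thesis by simp
  qed
  define g where "g = 1 / (2 * (r * h))"
  have g0: "g > 0" using h0 z by (simp add: g_def)
  have gb: "\<bar>bgrad T v \<bullet> x\<bar> \<le> g * norm x" for v x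
  proof -
    have "\<bar>bgrad T v \<bullet> x\<bar> \<le> norm (bgrad T v) * norm x" by (rule Cauchy_Schwarz_ineq2)
    also have "\<dots> \<le> g * norm x"
      using bgrad_bound[OF T z(1), of v] z(2) h0 by (intro mult_right_mono) (auto simp: g_def h_def)
    finally show ?thesis .
  qed
  have be_le: "norm (half_d \<T> eo T b u v) \<le> 32 * L / r ^ 2 * norm u * norm v" for u v
  proof -
    have "half_d \<T> eo T b u v = half_d \<T> eo T b (\<Sum>j\<in>vertices T. (bgrad T j \<bullet> u) *\<^sub>R (j - p)) (\<Sum>k\<in>vertices T. (bgrad T k \<bullet> v) *\<^sub>R (k - p))"
      by (simp only: bgrad_recover[OF T])
    also have "\<dots> = (\<Sum>j\<in>vertices T. (bgrad T j \<bullet> u) *\<^sub>R (\<Sum>k\<in>vertices T. (bgrad T k \<bullet> v) *\<^sub>R half_d \<T> eo T b (j - p) (k - p)))"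
    proof -
      have 1: "half_d \<T> eo T b (\<Sum>j\<in>vertices T. (bgrad T j \<bullet> u) *\<^sub>R (j - p)) w
          = (\<Sum>j\<in>vertices T. (bgrad T j \<bullet> u) *\<^sub>R half_d \<T> eo T b (j - p) w)" for w
        by (simp only: linear_sum[OF half_d_linear(2)] linear_scale[OF half_d_linear(2)])
      have 2: "half_d \<T> eo T b w (\<Sum>k\<in>vertices T. (bgrad T k \<bullet> v) *\<^sub>R (k - p))
          = (\<Sum>k\<in>vertices T. (bgrad T k \<bullet> v) *\<^sub>R half_d \<T> eo T b w (k - p))" for w
        by (simp only: linear_sum[OF half_d_linear(1)] linear_scale[OF half_d_linear(1)])
      show ?thesis unfolding 1 unfolding 2 ..
    qed
    also have "norm \<dots> \<le> (\<Sum>j\<in>vertices T. (g * norm u) * (\<Sum>k\<in>vertices T. (g * norm v) * (8 * L * h ^ 2)))"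
    proof (intro sum_norm_le)
      fix j assume j: "j \<in> vertices T"
      have "norm (\<Sum>k\<in>vertices T. (bgrad T k \<bullet> v) *\<^sub>R half_d \<T> eo T b (j - p) (k - p))
          \<le> (\<Sum>k\<in>vertices T. (g * norm v) * (8 * L * h ^ 2))"
        by (intro sum_norm_le) (use j loop gb g0 in \<open>auto intro!: mult_mono simp del: mult_le_cancel_left\<close>)
      then show "norm ((bgrad T j \<bullet> u) *\<^sub>R (\<Sum>k\<in>vertices T. (bgrad T k \<bullet> v) *\<^sub>R half_d \<T> eo T b (j - p) (k - p)))
          \<le> (g * norm u) * (\<Sum>k\<in>vertices T. (g * norm v) * (8 * L * h ^ 2))"
        unfolding norm_scaleR using gb g0 by (intro mult_mono) auto
    qed
    \<comment> \<open>There are 16 pairs of vertices with 8 each; since \<open>(g * h) ^ 2\<close>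
      is \<open>1 / (4 * r ^ 2)\<close>, the constant becomes 32.\<close>
    also have "\<dots> = 128 * L * (g * h) ^ 2 * norm u * norm v"
      by (simp add: V(2) power2_eq_square)
    also have "g * h = 1 / (2 * r)" using h0 z(2) by (simp add: g_def)
    finally show ?thesis by (simp add: power2_eq_square)
  qed
  then show "norm (half_d \<T> eo T b u v) \<le> 32 * L / r ^ 2 * norm u * norm v" .
  define Kb where "Kb = 32 * L / r ^ 2"
  have Kb0: "Kb \<ge> 0" using L(1) by (simp add: Kb_def)
  have al_p: "norm (centre_part \<T> eo T z b (j - p)) \<le> (L + 2 * L * H + Kb * H) * h" if j: "j \<in> vertices T" for j
  proof -
    have nj: "norm (j - p) \<le> h" "norm (p - z) \<le> h" using dist VT j p zT by auto
    have hh: "h * h \<le> H * h" using H h0 by (intro mult_right_mono) (auto simp: h_def)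
    have "centre_part \<T> eo T z b (j - p) = (eps p j - A p (j - p)) + A p (j - p) - half_d \<T> eo T b (p - z) (j - p)"
      by (simp add: eps_def)
    also have "norm \<dots> \<le> norm (eps p j - A p (j - p)) + norm (A p (j - p)) + norm (half_d \<T> eo T b (p - z) (j - p))"
      by (intro norm_triangle_le_diff add_mono norm_triangle_ineq) auto
    also have "\<dots> \<le> 2 * L * h ^ 2 + L * h + Kb * h * h"
    proof (intro add_mono)
      show "norm (eps p j - A p (j - p)) \<le> 2 * L * h ^ 2" by (rule approx[OF p j])
      show "norm (A p (j - p)) \<le> L * h"
        using L(2)[of p "j - p"] VT[OF p] TS mult_left_mono[OF nj(1) L(1)] by force
      have "Kb * norm (p - z) * norm (j - p) \<le> Kb * h * h"
        using nj Kb0 h0 by (intro mult_mono mult_left_mono) auto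
      then show "norm (half_d \<T> eo T b (p - z) (j - p)) \<le> Kb * h * h"
        using be_le[of "p - z" "j - p"] by (simp add: Kb_def)
    qed
    also have "\<dots> \<le> (L + 2 * L * H + Kb * H) * h"
      using mult_left_mono[OF hh, of "2 * L"] mult_left_mono[OF hh Kb0] L(1)
      by (simp add: power2_eq_square algebra_simps)
    finally show ?thesis .
  qed
  have "centre_part \<T> eo T z b v = centre_part \<T> eo T z b (\<Sum>j\<in>vertices T. (bgrad T j \<bullet> v) *\<^sub>R (j - p))"
    by (simp only: bgrad_recover[OF T])
  also have "\<dots> = (\<Sum>j\<in>vertices T. (bgrad T j \<bullet> v) *\<^sub>R centre_part \<T> eo T z b (j - p))"
    by (simp only: linear_sum[OF centre_part_linear] linear_scale[OF centre_part_linear])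
  also have "norm \<dots> \<le> (\<Sum>j\<in>vertices T. (g * norm v) * ((L + 2 * L * H + Kb * H) * h))"
    by (intro sum_norm_le) (use al_p gb g0 in \<open>auto intro!: mult_mono simp del: mult_le_cancel_left\<close>)
  also have "\<dots> = 4 * (g * h) * (L + 2 * L * H + Kb * H) * norm v" by (simp add: V(2))
  also have "g * h = 1 / (2 * r)" using h0 z(2) by (simp add: g_def)
  finally show "norm (centre_part \<T> eo T z b v) \<le> 2 / r * (L + 2 * L * H + 32 * L / r ^ 2 * H) * norm v"
    by (simp add: Kb_def)
qed

section \<open>Whitney 2-forms on a tetrahedron\<close>

definition wedge2 :: "(real^3) set \<Rightarrow> real^3 \<Rightarrow> real^3 \<Rightarrow> real^3 \<Rightarrow> real^3 \<Rightarrow> real"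
  where "wedge2 T j k u v = (bgrad T j \<bullet> u) * (bgrad T k \<bullet> v) - (bgrad T j \<bullet> v) * (bgrad T k \<bullet> u)"

text \<open>The polynomial that gives the Whitney 2-form inside \<open>T\<close>, taken on the whole
  space; it does not depend on \<open>tet_at\<close> and is continuous up to the boundary.\<close>

definition whitney2_tet :: "(real^3) set \<Rightarrow> (real^3) \<times> (real^3) \<times> (real^3) \<Rightarrow> real form2"
  where "whitney2_tet T = (\<lambda>(i, j, k) x u v.
    2 * (bary T i x * wedge2 T j k u v - bary T j x * wedge2 T i k u v + bary T k x * wedge2 T i j u v))"

lemma whitney2_interior:
  assumes mesh: "mesh_of S \<T>" and T: "T \<in> simplexes 3 \<T>" and x: "x \<in> interior T"
  shows "whitney2 \<T> f x u v = whitney2_tet T f x u v"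
  by (cases f) (simp add: whitney2_def whitney2_tet_def wedge_def wedge2_def lam_interior[OF mesh T x] dlam_interior[OF mesh T x])

lemma continuous_on_bary: "3 simplex T \<Longrightarrow> continuous_on X (bary T i)"
proof -
  assume T: "3 simplex T"
  have "bary T i x = bary T i 0 + bgrad T i \<bullet> x" for x using bary_affine[OF T, of i x 0] by simp
  then have eq: "(\<lambda>x. bary T i 0 + bgrad T i \<bullet> x) = bary T i" by (intro ext) (rule sym)
  have "continuous_on X (\<lambda>x. bary T i 0 + bgrad T i \<bullet> x)" by (intro continuous_intros)
  then show ?thesis unfolding eq .
qed

lemma continuous_on_whitney2_tet: "3 simplex T \<Longrightarrow> continuous_on X (\<lambda>x. whitney2_tet T f x u v)"
  by (cases f) (auto simp: whitney2_tet_def intro!: continuous_intros continuous_on_bary)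

text \<open>Under each transposition both the Whitney form and the value of \<Omega> change sign, so
  the product depends neither on the orientation nor on the distinguished vertex of the
  face.\<close>

lemma whitney2_tet_face_sym:
  fixes \<Omega> :: "real^3 \<Rightarrow> real^3 \<Rightarrow> 'b::real_vector" and T :: "(real^3) set" and x u v :: "real^3"
  assumes l: "\<And>u. linear (\<Omega> u)" "\<And>v. linear (\<lambda>u. \<Omega> u v)" and a: "\<And>u v. \<Omega> u v = - \<Omega> v u"
  defines "tm \<equiv> \<lambda>(i, j, k). whitney2_tet T (i, j, k) x u v *\<^sub>R \<Omega> (j - i) (k - i)"
  shows "tm (j, i, k) = tm (i, j, k)" "tm (i, k, j) = tm (i, j, k)"
proof -
  have d: "\<Omega> w w = 0" for w
  proof -
    have "2 *\<^sub>R \<Omega> w w = 0" unfolding scaleR_2 by (subst (2) a) simp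
    then show ?thesis by simp
  qed
  have w: "whitney2_tet T (j, i, k) x u v = - whitney2_tet T (i, j, k) x u v" "whitney2_tet T (i, k, j) x u v = - whitney2_tet T (i, j, k) x u v"
    by (simp_all add: whitney2_tet_def wedge2_def algebra_simps)
  have "\<Omega> (i - j) (k - j) = - \<Omega> (j - i) (k - i)"
  proof -
    have e: "i - j = - (j - i)" "k - j = (k - i) - (j - i)" by auto
    have "\<Omega> (- p) (q - p) = - \<Omega> p q" for p q
      by (simp only: linear_diff[OF l(1)] linear_neg[OF l(2)] d) simp
    then show ?thesis unfolding e by blast
  qed
  then show "tm (j, i, k) = tm (i, j, k)" by (simp add: tm_def w)
  show "tm (i, k, j) = tm (i, j, k)" using a[of "k - i" "j - i"] by (simp add: tm_def w)
qed

text \<open>In the frame of the edge vectors at \<open>a\<close>, which is dual to the gradients at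
  the other vertices, the coefficient of each of \<open>O12\<close>, \<open>O13\<close>,
  \<open>O23\<close> combines two faces, and in this combination the parts that depend on
  \<open>x\<close> cancel.\<close>

lemma whitney2_tet_complete_ordered:
  fixes \<Omega> :: "real^3 \<Rightarrow> real^3 \<Rightarrow> 'b::real_vector"
  assumes T: "3 simplex T" and V: "vertices T = {a, b, c, d}" "distinct [a, b, c, d]"
    and l: "\<And>u. linear (\<Omega> u)" "\<And>v. linear (\<lambda>u. \<Omega> u v)" and as: "\<And>u v. \<Omega> u v = - \<Omega> v u"
  shows "whitney2_tet T (b, c, d) x u v *\<^sub>R \<Omega> (c - b) (d - b) + whitney2_tet T (a, c, d) x u v *\<^sub>R \<Omega> (c - a) (d - a)
       + whitney2_tet T (a, b, d) x u v *\<^sub>R \<Omega> (b - a) (d - a) + whitney2_tet T (a, b, c) x u v *\<^sub>R \<Omega> (b - a) (c - a)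
       = 2 *\<^sub>R \<Omega> u v"
proof -
  have dd: "\<Omega> w w = 0" for w
  proof -
    have "2 *\<^sub>R \<Omega> w w = 0" unfolding scaleR_2 by (subst (2) as) simp
    then show ?thesis by simp
  qed
  define e1 e2 e3 where "e1 = b - a" and "e2 = c - a" and "e3 = d - a"
  define O12 O13 O23 where "O12 = \<Omega> e1 e2" and "O13 = \<Omega> e1 e3" and "O23 = \<Omega> e2 e3"
  have rev: "\<Omega> e2 e1 = - O12" "\<Omega> e3 e1 = - O13" "\<Omega> e3 e2 = - O23"
    unfolding O12_def O13_def O23_def by (rule as)+
  define u1 u2 u3 where "u1 = bgrad T b \<bullet> u" and "u2 = bgrad T c \<bullet> u" and "u3 = bgrad T d \<bullet> u"
  define v1 v2 v3 where "v1 = bgrad T b \<bullet> v" and "v2 = bgrad T c \<bullet> v" and "v3 = bgrad T d \<bullet> v"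
  have u: "u = u1 *\<^sub>R e1 + u2 *\<^sub>R e2 + u3 *\<^sub>R e3"
    using bgrad_recover[OF T, of u a] V(2) unfolding V(1) by (simp add: u1_def u2_def u3_def e1_def e2_def e3_def add.assoc)
  have v: "v = v1 *\<^sub>R e1 + v2 *\<^sub>R e2 + v3 *\<^sub>R e3"
    using bgrad_recover[OF T, of v a] V(2) unfolding V(1) by (simp add: v1_def v2_def v3_def e1_def e2_def e3_def add.assoc)
  have g0: "bgrad T a = - bgrad T b - bgrad T c - bgrad T d"
    using bgrad_sum[OF T] V(2) unfolding V(1) by (simp add: algebra_simps eq_neg_iff_add_eq_0)
  have l0: "bary T a x = 1 - bary T b x - bary T c x - bary T d x"
    using bary_recover(1)[OF T, of x] V(2) unfolding V(1) by simp
  have Ouv: "\<Omega> u v = (u1 * v2 - u2 * v1) *\<^sub>R O12 + (u1 * v3 - u3 * v1) *\<^sub>R O13 + (u2 * v3 - u3 * v2) *\<^sub>R O23"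
  proof -
    have "\<Omega> u v = \<Omega> (u1 *\<^sub>R e1 + u2 *\<^sub>R e2 + u3 *\<^sub>R e3) (v1 *\<^sub>R e1 + v2 *\<^sub>R e2 + v3 *\<^sub>R e3)"
      by (rule arg_cong2[OF u v])
    also have "\<dots> = (u1 * v2 - u2 * v1) *\<^sub>R O12 + (u1 * v3 - u3 * v1) *\<^sub>R O13 + (u2 * v3 - u3 * v2) *\<^sub>R O23"
      by (simp add: linear_add[OF l(1)] linear_scale[OF l(1)] linear_add[OF l(2)] linear_scale[OF l(2)] dd rev
          flip: O12_def O13_def O23_def) (simp add: algebra_simps)
    finally show ?thesis .
  qed
  have Obcd: "\<Omega> (c - b) (d - b) = O23 - O13 + O12"
  proof -
    have e: "c - b = e2 - e1" "d - b = e3 - e1" by (auto simp: e1_def e2_def e3_def)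
    show ?thesis unfolding e
      by (simp only: linear_diff[OF l(1)] linear_diff[OF l(2)] dd rev flip: O12_def O13_def O23_def) simp
  qed
  have whitney2_tet: "whitney2_tet T (b, c, d) x u v + whitney2_tet T (a, b, c) x u v = 2 * (u1 * v2 - u2 * v1)"
    "whitney2_tet T (a, b, d) x u v - whitney2_tet T (b, c, d) x u v = 2 * (u1 * v3 - u3 * v1)"
    "whitney2_tet T (b, c, d) x u v + whitney2_tet T (a, c, d) x u v = 2 * (u2 * v3 - u3 * v2)"
    by (simp_all add: whitney2_tet_def wedge2_def l0 g0 inner_diff_left flip: u1_def u2_def u3_def v1_def v2_def v3_def)
      (simp_all add: algebra_simps)
  have "whitney2_tet T (b, c, d) x u v *\<^sub>R (O23 - O13 + O12) + whitney2_tet T (a, c, d) x u v *\<^sub>R O23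
       + whitney2_tet T (a, b, d) x u v *\<^sub>R O13 + whitney2_tet T (a, b, c) x u v *\<^sub>R O12
      = (whitney2_tet T (b, c, d) x u v + whitney2_tet T (a, b, c) x u v) *\<^sub>R O12
       + (whitney2_tet T (a, b, d) x u v - whitney2_tet T (b, c, d) x u v) *\<^sub>R O13
       + (whitney2_tet T (b, c, d) x u v + whitney2_tet T (a, c, d) x u v) *\<^sub>R O23"
    by (simp add: algebra_simps)
  then show ?thesis unfolding Obcd Ouv whitney2_tet
    by (simp add: O12_def O13_def O23_def e1_def e2_def e3_def scaleR_add_right)
qed

section \<open>Faces of a tetrahedron and the mass matrix\<close>

context
  fixes S :: "(real^3) set" and \<T> T
  assumes mesh: "mesh_of S \<T>" and TT: "T \<in> simplexes 3 \<T>"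
begin

text \<open>By affine independence the faces correspond to the subsets of the vertices, and a
  triangle omits exactly one of four. That it belongs to the mesh follows from closedness of a
  simplicial complex under faces.\<close>

lemma faces_eq: "faces \<T> T = (\<lambda>p. convex hull (vertices T - {p})) ` vertices T"
  and vertices_face: "p \<in> vertices T \<Longrightarrow> vertices (convex hull (vertices T - {p})) = vertices T - {p}"
proof -
  have T: "3 simplex T" using TT simplexesD by blast
  note V = vertices_tetrahedron[OF T]
  have ind: "\<not> affine_dependent C" if "C \<subseteq> vertices T" for C
    using V(3) that affine_independent_subset by blast
  have vc: "vertices (convex hull C) = C" if "C \<subseteq> vertices T" for C
    using ind[OF that] by (auto simp: vertices_def extreme_point_of_convex_hull_affine_independent)
  then show "vertices (convex hull (vertices T - {p})) = vertices T - {p}" if "p \<in> vertices T" by blast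
  have fc: "f face_of T \<longleftrightarrow> (\<exists>C. C \<subseteq> vertices T \<and> f = convex hull C)" for f
    using face_of_convex_hull_affine_independent[OF V(3), of f] unfolding V(4)[symmetric] .
  have closed: "f \<in> \<T>" if "f face_of T" for f
  proof -
    have "\<forall>F S. S \<in> \<T> \<and> F face_of S \<longrightarrow> F \<in> \<T>"
      using mesh unfolding mesh_of_def simplicial_complex_def by simp
    then show ?thesis using that simplexesD(2)[OF TT] by blast
  qed
  show "faces \<T> T = (\<lambda>p. convex hull (vertices T - {p})) ` vertices T"
  proof (intro equalityI subsetI)
    fix f assume "f \<in> faces \<T> T"
    then have f: "2 simplex f" "f face_of T" by (auto simp: faces_def simplexes_def)
    obtain C where C: "C \<subseteq> vertices T" "f = convex hull C" using f(2) fc by blast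
    obtain C' where C': "\<not> affine_dependent C'" "int (card C') = 2 + 1" "f = convex hull C'"
      using f(1) by (auto simp: simplex_def)
    have "vertices f = C'" unfolding C'(3) using C'(1)
      by (auto simp: vertices_def extreme_point_of_convex_hull_affine_independent)
    then have c3: "card C = 3" using vc[OF C(1)] C(2) C'(2) by simp
    have "card (vertices T - C) = 1" using C(1) V(1,2) c3 by (simp add: card_Diff_subset finite_subset)
    then obtain p where p: "vertices T - C = {p}" by (auto simp: card_1_singleton_iff)
    then have "C = vertices T - {p}" "p \<in> vertices T" using C(1) by auto
    then show "f \<in> (\<lambda>p. convex hull (vertices T - {p})) ` vertices T" using C(2) by blast
  next
    fix f assume "f \<in> (\<lambda>p. convex hull (vertices T - {p})) ` vertices T"
    then obtain p where p: "p \<in> vertices T" "f = convex hull (vertices T - {p})" by blast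
    have "f face_of T" using fc p by blast
    moreover have "2 simplex f" unfolding p(2)
      by (rule simplex_convex_hull) (use ind[of "vertices T - {p}"] V(1,2) p(1) in auto)
    ultimately show "f \<in> faces \<T> T" using closed by (simp add: faces_def simplexes_def)
  qed
qed

lemma inj_on_faces: "inj_on (\<lambda>p. convex hull (vertices T - {p})) (vertices T)"
proof (rule inj_onI)
  fix p q assume pq: "p \<in> vertices T" "q \<in> vertices T" "convex hull (vertices T - {p}) = convex hull (vertices T - {q})"
  then have "vertices T - {p} = vertices T - {q}" using vertices_face by metis
  then show "p = q" using pq by blast
qed

lemma finite_faces: "finite (faces \<T> T)" "card (faces \<T> T) = 4"
  using vertices_tetrahedron(1,2)[OF simplexesD(1)[OF TT]] by (simp_all add: faces_eq card_image inj_on_faces)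

lemma face_vertices:
  assumes fo: "face_orientation \<T> fo" and f: "f \<in> faces \<T> T" and e: "fo f = (i, j, k)"
  shows "i \<in> vertices T" "j \<in> vertices T" "k \<in> vertices T"
proof -
  have "vertices f = {i, j, k}"
    using bspec[OF fo[unfolded face_orientation_def], of f] f e by (simp add: faces_def)
  moreover have "vertices f \<subseteq> vertices T"
    using f extreme_point_of_face[of f T] by (auto simp: faces_def vertices_def)
  ultimately show "i \<in> vertices T" "j \<in> vertices T" "k \<in> vertices T" by auto
qed

text \<open>One half of \<open>\<Omega> (j - i) (k - i)\<close> is the integral of the constant form
  over the face, so this is the exactness of Whitney interpolation on constant 2-forms. The two
  transpositions reach every ordering that \<open>fo\<close> may choose.\<close>

lemma whitney2_tet_complete:
  fixes \<Omega> :: "real^3 \<Rightarrow> real^3 \<Rightarrow> 'b::real_vector"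
  assumes fo: "face_orientation \<T> fo"
    and l: "\<And>u. linear (\<Omega> u)" "\<And>v. linear (\<lambda>u. \<Omega> u v)" and as: "\<And>u v. \<Omega> u v = - \<Omega> v u"
  shows "(\<Sum>f\<in>faces \<T> T. whitney2_tet T (fo f) x u v *\<^sub>R (case fo f of (i, j, k) \<Rightarrow> (1/2) *\<^sub>R \<Omega> (j - i) (k - i))) = \<Omega> u v"
proof -
  have T: "3 simplex T" using TT simplexesD by blast
  obtain a b c d where V: "vertices T = {a, b, c, d}" "distinct [a, b, c, d]"
  proof -
    obtain xs where xs: "set xs = vertices T" "distinct xs"
      using finite_distinct_list[OF vertices_tetrahedron(1)[OF T]] by blast
    then have "length xs = 4" using distinct_card[OF xs(2)] vertices_tetrahedron(2)[OF T] by simp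
    then obtain a b c d where "xs = [a, b, c, d]" by (auto simp: numeral_eq_Suc length_Suc_conv)
    then show thesis using that[of a b c d] xs by auto
  qed
  define tm where "tm = (\<lambda>(i, j, k). whitney2_tet T (i, j, k) x u v *\<^sub>R \<Omega> (j - i) (k - i))"
  have sym: "tm (j, i, k) = tm (i, j, k)" "tm (i, k, j) = tm (i, j, k)" for i j k
    unfolding tm_def by (rule whitney2_tet_face_sym[OF l as])+
  have perm: "tm e = tm (p, q, s)" if "case e of (i, j, k) \<Rightarrow> {i, j, k} = {p, q, s}" "distinct [p, q, s]" for e p q s
  proof -
    obtain i j k where e: "e = (i, j, k)" by (cases e)
    have "card {i, j, k} = 3" using that e by simp
    then have dist: "i \<noteq> j" "i \<noteq> k" "j \<noteq> k" by (auto simp: card_insert_if split: if_splits)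
    have "i = p \<or> i = q \<or> i = s" "j = p \<or> j = q \<or> j = s" "k = p \<or> k = q \<or> k = s" using that e by auto
    then show ?thesis unfolding e using dist by (elim disjE) (simp_all add: sym)
  qed
  have face: "tm (fo (convex hull (vertices T - {y}))) = tm (p, q, s)"
    if y: "y \<in> vertices T" "vertices T - {y} = {p, q, s}" "distinct [p, q, s]" for y p q s
  proof (rule perm[OF _ y(3)])
    have "convex hull (vertices T - {y}) \<in> simplexes 2 \<T>" using y(1) faces_eq by (auto simp: faces_def)
    note f = bspec[OF fo[unfolded face_orientation_def] this]
    obtain i j k where ijk: "fo (convex hull (vertices T - {y})) = (i, j, k)"
      by (cases "fo (convex hull (vertices T - {y}))")
    have "vertices T - {y} = {i, j, k}" using f unfolding ijk prod.case vertices_face[OF y(1)] .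
    then show "case fo (convex hull (vertices T - {y})) of (i, j, k) \<Rightarrow> {i, j, k} = {p, q, s}"
      unfolding ijk prod.case using y(2) by (simp only:)
  qed
  have "(\<Sum>f\<in>faces \<T> T. whitney2_tet T (fo f) x u v *\<^sub>R (case fo f of (i, j, k) \<Rightarrow> (1/2) *\<^sub>R \<Omega> (j - i) (k - i)))
      = (\<Sum>f\<in>faces \<T> T. (1/2) *\<^sub>R tm (fo f))"
    by (rule sum.cong) (auto simp: tm_def split: prod.splits)
  also have "\<dots> = (1/2) *\<^sub>R (\<Sum>f\<in>faces \<T> T. tm (fo f))" by (simp only: scaleR_sum_right)
  also have "(\<Sum>f\<in>faces \<T> T. tm (fo f)) = (\<Sum>y\<in>vertices T. tm (fo (convex hull (vertices T - {y}))))"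
    unfolding faces_eq by (subst sum.reindex[OF inj_on_faces]) simp
  also have "\<dots> = tm (fo (convex hull (vertices T - {a}))) + tm (fo (convex hull (vertices T - {b})))
      + tm (fo (convex hull (vertices T - {c}))) + tm (fo (convex hull (vertices T - {d})))"
    using V(2) unfolding V(1) by simp
  also have "tm (fo (convex hull (vertices T - {a}))) = tm (b, c, d)" by (rule face) (use V in auto)
  also have "tm (fo (convex hull (vertices T - {b}))) = tm (a, c, d)" by (rule face) (use V in auto)
  also have "tm (fo (convex hull (vertices T - {c}))) = tm (a, b, d)" by (rule face) (use V in auto)
  also have "tm (fo (convex hull (vertices T - {d}))) = tm (a, b, c)" by (rule face) (use V in auto)
  also have "tm (b, c, d) + tm (a, c, d) + tm (a, b, d) + tm (a, b, c) = 2 *\<^sub>R \<Omega> u v"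
    unfolding tm_def using whitney2_tet_complete_ordered[OF T V l as] by simp
  finally show ?thesis by simp
qed

lemma whitney2_tet_bound:
  assumes z: "cball z (r * diameter T) \<subseteq> T" "r > 0" and x: "x \<in> T" and uv: "norm u \<le> 1" "norm v \<le> 1"
  shows "\<bar>whitney2_tet T f x u v\<bar> \<le> 3 / (r * diameter T) ^ 2"
proof -
  have T: "3 simplex T" using TT simplexesD by blast
  define g where "g = 1 / (2 * (r * diameter T))"
  have g0: "g > 0" using z diameter_tetrahedron_pos[OF T] by (simp add: g_def)
  have gb: "\<bar>bgrad T v \<bullet> x\<bar> \<le> g" if "norm x \<le> 1" for v x
  proof -
    have "\<bar>bgrad T v \<bullet> x\<bar> \<le> norm (bgrad T v) * norm x" by (rule Cauchy_Schwarz_ineq2)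
    also have "\<dots> \<le> g * 1"
      using bgrad_bound[OF T z(1), of v] z(2) diameter_tetrahedron_pos[OF T] that g0
      by (intro mult_mono) (auto simp: g_def)
    finally show ?thesis by simp
  qed
  have wb: "\<bar>wedge2 T j k u v\<bar> \<le> 2 * g ^ 2" for j k
  proof -
    have "\<bar>(bgrad T j \<bullet> u) * (bgrad T k \<bullet> v)\<bar> \<le> g * g" "\<bar>(bgrad T j \<bullet> v) * (bgrad T k \<bullet> u)\<bar> \<le> g * g"
      unfolding abs_mult using gb uv g0 by (intro mult_mono; auto)+
    then show ?thesis unfolding wedge2_def power2_eq_square by linarith
  qed
  have bb: "\<bar>bary T i x * wedge2 T j k u v\<bar> \<le> 1 * (2 * g ^ 2)" for i j k
    unfolding abs_mult using bary_bounds[OF T x] wb by (intro mult_mono) auto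
  obtain i j k where f: "f = (i, j, k)" by (cases f)
  have "\<bar>whitney2_tet T f x u v\<bar> \<le> 12 * g ^ 2"
    using bb[of i j k] bb[of j i k] bb[of k i j] unfolding f whitney2_tet_def by simp
  also have "12 * g ^ 2 = 3 / (r * diameter T) ^ 2" by (simp add: g_def power2_eq_square)
  finally show ?thesis .
qed

lemma continuous_on_inner2_whitney2_tet: "continuous_on X (\<lambda>x. inner2 (whitney2_tet T f0 x) (whitney2_tet T f1 x))"
  unfolding inner2_def using simplexesD(1)[OF TT] by (intro continuous_intros continuous_on_whitney2_tet) auto

lemma mass_eq: "mass \<T> T f0 f1 = (LINT x:T|lebesgue. inner2 (whitney2_tet T f0 x) (whitney2_tet T f1 x))"
  unfolding mass_def
proof (rule set_integral_interior(2))
  show "compact T" "convex T" using simplexesD(1)[OF TT] compact_simplex convex_simplex by blast+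
  show "continuous_on T (\<lambda>x. inner2 (whitney2_tet T f0 x) (whitney2_tet T f1 x))" by (rule continuous_on_inner2_whitney2_tet)
qed (simp add: inner2_def whitney2_interior[OF mesh TT])

text \<open>Products of two Whitney 2-forms of size \<open>1/h^2\<close> are integrated over a
  volume \<open>O(h^3)\<close>, which gives entries of size \<open>1/h\<close>. The powers are
  arranged as \<open>jet_O_weight\<close> expects them. The constant 81 is 9 pairs of basis vectors
  times the square of 3.\<close>

lemma mass_bound:
  assumes z: "cball z (r * diameter T) \<subseteq> T" "r > 0"
  shows "\<bar>mass \<T> T f0 f1\<bar> * diameter T ^ 5 \<le> 81 * unit_ball_vol 3 / r ^ 4 * diameter T ^ 4"
proof -
  have T: "3 simplex T" using TT simplexesD by blast
  have d: "diameter T > 0" by (rule diameter_tetrahedron_pos[OF T])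
  define B where "B = 3 / (r * diameter T) ^ 2"
  have B0: "B \<ge> 0" by (simp add: B_def)
  have "\<bar>inner2 (whitney2_tet T f0 x) (whitney2_tet T f1 x)\<bar> \<le> 81 / (r * diameter T) ^ 4" if x: "x \<in> T" for x
  proof -
    have 1: "\<bar>whitney2_tet T f0 x u v * whitney2_tet T f1 x u v\<bar> \<le> B * B" if "u \<in> Basis" "v \<in> Basis" for u v
      unfolding abs_mult using whitney2_tet_bound[OF z x, of u v] that B0 by (intro mult_mono) (auto simp: B_def)
    have "\<bar>\<Sum>u\<in>(Basis::(real^3) set). \<Sum>v\<in>(Basis::(real^3) set). whitney2_tet T f0 x u v * whitney2_tet T f1 x u v\<bar>
       \<le> (\<Sum>u\<in>(Basis::(real^3) set). \<Sum>v\<in>(Basis::(real^3) set). B * B)"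
      by (intro order_trans[OF sum_abs] sum_mono 1)
    then have "\<bar>inner2 (whitney2_tet T f0 x) (whitney2_tet T f1 x)\<bar> \<le> 9 * (B * B)"
      using B0 by (simp add: inner2_def)
    also have "\<dots> = 81 / (r * diameter T) ^ 4" by (simp add: B_def eval_nat_numeral)
    finally show ?thesis .
  qed
  then have "\<bar>mass \<T> T f0 f1\<bar> \<le> 81 / (r * diameter T) ^ 4 * measure lebesgue T"
    unfolding mass_eq using compact_simplex[OF T] by (intro set_integral_abs_le continuous_on_inner2_whitney2_tet) auto
  also have "\<dots> \<le> 81 / (r * diameter T) ^ 4 * (unit_ball_vol 3 * diameter T ^ 3)"
    using tetrahedron_volume(2)[OF T z(1)] z(2) d by (intro mult_left_mono) auto
  finally have "\<bar>mass \<T> T f0 f1\<bar> * diameter T ^ 5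
      \<le> 81 / (r * diameter T) ^ 4 * (unit_ball_vol 3 * diameter T ^ 3) * diameter T ^ 5"
    using d by (intro mult_right_mono) auto
  also have "\<dots> = 81 * unit_ball_vol 3 / r ^ 4 * diameter T ^ 4"
    using d z(2) by (simp add: field_simps eval_nat_numeral)
  finally show ?thesis .
qed

text \<open>Before integration the double sum is the squared norm of \<Omega> as reconstructed from
  Whitney 2-forms, which is constant in \<open>x\<close>. The mass matrix thus reproduces the norm
  of a constant form without error.\<close>

lemma mass_sum:
  fixes \<Omega> :: "real^3 \<Rightarrow> real^3 \<Rightarrow> 'b::real_inner"
  assumes fo: "face_orientation \<T> fo"
    and l: "\<And>u. linear (\<Omega> u)" "\<And>v. linear (\<lambda>u. \<Omega> u v)" and as: "\<And>u v. \<Omega> u v = - \<Omega> v u"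
  defines "\<omega> \<equiv> \<lambda>f. case fo f of (i, j, k) \<Rightarrow> (1/2) *\<^sub>R \<Omega> (j - i) (k - i)"
  shows "(\<Sum>f0\<in>faces \<T> T. \<Sum>f1\<in>faces \<T> T. mass \<T> T (fo f0) (fo f1) * (\<omega> f0 \<bullet> \<omega> f1))
     = measure lebesgue T * inner2 \<Omega> \<Omega>"
proof -
  have c: "compact T" using simplexesD(1)[OF TT] compact_simplex by blast
  have int: "integrable lebesgue (\<lambda>x. indicator T x *\<^sub>R (inner2 (whitney2_tet T (fo f0) x) (whitney2_tet T (fo f1) x) * q))" for f0 f1 q
  proof -
    have "continuous_on T (\<lambda>x. inner2 (whitney2_tet T (fo f0) x) (whitney2_tet T (fo f1) x) * q)"
      by (intro continuous_on_mult_right continuous_on_inner2_whitney2_tet)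
    from set_integrable_compact[OF c this] show ?thesis unfolding set_integrable_def .
  qed
  have pt: "(\<Sum>f0\<in>faces \<T> T. \<Sum>f1\<in>faces \<T> T. inner2 (whitney2_tet T (fo f0) x) (whitney2_tet T (fo f1) x) * (\<omega> f0 \<bullet> \<omega> f1)) = inner2 \<Omega> \<Omega>" for x
  proof -
    have o: "\<Omega> u v = (\<Sum>f\<in>faces \<T> T. whitney2_tet T (fo f) x u v *\<^sub>R \<omega> f)" for u v
      unfolding \<omega>_def by (rule whitney2_tet_complete[OF fo l as, symmetric])
    let ?X = "\<lambda>u v f0 f1. whitney2_tet T (fo f0) x u v * whitney2_tet T (fo f1) x u v * (\<omega> f0 \<bullet> \<omega> f1)"
    have "\<Omega> u v \<bullet> \<Omega> u v = (\<Sum>f0\<in>faces \<T> T. \<Sum>f1\<in>faces \<T> T. ?X u v f0 f1)" for u v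
      unfolding o inner_sum_left inner_sum_right by (simp add: mult_ac inner_commute)
    then have "inner2 \<Omega> \<Omega> = (\<Sum>u\<in>Basis. \<Sum>v\<in>Basis. \<Sum>f0\<in>faces \<T> T. \<Sum>f1\<in>faces \<T> T. ?X u v f0 f1) / 2"
      unfolding inner2_def by (simp only:)
    also have "(\<Sum>u\<in>Basis. \<Sum>v\<in>Basis. \<Sum>f0\<in>faces \<T> T. \<Sum>f1\<in>faces \<T> T. ?X u v f0 f1)
        = (\<Sum>u\<in>Basis. \<Sum>f0\<in>faces \<T> T. \<Sum>v\<in>Basis. \<Sum>f1\<in>faces \<T> T. ?X u v f0 f1)"
      by (rule sum.cong[OF refl], rule sum.swap)
    also have "\<dots> = (\<Sum>f0\<in>faces \<T> T. \<Sum>u\<in>Basis. \<Sum>v\<in>Basis. \<Sum>f1\<in>faces \<T> T. ?X u v f0 f1)"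
      by (rule sum.swap)
    also have "\<dots> = (\<Sum>f0\<in>faces \<T> T. \<Sum>u\<in>Basis. \<Sum>f1\<in>faces \<T> T. \<Sum>v\<in>Basis. ?X u v f0 f1)"
      by (rule sum.cong[OF refl], rule sum.cong[OF refl], rule sum.swap)
    also have "\<dots> = (\<Sum>f0\<in>faces \<T> T. \<Sum>f1\<in>faces \<T> T. \<Sum>u\<in>Basis. \<Sum>v\<in>Basis. ?X u v f0 f1)"
      by (rule sum.cong[OF refl], rule sum.swap)
    finally show ?thesis
      by (simp add: inner2_def sum_distrib_right sum_divide_distrib)
  qed
  have "(\<Sum>f0\<in>faces \<T> T. \<Sum>f1\<in>faces \<T> T. mass \<T> T (fo f0) (fo f1) * (\<omega> f0 \<bullet> \<omega> f1))
    = (\<Sum>f0\<in>faces \<T> T. \<Sum>f1\<in>faces \<T> T. LINT x|lebesgue. indicator T x *\<^sub>R (inner2 (whitney2_tet T (fo f0) x) (whitney2_tet T (fo f1) x) * (\<omega> f0 \<bullet> \<omega> f1)))"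
    unfolding mass_eq set_lebesgue_integral_def
    by (simp add: integral_mult_left_zero[symmetric] mult.assoc[symmetric] del: integral_mult_left_zero)
  also have "\<dots> = (LINT x|lebesgue. (\<Sum>f0\<in>faces \<T> T. \<Sum>f1\<in>faces \<T> T. indicator T x *\<^sub>R (inner2 (whitney2_tet T (fo f0) x) (whitney2_tet T (fo f1) x) * (\<omega> f0 \<bullet> \<omega> f1))))"
    by (simp only: Bochner_Integration.integral_sum int Bochner_Integration.integrable_sum)
  also have "\<dots> = (LINT x:T|lebesgue. inner2 \<Omega> \<Omega>)"
  proof -
    have "(\<Sum>f0\<in>faces \<T> T. \<Sum>f1\<in>faces \<T> T. indicator T x *\<^sub>R (inner2 (whitney2_tet T (fo f0) x) (whitney2_tet T (fo f1) x) * (\<omega> f0 \<bullet> \<omega> f1)))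
        = (indicator T x *\<^sub>R inner2 \<Omega> \<Omega> :: real)" for x
      unfolding pt[of x, symmetric] scaleR_sum_right ..
    then show ?thesis unfolding set_lebesgue_integral_def by (simp only:)
  qed
  also have "\<dots> = measure lebesgue T * inner2 \<Omega> \<Omega>" using set_integral_const[OF c] by simp
  finally show ?thesis .
qed

end

section \<open>Expansion of the two actions on a tetrahedron\<close>

lemma jet_O_sum_const:
  assumes "finite B" "B \<noteq> {}" "\<And>u. u \<in> B \<Longrightarrow> jet_O I h N k (f u)"
  shows "jet_O I h N k (\<lambda>i t. \<Sum>u\<in>B. f u i t)"
  using assms
proof (induction B rule: finite_ne_induct)
  case (singleton u)
  then show ?case by simp
next
  case (insert u B)
  have "jet_O I h N k (\<lambda>i t. f u i t + (\<Sum>u\<in>B. f u i t))"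
    using insert by (intro jet_O_add) auto
  then show ?case using insert by simp
qed

text \<open>A difference of squares is a sum of two products, each with one factor
  \<open>X - Y\<close> of order \<open>k\<close> and one bounded factor.\<close>

lemma jet_O_inner2_diff:
  fixes X Y :: "'i \<Rightarrow> real \<Rightarrow> real^3 \<Rightarrow> real^3 \<Rightarrow> 'b::real_inner"
  assumes X: "\<And>u v. u \<in> Basis \<Longrightarrow> v \<in> Basis \<Longrightarrow> jet_O I h N 0 (\<lambda>i t. X i t u v)"
    and Y: "\<And>u v. u \<in> Basis \<Longrightarrow> v \<in> Basis \<Longrightarrow> jet_O I h N 0 (\<lambda>i t. Y i t u v)"
    and D: "\<And>u v. u \<in> Basis \<Longrightarrow> v \<in> Basis \<Longrightarrow> jet_O I h N k (\<lambda>i t. X i t u v - Y i t u v)"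
  shows "jet_O I h N k (\<lambda>i t. inner2 (X i t) (X i t) - inner2 (Y i t) (Y i t))"
proof -
  have "jet_O I h N k (\<lambda>i t. (X i t u v - Y i t u v) \<bullet> X i t u v + Y i t u v \<bullet> (X i t u v - Y i t u v))"
    if "u \<in> Basis" "v \<in> Basis" for u v
    using jet_O_bilinear[OF bounded_bilinear_inner D[OF that] X[OF that]]
      jet_O_bilinear[OF bounded_bilinear_inner Y[OF that] D[OF that]]
    by (intro jet_O_add) simp_all
  then have "jet_O I h N k (\<lambda>i t. (1/2) *\<^sub>R (\<Sum>u\<in>Basis. \<Sum>v\<in>Basis.
      (X i t u v - Y i t u v) \<bullet> X i t u v + Y i t u v \<bullet> (X i t u v - Y i t u v)))"
    by (intro jet_O_cmult jet_O_sum_const) auto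
  then show ?thesis
    by (rule jet_O_cong)
      (simp add: inner2_def inner_diff_left inner_diff_right inner_commute sum_subtractf flip: diff_divide_distrib)
qed

lemma jet_O_transport:
  fixes x :: "'i \<Rightarrow> real \<Rightarrow> complex^'n^'n"
  assumes x: "jet_O I h N 1 x"
  shows "jet_O I h N 1 (\<lambda>i t. mexp (- x i t) - mat 1)" "jet_O I h N 0 (\<lambda>i t. mexp (- x i t))"
proof -
  have xx: "jet_O I h N 2 (\<lambda>i t. x i t ** x i t)"
    using jet_O_bilinear[OF bounded_bilinear_matrix_mult x x] by (simp add: numeral_2_eq_2)
  have "jet_O I h N 1 (\<lambda>i t. - x i t + (1/2) *\<^sub>R (x i t ** x i t) + mexp_rem (- x i t))"
    by (intro jet_O_add jet_O_minus x jet_O_cmult jet_O_mono[OF xx]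
        jet_O_mono[OF jet_O_mexp_rem[OF jet_O_minus[OF x]]]) auto
  then show 1: "jet_O I h N 1 (\<lambda>i t. mexp (- x i t) - mat 1)"
    by (rule jet_O_cong) (simp add: mexp_rem_def mm.minus_left mm.minus_right)
  have "jet_O I h N 0 (\<lambda>i t. (mexp (- x i t) - mat 1) + mat 1)"
    by (intro jet_O_add jet_O_mono[OF 1] jet_O_const[OF x]) simp
  then show "jet_O I h N 0 (\<lambda>i t. mexp (- x i t))" by simp
qed

lemma norm_le_inner1: "u \<in> Basis \<Longrightarrow> norm (f u) \<le> sqrt (inner1 f f)"
proof -
  assume u: "u \<in> Basis"
  have "(norm (f u))\<^sup>2 \<le> inner1 f f"
    unfolding inner1_def power2_norm_eq_inner by (rule member_le_sum[OF u]) auto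
  then show ?thesis by (rule real_le_rsqrt)
qed

text \<open>The factor 2 is the one between \<open>half_d\<close> and the exterior derivative, so
  that the bound is in terms of the integrand of \<open>L2_norm2\<close>.\<close>

lemma norm_le_inner2:
  assumes "u \<in> Basis" "v \<in> Basis"
  shows "norm (f u v) \<le> sqrt (inner2 (\<lambda>u v. 2 *\<^sub>R f u v) (\<lambda>u v. 2 *\<^sub>R f u v))"
proof -
  have "(norm (f u v))\<^sup>2 \<le> (\<Sum>v\<in>Basis. f u v \<bullet> f u v)"
    unfolding power2_norm_eq_inner by (rule member_le_sum[OF assms(2)]) auto
  also have "\<dots> \<le> (\<Sum>u\<in>Basis. \<Sum>v\<in>Basis. f u v \<bullet> f u v)"
    by (rule member_le_sum[OF assms(1)]) (auto intro: sum_nonneg)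
  also have "\<dots> \<le> 2 * \<dots>" by (simp add: sum_nonneg)
  also have "\<dots> = inner2 (\<lambda>u v. 2 *\<^sub>R f u v) (\<lambda>u v. 2 *\<^sub>R f u v)"
    by (simp add: inner2_def sum_distrib_left sum_divide_distrib)
  finally show ?thesis by (rule real_le_rsqrt)
qed

text \<open>A tetrahedron of one of the meshes together with the coefficients of a perturbation.\<close>

type_synonym 'm index = "nat \<times> (real^3) set \<times> ((real^3) set \<Rightarrow> complex^'m^'m)"

text \<open>The interpolant, with coefficients \<open>b\<close>, enters the expansions through the
  uniform bounds \<open>al_b\<close> and \<open>be_b\<close>. The coefficients of the perturbation
  are part of the index, which makes all constants uniform in the perturbation.\<close>

locale whitney_perturbation =
  fixes S :: "(real^3) set" and \<T> :: "nat \<Rightarrow> (real^3) set set"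
    and eo :: "nat \<Rightarrow> (real^3) set \<Rightarrow> (real^3) \<times> (real^3)"
    and fo :: "nat \<Rightarrow> (real^3) set \<Rightarrow> (real^3) \<times> (real^3) \<times> (real^3)"
    and b :: "nat \<Rightarrow> (real^3) set \<Rightarrow> complex^'n^'n" and z :: "(real^3) set \<Rightarrow> real^3" and r H K :: real
  assumes mesh: "\<And>n. mesh_of S (\<T> n)"
    and fo: "\<And>n. face_orientation (\<T> n) (fo n)"
    and r: "r > 0" and ball: "\<And>n T. T \<in> simplexes 3 (\<T> n) \<Longrightarrow> cball (z T) (r * diameter T) \<subseteq> T"
    and H: "\<And>n T. T \<in> simplexes 3 (\<T> n) \<Longrightarrow> diameter T \<le> H"
    and K: "K \<ge> 0"
    and al_b: "\<And>n T v. T \<in> simplexes 3 (\<T> n) \<Longrightarrow> norm (centre_part (\<T> n) (eo n) T (z T) (b n) v) \<le> K * norm v"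
    and be_b: "\<And>n T u v. T \<in> simplexes 3 (\<T> n) \<Longrightarrow> norm (half_d (\<T> n) (eo n) T (b n) u v) \<le> K * norm u * norm v"
begin

definition I :: "'n index set" where "I = {(n, T, c). T \<in> simplexes 3 (\<T> n)}"

definition tet :: "'n index \<Rightarrow> (real^3) set" where "tet i = fst (snd i)"

definition h :: "'n index \<Rightarrow> real" where "h i = diameter (tet i)"

text \<open>\<open>Nal\<close> and \<open>Nbe\<close> are the pointwise norms of the perturbation at
  the centre and of its exterior derivative; their squares can be compared with the integrands of
  the two norms in the claim.\<close>

definition Nal :: "'n index \<Rightarrow> real"
  where "Nal i = (let f = centre_part (\<T> (fst i)) (eo (fst i)) (tet i) (z (tet i)) (snd (snd i)) in sqrt (inner1 f f))"

definition Nbe :: "'n index \<Rightarrow> real"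
  where "Nbe i = (let f = (\<lambda>u v. 2 *\<^sub>R half_d (\<T> (fst i)) (eo (fst i)) (tet i) (snd (snd i)) u v) in sqrt (inner2 f f))"

definition N :: "'n index \<Rightarrow> real" where "N i = Nal i + Nbe i"

definition coeffs :: "'n index \<Rightarrow> real \<Rightarrow> (real^3) set \<Rightarrow> complex^'n^'n"
  where "coeffs i t = (\<lambda>e. b (fst i) e + t *\<^sub>R snd (snd i) e)"

definition form :: "'n index \<Rightarrow> real \<Rightarrow> (complex^'n^'n) form1"
  where "form i t = wcomb (\<T> (fst i)) (eo (fst i)) (coeffs i t)"

definition Al :: "'n index \<Rightarrow> real \<Rightarrow> real^3 \<Rightarrow> complex^'n^'n"
  where "Al i t = centre_part (\<T> (fst i)) (eo (fst i)) (tet i) (z (tet i)) (coeffs i t)"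

definition Be :: "'n index \<Rightarrow> real \<Rightarrow> real^3 \<Rightarrow> real^3 \<Rightarrow> complex^'n^'n"
  where "Be i t = half_d (\<T> (fst i)) (eo (fst i)) (tet i) (coeffs i t)"

text \<open>The curvature of \<open>form i t\<close> at the centre of the inscribed ball.\<close>

definition Om :: "'n index \<Rightarrow> real \<Rightarrow> real^3 \<Rightarrow> real^3 \<Rightarrow> complex^'n^'n"
  where "Om i t u v = 2 *\<^sub>R Be i t u v + commutator (Al i t u) (Al i t v)"

lemma tet_simplex: "i \<in> I \<Longrightarrow> tet i \<in> simplexes 3 (\<T> (fst i))"
  by (auto simp: I_def tet_def)

lemma tet3: "i \<in> I \<Longrightarrow> 3 simplex tet i"
  using tet_simplex simplexesD by blast

lemma h_pos: "i \<in> I \<Longrightarrow> 0 < h i"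
  using diameter_tetrahedron_pos[OF tet3] by (simp add: h_def)

lemma h_le: "i \<in> I \<Longrightarrow> h i \<le> H"
  using H[OF tet_simplex] by (simp add: h_def)

lemma N_nonneg: "0 \<le> Nal i" "0 \<le> Nbe i" "0 \<le> N i"
proof -
  show 1: "0 \<le> Nal i" "0 \<le> Nbe i"
    unfolding Nal_def Nbe_def Let_def inner1_def inner2_def
    by (intro real_sqrt_ge_zero divide_nonneg_nonneg sum_nonneg; simp)+
  then show "0 \<le> N i" by (simp add: N_def)
qed

lemma scale: "i \<in> I \<Longrightarrow> 0 \<le> h i \<and> 0 \<le> N i \<and> h i \<le> H"
  using h_pos h_le N_nonneg by (simp add: less_imp_le)

lemma tet_dist: "i \<in> I \<Longrightarrow> x \<in> tet i \<Longrightarrow> y \<in> tet i \<Longrightarrow> norm (x - y) \<le> h i"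
  using diameter_bounded_bound[of "tet i" x y] compact_simplex[OF tet3]
  by (simp add: compact_imp_bounded h_def dist_norm)

lemma centre_in_tet: "i \<in> I \<Longrightarrow> z (tet i) \<in> tet i"
  using ball[OF tet_simplex, of i] r h_pos[of i] by (auto simp: h_def subset_iff)

lemma Al_eq: "Al i t v = centre_part (\<T> (fst i)) (eo (fst i)) (tet i) (z (tet i)) (b (fst i)) v
     + t *\<^sub>R centre_part (\<T> (fst i)) (eo (fst i)) (tet i) (z (tet i)) (snd (snd i)) v"
  by (simp add: Al_def coeffs_def centre_part_add_scale)

lemma Be_eq: "Be i t u v = half_d (\<T> (fst i)) (eo (fst i)) (tet i) (b (fst i)) u v
     + t *\<^sub>R half_d (\<T> (fst i)) (eo (fst i)) (tet i) (snd (snd i)) u v"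
  by (simp add: Be_def coeffs_def half_d_add_scale)

text \<open>Applied with \<open>k = 0\<close> to basis vectors and with \<open>k = 1\<close> to edge
  vectors. The constant collects \<open>K\<close> for the interpolant and 3 from expanding the
  argument of the perturbation in the basis.\<close>

lemma jet_Al:
  assumes J: "\<And>j. j \<in> J \<Longrightarrow> p j \<in> I \<and> norm (w j) \<le> h (p j) ^ k"
  shows "jet_O J (\<lambda>j. h (p j)) (\<lambda>j. N (p j)) k (\<lambda>j t. Al (p j) t (w j))"
  unfolding Al_eq
proof (rule jet_O_affine[where K="K + 3" and H=H])
  fix j assume j: "j \<in> J"
  show "0 \<le> h (p j) \<and> 0 \<le> N (p j) \<and> h (p j) \<le> H" using scale J[OF j] by blast
  have w: "norm (w j) \<le> h (p j) ^ k" and T: "tet (p j) \<in> simplexes 3 (\<T> (fst (p j)))"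
    and hk: "0 \<le> h (p j) ^ k"
    using J[OF j] tet_simplex scale by auto
  have "norm (centre_part (\<T> (fst (p j))) (eo (fst (p j))) (tet (p j)) (z (tet (p j))) (b (fst (p j))) (w j)) \<le> K * norm (w j)"
    by (rule al_b[OF T])
  also have "\<dots> \<le> (K + 3) * h (p j) ^ k" using w K hk by (intro mult_mono) auto
  finally show "norm (centre_part (\<T> (fst (p j))) (eo (fst (p j))) (tet (p j)) (z (tet (p j))) (b (fst (p j))) (w j)) \<le> (K + 3) * h (p j) ^ k" .
  have "norm (centre_part (\<T> (fst (p j))) (eo (fst (p j))) (tet (p j)) (z (tet (p j))) (snd (snd (p j))) (w j)) \<le> 3 * Nal (p j) * norm (w j)"
    unfolding Nal_def Let_def by (rule norm_le_sum_Basis[OF centre_part_linear]) (rule norm_le_inner1)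
  also have "\<dots> \<le> (K + 3) * N (p j) * h (p j) ^ k"
    using w K hk N_nonneg[of "p j"] by (intro mult_mono) (auto simp: N_def)
  finally show "norm (centre_part (\<T> (fst (p j))) (eo (fst (p j))) (tet (p j)) (z (tet (p j))) (snd (snd (p j))) (w j)) \<le> (K + 3) * h (p j) ^ k * N (p j)"
    by (simp add: mult_ac)
qed

text \<open>Each of the two arguments contributes its own order, and a factor 3 from its expansion
  in the basis, whence \<open>K + 9\<close>.\<close>

lemma jet_Be:
  assumes J: "\<And>j. j \<in> J \<Longrightarrow> p j \<in> I \<and> norm (w j) \<le> h (p j) ^ k \<and> norm (w' j) \<le> h (p j) ^ l"
  shows "jet_O J (\<lambda>j. h (p j)) (\<lambda>j. N (p j)) (k + l) (\<lambda>j t. Be (p j) t (w j) (w' j))"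
  unfolding Be_eq
proof (rule jet_O_affine[where K="K + 9" and H=H])
  fix j assume j: "j \<in> J"
  show "0 \<le> h (p j) \<and> 0 \<le> N (p j) \<and> h (p j) \<le> H" using scale J[OF j] by blast
  have w: "norm (w j) \<le> h (p j) ^ k" "norm (w' j) \<le> h (p j) ^ l" and T: "tet (p j) \<in> simplexes 3 (\<T> (fst (p j)))"
    and hk: "0 \<le> h (p j) ^ k" "0 \<le> h (p j) ^ l"
    using J[OF j] tet_simplex scale by auto
  let ?b = "\<lambda>c. half_d (\<T> (fst (p j))) (eo (fst (p j))) (tet (p j)) c"
  have "norm (?b (b (fst (p j))) (w j) (w' j)) \<le> K * norm (w j) * norm (w' j)"
    by (rule be_b[OF T])
  also have "\<dots> \<le> (K + 9) * h (p j) ^ k * h (p j) ^ l" using w K hk by (intro mult_mono) auto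
  finally show "norm (?b (b (fst (p j))) (w j) (w' j)) \<le> (K + 9) * h (p j) ^ (k + l)"
    by (simp add: power_add mult_ac)
  have "norm (?b (snd (snd (p j))) u v) \<le> 3 * Nbe (p j) * norm v" if "u \<in> Basis" for u v
    unfolding Nbe_def Let_def by (rule norm_le_sum_Basis[OF half_d_linear(1)]) (rule norm_le_inner2[OF that])
  then have "norm (?b (snd (snd (p j))) (w j) (w' j)) \<le> 3 * (3 * Nbe (p j) * norm (w' j)) * norm (w j)"
    by (rule norm_le_sum_Basis[OF half_d_linear(2)])
  also have "\<dots> = 9 * Nbe (p j) * norm (w j) * norm (w' j)" by simp
  also have "\<dots> \<le> (K + 9) * N (p j) * h (p j) ^ k * h (p j) ^ l"
    using w K hk N_nonneg[of "p j"] by (intro mult_mono) (auto simp: N_def)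
  finally show "norm (?b (snd (snd (p j))) (w j) (w' j)) \<le> (K + 9) * h (p j) ^ (k + l) * N (p j)"
    by (simp add: power_add mult_ac)
qed

lemma Al_linear: "linear (Al i t)" unfolding Al_def by (rule centre_part_linear)

lemma Be_linear: "linear (Be i t u)" "linear (\<lambda>u. Be i t u v)" unfolding Be_def by (rule half_d_linear)+

lemma Be_antisym: "Be i t u v = - Be i t v u" unfolding Be_def by (rule half_d_antisym)

lemma commutator_simps:
  "commutator (x + y) w = commutator x w + commutator y w" "commutator x (y + w) = commutator x y + commutator x w"
  "commutator (x - y) w = commutator x w - commutator y w" "commutator x (y - w) = commutator x y - commutator x w"
  "commutator (a *\<^sub>R x) y = a *\<^sub>R commutator x y" "commutator x (a *\<^sub>R y) = a *\<^sub>R commutator x y"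
  "commutator x x = 0" for x y w :: "complex^'m^'m"
  by (simp_all add: commutator_def mm_simps algebra_simps)

lemma commutator_antisym: "commutator x y = - commutator y x"
  by (simp add: commutator_def)

lemma Om_bilinear: "linear (Om i t u)" "linear (\<lambda>u. Om i t u v)" "Om i t u v = - Om i t v u"
proof -
  note ln = linear_add[OF Al_linear] linear_scale[OF Al_linear] linear_add[OF Be_linear(1)] linear_scale[OF Be_linear(1)]
    linear_add[OF Be_linear(2)] linear_scale[OF Be_linear(2)]
  show "linear (Om i t u)" "linear (\<lambda>u. Om i t u v)"
    by (rule linearI; simp add: Om_def ln commutator_simps algebra_simps)+
  show "Om i t u v = - Om i t v u"
    unfolding Om_def using Be_antisym[of i t u v] commutator_antisym[of "Al i t u" "Al i t v"] by simp
qed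

definition eps :: "'n index \<Rightarrow> real \<Rightarrow> real^3 \<Rightarrow> real^3 \<Rightarrow> complex^'n^'n"
  where "eps i t p q = Al i t (q - p) + Be i t (p - z (tet i)) (q - p)"

lemma edge_integral_form:
  "i \<in> I \<Longrightarrow> p \<in> vertices (tet i) \<Longrightarrow> q \<in> vertices (tet i) \<Longrightarrow> edge_integral (form i t) q p = eps i t p q"
  unfolding form_def eps_def Al_def Be_def by (rule edge_integral_wcomb[OF mesh tet_simplex])

lemma eps_loop: "eps i t p q + eps i t q s + eps i t s p = Be i t (q - p) (s - p)"
  unfolding eps_def Al_def Be_def by (rule edge_loop)

lemma vertices_in_tet: "i \<in> I \<Longrightarrow> p \<in> vertices (tet i) \<Longrightarrow> p \<in> tet i"
  using vertices_subset[OF mesh tet_simplex] .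

lemma jet_eps:
  assumes J: "\<And>j. j \<in> J \<Longrightarrow> p j \<in> I \<and> P j \<in> vertices (tet (p j)) \<and> Q j \<in> vertices (tet (p j))"
  shows "jet_O J (\<lambda>j. h (p j)) (\<lambda>j. N (p j)) 2 (\<lambda>j t. eps (p j) t (P j) (Q j) - Al (p j) t (Q j - P j))"
    "jet_O J (\<lambda>j. h (p j)) (\<lambda>j. N (p j)) 1 (\<lambda>j t. eps (p j) t (P j) (Q j))"
proof -
  have d: "p j \<in> I" "norm (Q j - P j) \<le> h (p j) ^ 1" "norm (P j - z (tet (p j))) \<le> h (p j) ^ 1" if "j \<in> J" for j
    using J[OF that] tet_dist vertices_in_tet centre_in_tet by auto
  have "jet_O J (\<lambda>j. h (p j)) (\<lambda>j. N (p j)) (1 + 1) (\<lambda>j t. Be (p j) t (P j - z (tet (p j))) (Q j - P j))"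
    by (rule jet_Be) (use d in blast)
  then have Be: "jet_O J (\<lambda>j. h (p j)) (\<lambda>j. N (p j)) 2 (\<lambda>j t. Be (p j) t (P j - z (tet (p j))) (Q j - P j))"
    by (simp add: numeral_2_eq_2)
  then show "jet_O J (\<lambda>j. h (p j)) (\<lambda>j. N (p j)) 2 (\<lambda>j t. eps (p j) t (P j) (Q j) - Al (p j) t (Q j - P j))"
    by (simp add: eps_def)
  show "jet_O J (\<lambda>j. h (p j)) (\<lambda>j. N (p j)) 1 (\<lambda>j t. eps (p j) t (P j) (Q j))"
    unfolding eps_def by (intro jet_O_add jet_Al jet_O_mono[OF Be]) (use d in auto)
qed

section \<open>Holonomies and the lattice action\<close>

definition FI :: "('n index \<times> (real^3) set) set"
  where "FI = Sigma I (\<lambda>i. faces (\<T> (fst i)) (tet i))"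

definition hol :: "'n index \<times> (real^3) set \<Rightarrow> real \<Rightarrow> complex^'n^'n"
  where "hol j t = mat 1 - holonomy (form (fst j) t) (fo (fst (fst j)) (snd j))"

definition face_Om :: "'n index \<times> (real^3) set \<Rightarrow> real \<Rightarrow> complex^'n^'n"
  where "face_Om j t = (case fo (fst (fst j)) (snd j) of (p, q, s) \<Rightarrow> (1/2) *\<^sub>R Om (fst j) t (q - p) (s - p))"

text \<open>By the discrete Stokes theorem the integrals along the three edges sum to
  \<open>Be\<close> of two edge vectors, which is of order 2 as the expansion of the holonomy
  requires. Replacing the edge integrals in the commutator by \<open>Al\<close> costs order 3, since
  they differ from it by order 2 and the other factor is of order 1.\<close>

lemma jet_hol:
  shows "jet_O FI (\<lambda>j. h (fst j)) (\<lambda>j. N (fst j)) 3 (\<lambda>j t. hol j t - face_Om j t)"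
    and "jet_O FI (\<lambda>j. h (fst j)) (\<lambda>j. N (fst j)) 2 face_Om"
    and "jet_O FI (\<lambda>j. h (fst j)) (\<lambda>j. N (fst j)) 2 hol"
proof -
  let ?h = "\<lambda>j::'n index \<times> (real^3) set. h (fst j)" and ?N = "\<lambda>j::'n index \<times> (real^3) set. N (fst j)"
  define P where "P j = fst (fo (fst (fst j)) (snd j))" for j :: "'n index \<times> (real^3) set"
  define Q where "Q j = fst (snd (fo (fst (fst j)) (snd j)))" for j :: "'n index \<times> (real^3) set"
  define R where "R j = snd (snd (fo (fst (fst j)) (snd j)))" for j :: "'n index \<times> (real^3) set"
  have PQR: "fo (fst (fst j)) (snd j) = (P j, Q j, R j)" for j by (simp add: P_def Q_def R_def)
  have V: "fst j \<in> I" "P j \<in> vertices (tet (fst j))" "Q j \<in> vertices (tet (fst j))" "R j \<in> vertices (tet (fst j))"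
    if "j \<in> FI" for j
    using that face_vertices[OF mesh tet_simplex fo _ PQR, of j] by (auto simp: FI_def)
  have d: "norm (Q j - P j) \<le> h (fst j) ^ 1" "norm (R j - P j) \<le> h (fst j) ^ 1" "norm (R j - Q j) \<le> h (fst j) ^ 1" if "j \<in> FI" for j
    using V[OF that] tet_dist vertices_in_tet by auto
  define x y w where "x = (\<lambda>j t. eps (fst j) t (P j) (Q j))" and "y = (\<lambda>j t. eps (fst j) t (Q j) (R j))"
    and "w = (\<lambda>j t. eps (fst j) t (R j) (P j))"
  have x: "jet_O FI ?h ?N 1 x" and y: "jet_O FI ?h ?N 1 y" and w: "jet_O FI ?h ?N 1 w"
    unfolding x_def y_def w_def by (rule jet_eps(2); use V in blast)+
  have xa: "jet_O FI ?h ?N 2 (\<lambda>j t. x j t - Al (fst j) t (Q j - P j))"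
    and ya: "jet_O FI ?h ?N 2 (\<lambda>j t. y j t - Al (fst j) t (R j - Q j))"
    unfolding x_def y_def by (rule jet_eps(1); use V in blast)+
  have "jet_O FI ?h ?N (1 + 1) (\<lambda>j t. Be (fst j) t (Q j - P j) (R j - P j))"
    by (rule jet_Be) (use V d in blast)
  then have half_d: "jet_O FI ?h ?N 2 (\<lambda>j t. Be (fst j) t (Q j - P j) (R j - P j))" by (simp add: numeral_2_eq_2)
  have s: "x j t + y j t + w j t = Be (fst j) t (Q j - P j) (R j - P j)" for j t
    unfolding x_def y_def w_def by (rule eps_loop)
  have a1: "jet_O FI ?h ?N 1 (\<lambda>j t. Al (fst j) t (Q j - P j))" and a2: "jet_O FI ?h ?N 1 (\<lambda>j t. Al (fst j) t (R j - P j))"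
    by (rule jet_Al; use V d in blast)+
  note bc = jet_O_bilinear[OF bounded_bilinear_commutator]
  have c1: "jet_O FI ?h ?N 3 (\<lambda>j t. commutator (Al (fst j) t (Q j - P j)) (y j t - Al (fst j) t (R j - Q j)))"
    using bc[OF a1 ya] by (simp add: numeral_3_eq_3)
  have c2: "jet_O FI ?h ?N 3 (\<lambda>j t. commutator (x j t - Al (fst j) t (Q j - P j)) (y j t))"
    using bc[OF xa y] by (simp add: numeral_3_eq_3)
  have F: "hol j t = mat 1 - mexp (- w j t) ** mexp (- y j t) ** mexp (- x j t)" if j: "j \<in> FI" for j t
    unfolding hol_def PQR holonomy_def prod.case transport_def x_def y_def w_def
    by (simp add: edge_integral_form V[OF j])
  have O: "face_Om j t = Be (fst j) t (Q j - P j) (R j - P j)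
      + (1/2) *\<^sub>R commutator (Al (fst j) t (Q j - P j)) (Al (fst j) t (R j - P j))" for j t
    unfolding face_Om_def PQR prod.case Om_def by (simp add: scaleR_add_right)
  \<comment> \<open>The second edge may start at \<open>P j\<close> instead of \<open>Q j\<close>:
    the difference is the first entry of the commutator and commutes with itself.\<close>
  have dif: "Al (fst j) t (R j - Q j) = Al (fst j) t (R j - P j) - Al (fst j) t (Q j - P j)" for j t
    using linear_diff[OF Al_linear, of "fst j" t "R j - P j" "Q j - P j"] by simp
  have "jet_O FI ?h ?N 2 (\<lambda>j t. x j t + y j t + w j t)" using half_d s by simp
  note hol = jet_O_holonomy[OF x y w this]
  have "jet_O FI ?h ?N 3 (\<lambda>j t. (mat 1 - mexp (- w j t) ** mexp (- y j t) ** mexp (- x j t)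
    - (x j t + y j t + w j t) - (1/2) *\<^sub>R commutator (x j t) (y j t))
    + (1/2) *\<^sub>R commutator (Al (fst j) t (Q j - P j)) (y j t - Al (fst j) t (R j - Q j))
    + (1/2) *\<^sub>R commutator (x j t - Al (fst j) t (Q j - P j)) (y j t))"
    by (intro jet_O_add jet_O_cmult c1 c2 hol)
  then show 1: "jet_O FI ?h ?N 3 (\<lambda>j t. hol j t - face_Om j t)"
  proof (rule jet_O_cong)
    fix j t assume j: "j \<in> FI"
    show "(mat 1 - mexp (- w j t) ** mexp (- y j t) ** mexp (- x j t)
    - (x j t + y j t + w j t) - (1/2) *\<^sub>R commutator (x j t) (y j t))
    + (1/2) *\<^sub>R commutator (Al (fst j) t (Q j - P j)) (y j t - Al (fst j) t (R j - Q j))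
    + (1/2) *\<^sub>R commutator (x j t - Al (fst j) t (Q j - P j)) (y j t) = hol j t - face_Om j t"
      unfolding F[OF j] O s dif by (simp add: commutator_simps algebra_simps)
  qed
  show 2: "jet_O FI ?h ?N 2 face_Om"
  proof -
    have "jet_O FI ?h ?N 2 (\<lambda>j t. Be (fst j) t (Q j - P j) (R j - P j)
      + (1/2) *\<^sub>R commutator (Al (fst j) t (Q j - P j)) (Al (fst j) t (R j - P j)))"
      using bc[OF a1 a2] by (intro jet_O_add jet_O_cmult half_d) (simp add: numeral_2_eq_2)
    then show ?thesis by (rule jet_O_cong) (simp add: O)
  qed
  have "jet_O FI ?h ?N 2 (\<lambda>j t. (hol j t - face_Om j t) + face_Om j t)"
    by (intro jet_O_add 2 jet_O_mono[OF 1]) simp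
  then show "jet_O FI ?h ?N 2 hol" by simp
qed

definition lattice_tet :: "'n index \<Rightarrow> real \<Rightarrow> real"
  where "lattice_tet i t = (\<Sum>f0\<in>faces (\<T> (fst i)) (tet i). \<Sum>f1\<in>faces (\<T> (fst i)) (tet i).
       mass (\<T> (fst i)) (tet i) (fo (fst i) f0) (fo (fst i) f1) *
       Re (trace (transport (form i t) (fst (fo (fst i) f1)) (fst (fo (fst i) f0)) ** (mat 1 - hconj (holonomy (form i t) (fo (fst i) f0))) **
                  transport (form i t) (fst (fo (fst i) f0)) (fst (fo (fst i) f1)) ** (mat 1 - holonomy (form i t) (fo (fst i) f1)))))"

text \<open>The transports differ from the unit matrix by order 1 and the holonomy defects are of
  order 2, so replacing the former by \<open>mat 1\<close> and the latter by \<open>face_Om\<close>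
  changes each product by order 5. The mass matrix takes away one order, and on
  \<open>face_Om\<close> its quadratic form is exact by \<open>mass_sum\<close>.\<close>

lemma jet_lattice:
  "jet_O I h N 4 (\<lambda>i t. lattice_tet i t - measure lebesgue (tet i) * inner2 (Om i t) (Om i t))"
proof -
  define J :: "('n index \<times> (real^3) set \<times> (real^3) set) set" where
    "J = Sigma I (\<lambda>i. faces (\<T> (fst i)) (tet i) \<times> faces (\<T> (fst i)) (tet i))"
  define L where "L j = (fst j, fst (snd j))" for j :: "'n index \<times> (real^3) set \<times> (real^3) set"
  define R where "R j = (fst j, snd (snd j))" for j :: "'n index \<times> (real^3) set \<times> (real^3) set"
  have LR: "L j \<in> FI" "R j \<in> FI" if "j \<in> J" for j using that by (auto simp: L_def R_def J_def FI_def)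
  let ?h = "\<lambda>j::'n index \<times> (real^3) set \<times> (real^3) set. h (fst j)"
  let ?N = "\<lambda>j::'n index \<times> (real^3) set \<times> (real^3) set. N (fst j)"
  have pullL: "jet_O J ?h ?N k (\<lambda>j. g (L j))" if "jet_O FI (\<lambda>j. h (fst j)) (\<lambda>j. N (fst j)) k g"
    for g :: "'n index \<times> (real^3) set \<Rightarrow> real \<Rightarrow> complex^'n^'n" and k
    using jet_O_pull[OF that LR(1)] by (simp add: L_def)
  have pullR: "jet_O J ?h ?N k (\<lambda>j. g (R j))" if "jet_O FI (\<lambda>j. h (fst j)) (\<lambda>j. N (fst j)) k g"
    for g :: "'n index \<times> (real^3) set \<Rightarrow> real \<Rightarrow> complex^'n^'n" and k
    using jet_O_pull[OF that LR(2)] by (simp add: R_def)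
  define P where "P j = fst (fo (fst (fst j)) (snd j))" for j :: "'n index \<times> (real^3) set"
  have V: "fst j \<in> I \<and> P j \<in> vertices (tet (fst j))" if "j \<in> FI" for j
  proof -
    obtain p q s where "fo (fst (fst j)) (snd j) = (p, q, s)" by (cases "fo (fst (fst j)) (snd j)")
    then show ?thesis
      using that face_vertices[OF mesh tet_simplex fo, of "fst j" "snd j"] by (auto simp: FI_def P_def)
  qed
  have VJ: "fst j \<in> I \<and> P (L j) \<in> vertices (tet (fst j)) \<and> P (R j) \<in> vertices (tet (fst j))" if "j \<in> J" for j
    using V[OF LR(1)[OF that]] V[OF LR(2)[OF that]] by (simp add: L_def R_def)
  define U01 where "U01 j t = mexp (- eps (fst j) t (P (R j)) (P (L j)))" for j t
  define U10 where "U10 j t = mexp (- eps (fst j) t (P (L j)) (P (R j)))" for j t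
  have e: "jet_O J ?h ?N 1 (\<lambda>j t. eps (fst j) t (P (R j)) (P (L j)))" "jet_O J ?h ?N 1 (\<lambda>j t. eps (fst j) t (P (L j)) (P (R j)))"
    by (rule jet_eps(2); use VJ in blast)+
  have U: "jet_O J ?h ?N 1 (\<lambda>j t. U01 j t - mat 1)" "jet_O J ?h ?N 0 U01" "jet_O J ?h ?N 1 (\<lambda>j t. U10 j t - mat 1)"
    unfolding U01_def U10_def by (rule jet_O_transport[OF e(1)] jet_O_transport[OF e(2)])+
  note XL = pullL[OF jet_hol(3)] and XR = pullR[OF jet_hol(3)] and YL = pullL[OF jet_hol(2)]
    and DL = pullL[OF jet_hol(1)] and DR = pullR[OF jet_hol(1)]
  note bil = jet_O_bilinear[OF bounded_bilinear_matrix_mult] and hc = jet_O_linear[OF bounded_linear_hconj]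
  have hd: "hconj (x - y) = hconj x - hconj y" for x y :: "complex^'n^'n"
    by (rule linear_diff[OF bounded_linear.linear[OF bounded_linear_hconj]])
  \<comment> \<open>The terms \<open>e1\<close> to \<open>e4\<close> remove the two transports and
    then replace the two holonomy defects, one factor at a time.\<close>
  define E where "E j t = U10 j t ** hconj (hol (L j) t) ** U01 j t ** hol (R j) t" for j t
  define e1 where "e1 j t = (U10 j t - mat 1) ** hconj (hol (L j) t) ** U01 j t ** hol (R j) t" for j t
  define e2 where "e2 j t = hconj (hol (L j) t) ** (U01 j t - mat 1) ** hol (R j) t" for j t
  define e3 where "e3 j t = hconj (hol (L j) t - face_Om (L j) t) ** hol (R j) t" for j t
  define e4 where "e4 j t = hconj (face_Om (L j) t) ** (hol (R j) t - face_Om (R j) t)" for j t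
  have E: "E j t - hconj (face_Om (L j) t) ** face_Om (R j) t = e1 j t + e2 j t + e3 j t + e4 j t" for j t
    by (simp add: E_def e1_def e2_def e3_def e4_def hd mm_simps)
  have e1: "jet_O J ?h ?N 5 e1"
    unfolding e1_def using bil[OF bil[OF bil[OF U(3) hc[OF XL]] U(2)] XR] by (simp add: eval_nat_numeral)
  have e2: "jet_O J ?h ?N 5 e2"
    unfolding e2_def using bil[OF bil[OF hc[OF XL] U(1)] XR] by (simp add: eval_nat_numeral)
  have e3: "jet_O J ?h ?N 5 e3" unfolding e3_def using bil[OF hc[OF DL] XR] by (simp add: eval_nat_numeral)
  have e4: "jet_O J ?h ?N 5 e4" unfolding e4_def using bil[OF hc[OF YL] DR] by (simp add: eval_nat_numeral)
  have "jet_O J ?h ?N 5 (\<lambda>j t. Re (trace (E j t - hconj (face_Om (L j) t) ** face_Om (R j) t)))"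
    unfolding E by (intro jet_O_linear[OF bounded_linear_Re_trace] jet_O_add e1 e2 e3 e4)
  then have 5: "jet_O J ?h ?N 5 (\<lambda>j t. Re (trace (E j t)) - face_Om (L j) t \<bullet> face_Om (R j) t)"
    unfolding inner_eq_Re_trace
    by (simp only: linear_diff[OF bounded_linear.linear[OF bounded_linear_Re_trace]])
  define M where "M j = mass (\<T> (fst (fst j))) (tet (fst j)) (fo (fst (fst j)) (fst (snd j))) (fo (fst (fst j)) (snd (snd j)))"
    for j :: "'n index \<times> (real^3) set \<times> (real^3) set"
  have 6: "jet_O J ?h ?N 4 (\<lambda>j t. M j *\<^sub>R (Re (trace (E j t)) - face_Om (L j) t \<bullet> face_Om (R j) t))"
  proof (rule jet_O_weight[OF 5])
    fix j assume "j \<in> J"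
    then have i: "fst j \<in> I" by (auto simp: J_def)
    show "\<bar>M j\<bar> * h (fst j) ^ 5 \<le> 81 * unit_ball_vol 3 / r ^ 4 * h (fst j) ^ 4"
      unfolding M_def h_def by (rule mass_bound[OF mesh tet_simplex[OF i] ball[OF tet_simplex[OF i]] r])
  qed
  have "jet_O I h N 4 (\<lambda>i t. \<Sum>q\<in>faces (\<T> (fst i)) (tet i) \<times> faces (\<T> (fst i)) (tet i).
      M (i, q) *\<^sub>R (Re (trace (E (i, q) t)) - face_Om (L (i, q)) t \<bullet> face_Om (R (i, q)) t))"
  proof (rule jet_O_sum[where m=16])
    show "jet_O (SIGMA i:I. faces (\<T> (fst i)) (tet i) \<times> faces (\<T> (fst i)) (tet i)) (\<lambda>p. h (fst p)) (\<lambda>p. N (fst p)) 4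
     (\<lambda>p t. M (fst p, snd p) *\<^sub>R (Re (trace (E (fst p, snd p) t)) - face_Om (L (fst p, snd p)) t \<bullet> face_Om (R (fst p, snd p)) t))"
      using 6 by (simp add: J_def)
    fix i assume i: "i \<in> I"
    note ff = finite_faces[OF mesh tet_simplex[OF i]]
    then have "faces (\<T> (fst i)) (tet i) \<noteq> {}" by auto
    then show "finite (faces (\<T> (fst i)) (tet i) \<times> faces (\<T> (fst i)) (tet i)) \<and>
      faces (\<T> (fst i)) (tet i) \<times> faces (\<T> (fst i)) (tet i) \<noteq> {} \<and>
      card (faces (\<T> (fst i)) (tet i) \<times> faces (\<T> (fst i)) (tet i)) \<le> 16"
      using ff by (simp add: card_cartesian_product)
  qed
  then show ?thesis
  proof (rule jet_O_cong)
    fix i t assume i: "i \<in> I"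
    let ?F = "faces (\<T> (fst i)) (tet i)"
    have lat: "lattice_tet i t = (\<Sum>f0\<in>?F. \<Sum>f1\<in>?F. M (i, f0, f1) * Re (trace (E (i, f0, f1) t)))"
      unfolding lattice_tet_def
    proof (intro sum.cong refl)
      fix f0 f1 assume f: "f0 \<in> ?F" "f1 \<in> ?F"
      then have "(i, f0, f1) \<in> J" using i by (simp add: J_def)
      note v = VJ[OF this, simplified]
      have "mat 1 - hconj (holonomy (form i t) (fo (fst i) f0)) = hconj (hol (i, f0) t)"
        by (simp add: hol_def hd)
      then show "mass (\<T> (fst i)) (tet i) (fo (fst i) f0) (fo (fst i) f1) *
       Re (trace (transport (form i t) (fst (fo (fst i) f1)) (fst (fo (fst i) f0)) ** (mat 1 - hconj (holonomy (form i t) (fo (fst i) f0))) **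
                  transport (form i t) (fst (fo (fst i) f0)) (fst (fo (fst i) f1)) ** (mat 1 - holonomy (form i t) (fo (fst i) f1))))
        = M (i, f0, f1) * Re (trace (E (i, f0, f1) t))"
        using edge_integral_form[OF i] v
        by (simp add: M_def E_def U01_def U10_def transport_def L_def R_def P_def hol_def)
    qed
    have vol: "measure lebesgue (tet i) * inner2 (Om i t) (Om i t)
       = (\<Sum>f0\<in>?F. \<Sum>f1\<in>?F. M (i, f0, f1) * (face_Om (i, f0) t \<bullet> face_Om (i, f1) t))"
      unfolding M_def face_Om_def
      using mass_sum[OF mesh tet_simplex[OF i] fo Om_bilinear, of i t] by simp
    show "(\<Sum>q\<in>?F \<times> ?F. M (i, q) *\<^sub>R (Re (trace (E (i, q) t)) - face_Om (L (i, q)) t \<bullet> face_Om (R (i, q)) t))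
       = lattice_tet i t - measure lebesgue (tet i) * inner2 (Om i t) (Om i t)"
      unfolding lat vol
      by (simp add: sum.cartesian_product' L_def R_def right_diff_distrib sum_subtractf)
  qed
qed

end

lemma inner2_simps:
  "inner2 (\<lambda>u v. X u v + Y u v) W = inner2 X W + inner2 Y W"
  "inner2 W (\<lambda>u v. X u v + Y u v) = inner2 W X + inner2 W Y"
  "inner2 (\<lambda>u v. s *\<^sub>R X u v) W = s * inner2 X W"
  "inner2 W (\<lambda>u v. s *\<^sub>R X u v) = s * inner2 W X"
  by (simp_all add: inner2_def inner_add_left inner_add_right sum.distrib add_divide_distrib
      sum_distrib_left)

lemma inner2_commute: "inner2 X Y = inner2 Y X"
  by (simp add: inner2_def inner_commute)

lemma inner2_quadratic:
  "inner2 (\<lambda>u v. P u v + t *\<^sub>R Q u v + t\<^sup>2 *\<^sub>R R u v) (\<lambda>u v. P u v + t *\<^sub>R Q u v + t\<^sup>2 *\<^sub>R R u v)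
   = inner2 P P + t * (2 * inner2 P Q) + t ^ 2 * (inner2 Q Q + 2 * inner2 P R) + t ^ 3 * (2 * inner2 Q R) + t ^ 4 * inner2 R R"
  by (simp add: inner2_simps inner2_commute[of Q P] inner2_commute[of R P] inner2_commute[of R Q]
      algebra_simps eval_nat_numeral)

section \<open>Curvature and the continuous action\<close>

context whitney_perturbation
begin

definition curv :: "'n index \<Rightarrow> real \<Rightarrow> real^3 \<Rightarrow> real^3 \<Rightarrow> real^3 \<Rightarrow> complex^'n^'n"
  where "curv i t x u v = 2 *\<^sub>R Be i t u v +
    commutator (Al i t u + Be i t (x - z (tet i)) u) (Al i t v + Be i t (x - z (tet i)) v)"

definition action_tet :: "'n index \<Rightarrow> real \<Rightarrow> real"
  where "action_tet i t = (LINT x:tet i|lebesgue. inner2 (curvature (form i t) x) (curvature (form i t) x))"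

lemma continuous_on_half_d: "continuous_on X (\<lambda>x. half_d \<T>' eo' T (c :: _ \<Rightarrow> 'c::euclidean_space) (x - y) u)"
proof -
  have "continuous_on UNIV (\<lambda>x. half_d \<T>' eo' T c x u)"
    by (rule linear_continuous_on[OF linear_conv_bounded_linear[THEN iffD1, OF half_d_linear(2)]])
  then show ?thesis
    by (rule continuous_on_compose2) (auto intro!: continuous_intros)
qed

lemma continuous_on_commutator:
  "continuous_on X f \<Longrightarrow> continuous_on X g \<Longrightarrow> continuous_on X (\<lambda>x. commutator (f x) (g x :: complex^'m^'m))"
  by (rule bounded_bilinear.continuous_on[OF bounded_bilinear_commutator])

lemma continuous_on_inner2:
  assumes "\<And>u v. continuous_on X (\<lambda>x. F x u v)" "\<And>u v. continuous_on X (\<lambda>x. G x u v)"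
  shows "continuous_on X (\<lambda>x. inner2 (F x) (G x))"
  unfolding inner2_def by (intro continuous_intros assms) simp

lemma continuous_on_curv: "continuous_on X (\<lambda>x. curv i t x u v)"
  unfolding curv_def Be_def
  by (intro continuous_on_add continuous_on_const continuous_on_commutator continuous_on_half_d)

lemma tet_compact: "i \<in> I \<Longrightarrow> compact (tet i)" "i \<in> I \<Longrightarrow> convex (tet i)"
  using compact_simplex[OF tet3] convex_simplex[OF tet3] by auto

lemma action_tet_eq:
  assumes i: "i \<in> I"
  shows "action_tet i t = (LINT x:tet i|lebesgue. inner2 (curv i t x) (curv i t x))"
  unfolding action_tet_def
proof (rule set_integral_interior(2)[OF tet_compact[OF i]])
  show "continuous_on (tet i) (\<lambda>x. inner2 (curv i t x) (curv i t x))"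
    by (intro continuous_on_inner2 continuous_on_curv)
  show "inner2 (curvature (form i t) x) (curvature (form i t) x) = inner2 (curv i t x) (curv i t x)"
    if "x \<in> interior (tet i)" for x
    unfolding inner2_def form_def curv_def Al_def Be_def
    by (simp only: curvature_wcomb[OF mesh tet_simplex[OF i] that, where z="z (tet i)"])
qed

text \<open>The curvature is quadratic in the form, and the form is affine in
  \<open>t\<close>.\<close>

lemma curv_polynomial:
  "\<exists>P Q R. (\<forall>u v. continuous_on X (\<lambda>x. P x u v)) \<and> (\<forall>u v. continuous_on X (\<lambda>x. Q x u v)) \<and>
     (\<forall>u v. continuous_on X (\<lambda>x. R x u v)) \<and>
     (\<forall>x t u v. curv i t x u v = P x u v + t *\<^sub>R Q x u v + t\<^sup>2 *\<^sub>R R x u v)"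
proof -
  define al0 where "al0 = centre_part (\<T> (fst i)) (eo (fst i)) (tet i) (z (tet i)) (b (fst i))"
  define al1 where "al1 = centre_part (\<T> (fst i)) (eo (fst i)) (tet i) (z (tet i)) (snd (snd i))"
  define be0 where "be0 = half_d (\<T> (fst i)) (eo (fst i)) (tet i) (b (fst i))"
  define be1 where "be1 = half_d (\<T> (fst i)) (eo (fst i)) (tet i) (snd (snd i))"
  define A0 where "A0 x u = al0 u + be0 (x - z (tet i)) u" for x u
  define A1 where "A1 x u = al1 u + be1 (x - z (tet i)) u" for x u
  have c: "continuous_on X (\<lambda>x. A0 x u)" "continuous_on X (\<lambda>x. A1 x u)" for u
    unfolding A0_def A1_def be0_def be1_def by (intro continuous_on_add continuous_on_const continuous_on_half_d)+
  have e: "curv i t x u v = (2 *\<^sub>R be0 u v + commutator (A0 x u) (A0 x v))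
      + t *\<^sub>R (2 *\<^sub>R be1 u v + commutator (A0 x u) (A1 x v) + commutator (A1 x u) (A0 x v))
      + t\<^sup>2 *\<^sub>R commutator (A1 x u) (A1 x v)" for x t u v
  proof -
    have A: "Al i t u + Be i t (x - z (tet i)) u = A0 x u + t *\<^sub>R A1 x u" for u
      unfolding Al_eq Be_eq A0_def A1_def al0_def al1_def be0_def be1_def by (simp add: scaleR_add_right)
    have B: "Be i t u v = be0 u v + t *\<^sub>R be1 u v"
      unfolding Be_eq be0_def be1_def ..
    show ?thesis unfolding curv_def A B
      by (simp add: commutator_simps scaleR_add_right power2_eq_square mult.commute)
  qed
  show ?thesis
    by (rule exI[of _ "\<lambda>x u v. 2 *\<^sub>R be0 u v + commutator (A0 x u) (A0 x v)"],
        rule exI[of _ "\<lambda>x u v. 2 *\<^sub>R be1 u v + commutator (A0 x u) (A1 x v) + commutator (A1 x u) (A0 x v)"],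
        rule exI[of _ "\<lambda>x u v. commutator (A1 x u) (A1 x v)"])
      (auto simp: e intro!: continuous_on_add continuous_on_const continuous_on_commutator c)
qed

lemma Om_eq_curv: "Om i t = curv i t (z (tet i))"
  by (simp add: fun_eq_iff Om_def curv_def linear_0[OF Be_linear(2)])

lemma jet_Om:
  assumes J: "\<And>j. j \<in> J \<Longrightarrow> p j \<in> I" and uv: "u \<in> Basis" "v \<in> Basis"
  shows "jet_O J (\<lambda>j. h (p j)) (\<lambda>j. N (p j)) 0 (\<lambda>j t. Om (p j) t u v)"
proof -
  have a: "jet_O J (\<lambda>j. h (p j)) (\<lambda>j. N (p j)) 0 (\<lambda>j t. Al (p j) t w)" if "w \<in> Basis" for w
    using J that by (intro jet_Al) auto
  have "jet_O J (\<lambda>j. h (p j)) (\<lambda>j. N (p j)) (0 + 0) (\<lambda>j t. Be (p j) t u v)"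
    using J uv by (intro jet_Be) auto
  then show ?thesis unfolding Om_def
    using jet_O_bilinear[OF bounded_bilinear_commutator a[OF uv(1)] a[OF uv(2)]]
    by (intro jet_O_add jet_O_cmult) simp_all
qed

text \<open>The exterior derivative is constant on a tetrahedron, so the curvature varies only
  through commutators that contain \<open>Be\<close> at the displacement from the centre. These are
  of order at least 1, and integration gains three more orders.\<close>

lemma jet_action:
  "jet_O I h N 4 (\<lambda>i t. action_tet i t - measure lebesgue (tet i) * inner2 (Om i t) (Om i t))"
proof -
  define J where "J = Sigma I tet"
  let ?h = "\<lambda>j::'n index \<times> (real^3). h (fst j)" and ?N = "\<lambda>j::'n index \<times> (real^3). N (fst j)"
  have J: "fst j \<in> I" "snd j \<in> tet (fst j)" if "j \<in> J" for j using that by (auto simp: J_def)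
  have dist: "norm (snd j - z (tet (fst j))) \<le> h (fst j) ^ 1" if "j \<in> J" for j
    using tet_dist[OF J(1)[OF that] J(2)[OF that] centre_in_tet[OF J(1)[OF that]]] by simp
  note bc = jet_O_bilinear[OF bounded_bilinear_commutator]
  have a: "jet_O J ?h ?N 0 (\<lambda>j t. Al (fst j) t w)" if "w \<in> Basis" for w
    by (rule jet_Al) (use that J in auto)
  have half_d: "jet_O J ?h ?N 1 (\<lambda>j t. Be (fst j) t (snd j - z (tet (fst j))) w)" if "w \<in> Basis" for w
  proof -
    have "jet_O J ?h ?N (1 + 0) (\<lambda>j t. Be (fst j) t (snd j - z (tet (fst j))) w)"
      by (rule jet_Be) (use that J dist in auto)
    then show ?thesis by simp
  qed
  have D: "jet_O J ?h ?N 1 (\<lambda>j t. curv (fst j) t (snd j) u v - Om (fst j) t u v)" if uv: "u \<in> Basis" "v \<in> Basis" for u v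
  proof -
    have "jet_O J ?h ?N 1 (\<lambda>j t. commutator (Al (fst j) t u) (Be (fst j) t (snd j - z (tet (fst j))) v)
       + commutator (Be (fst j) t (snd j - z (tet (fst j))) u) (Al (fst j) t v)
       + commutator (Be (fst j) t (snd j - z (tet (fst j))) u) (Be (fst j) t (snd j - z (tet (fst j))) v))"
      using bc[OF a[OF uv(1)] half_d[OF uv(2)]] bc[OF half_d[OF uv(1)] a[OF uv(2)]]
        jet_O_mono[OF bc[OF half_d[OF uv(1)] half_d[OF uv(2)]], of 1]
      by (intro jet_O_add) simp_all
    then show ?thesis
      by (rule jet_O_cong) (simp add: curv_def Om_def commutator_simps)
  qed
  have O: "jet_O J ?h ?N 0 (\<lambda>j t. Om (fst j) t u v)" if "u \<in> Basis" "v \<in> Basis" for u v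
    by (rule jet_Om) (use that J in auto)
  have C: "jet_O J ?h ?N 0 (\<lambda>j t. curv (fst j) t (snd j) u v)" if "u \<in> Basis" "v \<in> Basis" for u v
  proof -
    have "jet_O J ?h ?N 0 (\<lambda>j t. (curv (fst j) t (snd j) u v - Om (fst j) t u v) + Om (fst j) t u v)"
      by (intro jet_O_add jet_O_mono[OF D] O that) simp
    then show ?thesis by simp
  qed
  have E: "jet_O J ?h ?N 1 (\<lambda>j t. inner2 (curv (fst j) t (snd j)) (curv (fst j) t (snd j)) - inner2 (Om (fst j) t) (Om (fst j) t))"
    by (rule jet_O_inner2_diff[OF C O D])
  have "jet_O I h N (1 + 3) (\<lambda>i t. LINT x:tet i|lebesgue. inner2 (curv i t x) (curv i t x) - inner2 (Om i t) (Om i t))"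
  proof (rule jet_O_integral[where V="unit_ball_vol 3"])
    show "jet_O (Sigma I tet) (\<lambda>p. h (fst p)) (\<lambda>p. N (fst p)) 1
     (\<lambda>p t. inner2 (curv (fst p) t (snd p)) (curv (fst p) t (snd p)) - inner2 (Om (fst p) t) (Om (fst p) t))"
      using E unfolding J_def .
    fix i assume i: "i \<in> I"
    have "0 \<le> r * diameter (tet i)" using r h_pos[OF i] by (simp add: h_def)
    then show "compact (tet i) \<and> tet i \<noteq> {} \<and> measure lebesgue (tet i) \<le> unit_ball_vol 3 * h i ^ 3"
      using tetrahedron_volume(2)[OF tet3[OF i] ball[OF tet_simplex[OF i]]] tet_compact[OF i] centre_in_tet[OF i]
      by (auto simp: h_def)
    obtain P Q R where c: "\<And>u v. continuous_on (tet i) (\<lambda>x. P x u v)" "\<And>u v. continuous_on (tet i) (\<lambda>x. Q x u v)"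
      "\<And>u v. continuous_on (tet i) (\<lambda>x. R x u v)"
      and e: "\<And>x t u v. curv i t x u v = P x u v + t *\<^sub>R Q x u v + t\<^sup>2 *\<^sub>R R x u v"
      using curv_polynomial[of "tet i" i] by blast
    define q :: "nat \<Rightarrow> real^3 \<Rightarrow> real" where "q m x = (if m = 0 then inner2 (P x) (P x) else if m = 1 then 2 * inner2 (P x) (Q x)
      else if m = 2 then inner2 (Q x) (Q x) + 2 * inner2 (P x) (R x) else if m = 3 then 2 * inner2 (Q x) (R x)
      else inner2 (R x) (R x))" for m x
    have cq: "continuous_on (tet i) (q m)" for m
    proof -
      consider "m = 0" | "m = 1" | "m = 2" | "m = 3" | "m \<noteq> 0 \<and> m \<noteq> 1 \<and> m \<noteq> 2 \<and> m \<noteq> 3" by blast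
      then show ?thesis
        unfolding q_def by cases (simp_all, (intro continuous_intros continuous_on_inner2 c)+)
    qed
    have s: "(\<Sum>m<5. a m) = a 0 + a 1 + a 2 + a 3 + (a 4 :: real)" for a :: "nat \<Rightarrow> real"
      by (simp add: eval_nat_numeral)
    have eq: "inner2 (curv i t x) (curv i t x) = (\<Sum>m<5. t ^ m * q m x)" for t x
    proof -
      have "curv i t x = (\<lambda>u v. P x u v + t *\<^sub>R Q x u v + t\<^sup>2 *\<^sub>R R x u v)" by (simp add: fun_eq_iff e)
      then show ?thesis unfolding s by (simp only: inner2_quadratic) (simp add: q_def)
    qed
    \<comment> \<open>\<open>Om\<close> is \<open>curv\<close> at the centre, so the coefficients of
      its squared norm are the values of \<open>q\<close> there.\<close>
    show "\<exists>c. (\<forall>m<5. continuous_on (tet i) (c m)) \<and> (\<forall>x\<in>tet i. \<forall>t.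
         inner2 (curv i t x) (curv i t x) - inner2 (Om i t) (Om i t) = (\<Sum>m<5. t ^ m * c m x))"
      by (rule exI[of _ "\<lambda>m x. q m x - q m (z (tet i))"])
        (auto simp: Om_eq_curv eq right_diff_distrib sum_subtractf intro!: continuous_on_diff continuous_on_const cq)
  qed
  moreover have "(1::nat) + 3 = 4" by simp
  ultimately have "jet_O I h N 4 (\<lambda>i t. LINT x:tet i|lebesgue. inner2 (curv i t x) (curv i t x) - inner2 (Om i t) (Om i t))"
    by (simp only:)
  then show ?thesis
  proof (rule jet_O_cong)
    fix i t assume i: "i \<in> I"
    have int: "set_integrable lebesgue (tet i) (\<lambda>x. inner2 (curv i t x) (curv i t x))"
      "set_integrable lebesgue (tet i) (\<lambda>x. inner2 (Om i t) (Om i t))"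
      by (intro set_integrable_compact tet_compact i continuous_on_inner2 continuous_on_curv continuous_on_const)+
    show "(LINT x:tet i|lebesgue. inner2 (curv i t x) (curv i t x) - inner2 (Om i t) (Om i t))
       = action_tet i t - measure lebesgue (tet i) * inner2 (Om i t) (Om i t)"
      unfolding set_integral_diff(2)[OF int] action_tet_eq[OF i] set_integral_const[OF tet_compact(1)[OF i]] by simp
  qed
qed

text \<open>Subtracting the two expansions removes the common value and bounds the derivative of the
  difference. To split it into the derivatives of the two actions, differentiability of one of them
  is required; it follows from that of the squared norm of \<open>Om\<close>.\<close>

lemma action_lattice_estimate:
  obtains C where "C \<ge> 0"
    "\<And>i. i \<in> I \<Longrightarrow> \<exists>a l. (action_tet i has_real_derivative a) (at 0) \<and> (lattice_tet i has_real_derivative l) (at 0) \<and>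
      \<bar>a - l\<bar> \<le> C * h i ^ 4 * N i"
proof -
  have "jet_O I h N 4 (\<lambda>i t. (action_tet i t - measure lebesgue (tet i) * inner2 (Om i t) (Om i t))
     - (lattice_tet i t - measure lebesgue (tet i) * inner2 (Om i t) (Om i t)))"
    by (intro jet_O_diff jet_action jet_lattice)
  then have "jet_O I h N 4 (\<lambda>i t. action_tet i t - lattice_tet i t)" by simp
  then obtain C where C: "C \<ge> 0" "\<And>i. i \<in> I \<Longrightarrow> \<exists>f'. ((\<lambda>t. action_tet i t - lattice_tet i t) has_vector_derivative f') (at 0) \<and>
       norm f' \<le> C * h i ^ 4 * N i" unfolding jet_O_def by blast
  have "jet_O I h N 0 (\<lambda>i t. (1/2) *\<^sub>R (\<Sum>u\<in>Basis. \<Sum>v\<in>Basis. Om i t u v \<bullet> Om i t u v))"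
  proof (intro jet_O_cmult jet_O_sum_const)
    fix u v :: "real^3" assume uv: "u \<in> Basis" "v \<in> Basis"
    have "jet_O I h N 0 (\<lambda>i t. Om i t u v)" using jet_Om[of I "\<lambda>i. i", OF _ uv] by simp
    from jet_O_bilinear[OF bounded_bilinear_inner this this]
    show "jet_O I h N 0 (\<lambda>i t. Om i t u v \<bullet> Om i t u v)" by simp
  qed auto
  then have "jet_O I h N 0 (\<lambda>i t. inner2 (Om i t) (Om i t))" by (simp add: inner2_def)
  then have O: "\<exists>f'. ((\<lambda>t. inner2 (Om i t) (Om i t)) has_vector_derivative f') (at 0)" if "i \<in> I" for i
    using that unfolding jet_O_def by blast
  have D: "\<exists>f'. ((\<lambda>t. action_tet i t - measure lebesgue (tet i) * inner2 (Om i t) (Om i t)) has_vector_derivative f') (at 0)" if "i \<in> I" for i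
    using jet_action that unfolding jet_O_def by blast
  show thesis
  proof (rule that[OF C(1)])
    fix i assume i: "i \<in> I"
    obtain f where f: "((\<lambda>t. action_tet i t - lattice_tet i t) has_real_derivative f) (at 0)" "\<bar>f\<bar> \<le> C * h i ^ 4 * N i"
      using C(2)[OF i] by (auto simp: has_real_derivative_iff_has_vector_derivative)
    obtain o' d' where od: "((\<lambda>t. inner2 (Om i t) (Om i t)) has_real_derivative o') (at 0)"
      "((\<lambda>t. action_tet i t - measure lebesgue (tet i) * inner2 (Om i t) (Om i t)) has_real_derivative d') (at 0)"
      using O[OF i] D[OF i] by (auto simp: has_real_derivative_iff_has_vector_derivative)
    have "((\<lambda>t. (action_tet i t - measure lebesgue (tet i) * inner2 (Om i t) (Om i t)) + measure lebesgue (tet i) * inner2 (Om i t) (Om i t))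
        has_real_derivative d' + measure lebesgue (tet i) * o') (at 0)"
      by (intro DERIV_add DERIV_cmult od)
    then have a: "(action_tet i has_real_derivative d' + measure lebesgue (tet i) * o') (at 0)" by simp
    have "((\<lambda>t. action_tet i t - (action_tet i t - lattice_tet i t)) has_real_derivative (d' + measure lebesgue (tet i) * o') - f) (at 0)"
      by (intro DERIV_diff a f)
    then have l: "(lattice_tet i has_real_derivative (d' + measure lebesgue (tet i) * o') - f) (at 0)" by simp
    show "\<exists>a l. (action_tet i has_real_derivative a) (at 0) \<and> (lattice_tet i has_real_derivative l) (at 0) \<and>
      \<bar>a - l\<bar> \<le> C * h i ^ 4 * N i"
      by (rule exI, rule exI, rule conjI[OF a conjI[OF l]]) (use f in simp)
  qed
qed

end

section \<open>The norm of the perturbation\<close>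

lemma inner1_nonneg: "0 \<le> inner1 f f"
  unfolding inner1_def by (rule sum_nonneg) simp

lemma inner2_nonneg: "0 \<le> inner2 f f"
  unfolding inner2_def by (intro divide_nonneg_nonneg sum_nonneg) simp_all

lemma L2_norm_nonneg: "0 \<le> L2_norm1 S A" "0 \<le> L2_norm2 S F"
  unfolding L2_norm1_def L2_norm2_def set_lebesgue_integral_def
  by (intro real_sqrt_ge_zero Bochner_Integration.integral_nonneg; simp add: inner1_nonneg inner2_nonneg)+

text \<open>Cauchy-Schwarz after splitting each weight into two square roots. The weights are going
  to be the volumes of the tetrahedra.\<close>

lemma sum_mult_le_sqrt:
  fixes w x :: "'i \<Rightarrow> real"
  assumes "\<And>i. i \<in> A \<Longrightarrow> 0 \<le> w i"
  shows "(\<Sum>i\<in>A. w i * x i) \<le> sqrt (sum w A) * sqrt (\<Sum>i\<in>A. w i * (x i)\<^sup>2)"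
proof -
  have "(\<Sum>i\<in>A. w i * x i)\<^sup>2 = (\<Sum>i\<in>A. sqrt (w i) * (sqrt (w i) * x i))\<^sup>2"
    using assms by (intro arg_cong[where f="\<lambda>s. s\<^sup>2"] sum.cong) (auto simp flip: mult.assoc)
  also have "\<dots> \<le> (\<Sum>i\<in>A. (sqrt (w i))\<^sup>2) * (\<Sum>i\<in>A. (sqrt (w i) * x i)\<^sup>2)"
    by (rule Cauchy_Schwarz_ineq_sum)
  also have "\<dots> = sum w A * (\<Sum>i\<in>A. w i * (x i)\<^sup>2)"
    using assms by (simp add: power_mult_distrib)
  finally have "\<bar>\<Sum>i\<in>A. w i * x i\<bar> \<le> sqrt (sum w A * (\<Sum>i\<in>A. w i * (x i)\<^sup>2))"
    by (rule real_le_rsqrt[of "\<bar>_\<bar>", simplified])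
  then show ?thesis by (simp add: real_sqrt_mult)
qed

context whitney_perturbation
begin

lemma Nbe_sq: "(Nbe i)\<^sup>2 = inner2 (\<lambda>u v. 2 *\<^sub>R half_d (\<T> (fst i)) (eo (fst i)) (tet i) (snd (snd i)) u v)
    (\<lambda>u v. 2 *\<^sub>R half_d (\<T> (fst i)) (eo (fst i)) (tet i) (snd (snd i)) u v)"
  unfolding Nbe_def Let_def by (rule real_sqrt_pow2[OF inner2_nonneg])

text \<open>The value of a perturbation at the centre of the ball is recovered from its value at any
  other point of the tetrahedron and its exterior derivative.\<close>

lemma Nal_sq_le:
  assumes i: "i \<in> I" and x: "x \<in> tet i"
  defines "f \<equiv> \<lambda>v. centre_part (\<T> (fst i)) (eo (fst i)) (tet i) (z (tet i)) (snd (snd i)) v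
     + half_d (\<T> (fst i)) (eo (fst i)) (tet i) (snd (snd i)) (x - z (tet i)) v"
  shows "(Nal i)\<^sup>2 \<le> 2 * inner1 f f + 54 * H\<^sup>2 * (Nbe i)\<^sup>2"
proof -
  let ?a = "centre_part (\<T> (fst i)) (eo (fst i)) (tet i) (z (tet i)) (snd (snd i))"
  let ?b = "half_d (\<T> (fst i)) (eo (fst i)) (tet i) (snd (snd i))"
  have H: "norm (x - z (tet i)) \<le> H"
    using tet_dist[OF i x centre_in_tet[OF i]] h_le[OF i] by linarith
  have 1: "?a u \<bullet> ?a u \<le> 2 * (f u \<bullet> f u) + 18 * H\<^sup>2 * (Nbe i)\<^sup>2" if u: "u \<in> Basis" for u
  proof -
    have "norm (?b v u) \<le> Nbe i" if "v \<in> Basis" for v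
      unfolding Nbe_def Let_def by (rule norm_le_inner2[OF that u])
    then have "norm (?b (x - z (tet i)) u) \<le> 3 * Nbe i * norm (x - z (tet i))"
      by (rule norm_le_sum_Basis[OF half_d_linear(2)])
    also have "\<dots> \<le> 3 * Nbe i * H" using H N_nonneg(2)[of i] by (intro mult_left_mono) auto
    finally have "(norm (?b (x - z (tet i)) u))\<^sup>2 \<le> (3 * Nbe i * H)\<^sup>2" by (intro power_mono) auto
    moreover have "(norm (?a u))\<^sup>2 \<le> 2 * (norm (f u))\<^sup>2 + 2 * (norm (?b (x - z (tet i)) u))\<^sup>2"
    proof -
      have "?a u = f u - ?b (x - z (tet i)) u" by (simp add: f_def)
      then have "norm (?a u) \<le> norm (f u) + norm (?b (x - z (tet i)) u)" by (simp add: norm_triangle_ineq4)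
      then have "(norm (?a u))\<^sup>2 \<le> (norm (f u) + norm (?b (x - z (tet i)) u))\<^sup>2" by (intro power_mono) auto
      also have "\<dots> \<le> 2 * (norm (f u))\<^sup>2 + 2 * (norm (?b (x - z (tet i)) u))\<^sup>2"
        using sum_squares_bound[of "norm (f u)" "norm (?b (x - z (tet i)) u)"] by (simp add: power2_sum)
      finally show ?thesis .
    qed
    ultimately show ?thesis unfolding power2_norm_eq_inner by (simp add: power_mult_distrib mult_ac)
  qed
  have "(Nal i)\<^sup>2 = inner1 ?a ?a" unfolding Nal_def Let_def by (rule real_sqrt_pow2[OF inner1_nonneg])
  also have "\<dots> \<le> (\<Sum>u\<in>(Basis::(real^3) set). 2 * (f u \<bullet> f u) + 18 * H\<^sup>2 * (Nbe i)\<^sup>2)"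
    unfolding inner1_def by (rule sum_mono[OF 1])
  also have "\<dots> = 2 * inner1 f f + 54 * H\<^sup>2 * (Nbe i)\<^sup>2"
    by (simp add: inner1_def sum.distrib sum_distrib_left)
  finally show ?thesis .
qed

lemma sum_volume: "(\<Sum>T\<in>simplexes 3 (\<T> n). measure lebesgue T) = (LINT x:S|lebesgue. 1)"
proof -
  have "(LINT x:S|lebesgue. 1) = (\<Sum>T\<in>simplexes 3 (\<T> n). LINT x:T|lebesgue. (1::real))"
    by (rule mesh_integral[OF mesh]) auto
  also have "\<dots> = (\<Sum>T\<in>simplexes 3 (\<T> n). measure lebesgue T)"
    by (rule sum.cong) (simp_all add: set_integral_const compact_simplex[OF simplexesD(1)])
  finally show ?thesis ..
qed

text \<open>Volume times squared \<open>Nbe\<close> sums exactly to the squared norm of the exterior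
  derivative; for \<open>Nal\<close> the comparison at a point \<open>x\<close> is integrated over
  the tetrahedron. Cauchy-Schwarz then costs the square root of the volume of
  \<open>S\<close>.\<close>

lemma sum_volume_N_le:
  fixes n :: nat and c :: "(real^3) set \<Rightarrow> complex^'n^'n"
  assumes H0: "0 \<le> H"
  defines "A' \<equiv> wcomb (\<T> n) (eo n) c"
  shows "(\<Sum>T\<in>simplexes 3 (\<T> n). measure lebesgue T * N (n, T, c))
     \<le> sqrt (LINT x:S|lebesgue. 1) * ((10 + 8 * H) * (L2_norm2 S (ext_d A') + L2_norm1 S A'))"
proof -
  let ?M = "simplexes 3 (\<T> n)"
  have I: "(n, T, c) \<in> I" if "T \<in> ?M" for T using that by (simp add: I_def)
  have tet: "tet (n, T, c) = T" for T by (simp add: tet_def)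
  have cpt: "compact T" if "T \<in> ?M" for T using tet_compact(1)[OF I[OF that]] by (simp add: tet)
  define X where "X = L2_norm1 S A'"
  define Y where "Y = L2_norm2 S (ext_d A')"
  have X0: "0 \<le> X" and Y0: "0 \<le> Y" unfolding X_def Y_def by (rule L2_norm_nonneg)+
  have Y2: "Y\<^sup>2 = (\<Sum>T\<in>?M. measure lebesgue T * (Nbe (n, T, c))\<^sup>2)"
  proof -
    have "(LINT x:S|lebesgue. inner2 (ext_d A' x) (ext_d A' x)) = (\<Sum>T\<in>?M. LINT x:T|lebesgue. (Nbe (n, T, c))\<^sup>2)"
    proof (rule mesh_integral[OF mesh])
      fix T x assume T: "T \<in> ?M" "x \<in> interior T"
      show "inner2 (ext_d A' x) (ext_d A' x) = (Nbe (n, T, c))\<^sup>2"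
        unfolding Nbe_sq inner2_def A'_def by (simp add: ext_d_wcomb[OF mesh T] tet)
    qed simp
    also have "\<dots> = (\<Sum>T\<in>?M. measure lebesgue T * (Nbe (n, T, c))\<^sup>2)"
      by (rule sum.cong) (simp_all add: set_integral_const cpt)
    finally have e: "(LINT x:S|lebesgue. inner2 (ext_d A' x) (ext_d A' x)) = \<dots>" .
    show ?thesis unfolding Y_def L2_norm2_def e
      by (rule real_sqrt_pow2) (intro sum_nonneg mult_nonneg_nonneg; simp)
  qed
  define f where "f = (\<lambda>T x v. centre_part (\<T> n) (eo n) T (z T) c v + half_d (\<T> n) (eo n) T c (x - z T) v)"
  have fc: "continuous_on T (\<lambda>x. inner1 (f T x) (f T x))" for T
    unfolding inner1_def f_def by (intro continuous_intros continuous_on_half_d)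
  have X2: "X\<^sup>2 = (\<Sum>T\<in>?M. LINT x:T|lebesgue. inner1 (f T x) (f T x))"
  proof -
    have e: "(LINT x:S|lebesgue. inner1 (A' x) (A' x)) = (\<Sum>T\<in>?M. LINT x:T|lebesgue. inner1 (f T x) (f T x))"
    proof (rule mesh_integral[OF mesh])
      fix T x assume T: "T \<in> ?M" "x \<in> interior T"
      show "inner1 (A' x) (A' x) = inner1 (f T x) (f T x)"
        unfolding inner1_def A'_def f_def by (simp only: wcomb_interior[OF mesh T, where z="z T"])
    qed (rule fc)
    have "0 \<le> (LINT x:S|lebesgue. inner1 (A' x) (A' x))"
      unfolding set_lebesgue_integral_def
      by (rule Bochner_Integration.integral_nonneg) (simp add: inner1_nonneg)
    then show ?thesis unfolding X_def L2_norm1_def e[symmetric] by (rule real_sqrt_pow2)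
  qed
  have al_le: "measure lebesgue T * (Nal (n, T, c))\<^sup>2
      \<le> 2 * (LINT x:T|lebesgue. inner1 (f T x) (f T x)) + 54 * H\<^sup>2 * (measure lebesgue T * (Nbe (n, T, c))\<^sup>2)"
    if T: "T \<in> ?M" for T
  proof -
    have si: "set_integrable lebesgue T (\<lambda>x. inner1 (f T x) (f T x))"
      by (rule set_integrable_compact[OF cpt[OF T] fc])
    have "measure lebesgue T * (Nal (n, T, c))\<^sup>2 = (LINT x:T|lebesgue. (Nal (n, T, c))\<^sup>2)"
      by (simp add: set_integral_const cpt[OF T])
    also have "\<dots> \<le> (LINT x:T|lebesgue. 2 * inner1 (f T x) (f T x) + 54 * H\<^sup>2 * (Nbe (n, T, c))\<^sup>2)"
    proof (rule set_integral_mono)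
      show "set_integrable lebesgue T (\<lambda>x. (Nal (n, T, c))\<^sup>2)"
        "set_integrable lebesgue T (\<lambda>x. 2 * inner1 (f T x) (f T x) + 54 * H\<^sup>2 * (Nbe (n, T, c))\<^sup>2)"
        by (intro set_integrable_compact[OF cpt[OF T]] continuous_intros fc)+
      show "(Nal (n, T, c))\<^sup>2 \<le> 2 * inner1 (f T x) (f T x) + 54 * H\<^sup>2 * (Nbe (n, T, c))\<^sup>2" if "x \<in> T" for x
        using Nal_sq_le[OF I[OF T], of x] that by (simp add: tet f_def)
    qed
    also have "\<dots> = 2 * (LINT x:T|lebesgue. inner1 (f T x) (f T x)) + 54 * H\<^sup>2 * (Nbe (n, T, c))\<^sup>2 * measure lebesgue T"
      using set_integral_add(2)[OF set_integrable_mult_right[OF si, of 2]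
          set_integrable_compact[OF cpt[OF T] continuous_on_const[of T "54 * H\<^sup>2 * (Nbe (n, T, c))\<^sup>2"]]]
      by (simp add: set_integral_const cpt[OF T])
    finally show ?thesis by (simp add: mult_ac)
  qed
  have "(\<Sum>T\<in>?M. measure lebesgue T * (Nal (n, T, c))\<^sup>2) \<le> 2 * X\<^sup>2 + 54 * H\<^sup>2 * Y\<^sup>2"
    unfolding X2 Y2 sum_distrib_left sum.distrib[symmetric] by (rule sum_mono) (use al_le in simp)
  \<comment> \<open>The coefficient 8 is taken because its square 64 exceeds 54.\<close>
  also have "\<dots> \<le> (2 * X + 8 * H * Y)\<^sup>2"
  proof -
    have "(2 * X + 8 * H * Y)\<^sup>2 = 4 * X\<^sup>2 + 64 * (H\<^sup>2 * Y\<^sup>2) + 32 * (H * (X * Y))"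
      by (simp add: power2_eq_square algebra_simps)
    moreover have "0 \<le> H * (X * Y)" "0 \<le> H\<^sup>2 * Y\<^sup>2" "0 \<le> X\<^sup>2" using X0 Y0 H0 by simp_all
    ultimately show ?thesis by simp
  qed
  finally have al2: "(\<Sum>T\<in>?M. measure lebesgue T * (Nal (n, T, c))\<^sup>2) \<le> (2 * X + 8 * H * Y)\<^sup>2" .
  have s: "0 \<le> sqrt (sum (measure lebesgue) ?M)" by (intro real_sqrt_ge_zero sum_nonneg) simp
  have "(\<Sum>T\<in>?M. measure lebesgue T * Nal (n, T, c)) \<le> sqrt (sum (measure lebesgue) ?M) * (2 * X + 8 * H * Y)"
  proof -
    have "sqrt (\<Sum>T\<in>?M. measure lebesgue T * (Nal (n, T, c))\<^sup>2) \<le> 2 * X + 8 * H * Y"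
      using real_sqrt_le_mono[OF al2] X0 Y0 H0 by simp
    then show ?thesis
      using sum_mult_le_sqrt[of ?M "measure lebesgue" "\<lambda>T. Nal (n, T, c)"] mult_left_mono[OF _ s] by fastforce
  qed
  moreover have "(\<Sum>T\<in>?M. measure lebesgue T * Nbe (n, T, c)) \<le> sqrt (sum (measure lebesgue) ?M) * Y"
    using sum_mult_le_sqrt[of ?M "measure lebesgue" "\<lambda>T. Nbe (n, T, c)"] Y0 by (simp flip: Y2)
  ultimately have "(\<Sum>T\<in>?M. measure lebesgue T * N (n, T, c)) \<le> sqrt (sum (measure lebesgue) ?M) * (2 * X + 8 * H * Y + Y)"
    by (simp add: N_def distrib_left sum.distrib)
  \<comment> \<open>The factor \<open>10 + 8 * H\<close> dominates both the coefficient 2 of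
    \<open>X\<close> and the coefficient \<open>8 * H + 1\<close> of \<open>Y\<close>.\<close>
  also have "\<dots> \<le> sqrt (sum (measure lebesgue) ?M) * ((10 + 8 * H) * (Y + X))"
  proof (rule mult_left_mono[OF _ s])
    have "0 \<le> H * X" using H0 X0 by simp
    then show "2 * X + 8 * H * Y + Y \<le> (10 + 8 * H) * (Y + X)" using X0 Y0 by (simp add: algebra_simps)
  qed
  finally show ?thesis unfolding sum_volume X_def Y_def .
qed

end

section \<open>Consistency of the actions\<close>

text \<open>Exchanging the two sums collects the Lie algebra elements at each edge into one
  coefficient.\<close>

lemma Xspace_wcomb:
  assumes "A' \<in> Xspace G \<T> eo"
  obtains c where "A' = wcomb \<T> eo c"
proof -
  obtain m :: nat and w g where w: "\<And>k. k < m \<Longrightarrow> w k \<in> W1 \<T> eo" and A': "A' = (\<lambda>x v. \<Sum>k<m. w k x v *\<^sub>R g k)"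
    using assms unfolding Xspace_def tensor_def by blast
  have "\<exists>d. \<forall>k<m. w k = (\<lambda>x v. \<Sum>e\<in>simplexes 1 \<T>. d k e * whitney1 \<T> (eo e) x v)"
    using w unfolding W1_def by (intro choice) blast
  then obtain d where d: "\<And>k. k < m \<Longrightarrow> w k = (\<lambda>x v. \<Sum>e\<in>simplexes 1 \<T>. d k e * whitney1 \<T> (eo e) x v)" by blast
  have "A' x v = wcomb \<T> eo (\<lambda>e. \<Sum>k<m. d k e *\<^sub>R g k) x v" for x v
  proof -
    have "A' x v = (\<Sum>k<m. \<Sum>e\<in>simplexes 1 \<T>. (d k e * whitney1 \<T> (eo e) x v) *\<^sub>R g k)"
      unfolding A' by (rule sum.cong) (simp_all add: d scaleR_sum_left)
    also have "\<dots> = (\<Sum>e\<in>simplexes 1 \<T>. \<Sum>k<m. (d k e * whitney1 \<T> (eo e) x v) *\<^sub>R g k)"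
      by (rule sum.swap)
    finally show ?thesis by (simp add: wcomb_def scaleR_sum_right mult.commute)
  qed
  then have "A' = wcomb \<T> eo (\<lambda>e. \<Sum>k<m. d k e *\<^sub>R g k)" by (intro ext)
  then show thesis by (rule that)
qed

theorem theorem2:
  fixes G :: "(complex^'n^'n) set"
    and S :: "(real^3) set"
    and \<T> :: "nat \<Rightarrow> (real^3) set set"
    and eo :: "nat \<Rightarrow> (real^3) set \<Rightarrow> (real^3) \<times> (real^3)"
    and fo :: "nat \<Rightarrow> (real^3) set \<Rightarrow> (real^3) \<times> (real^3) \<times> (real^3)"
    and A :: "(complex^'n^'n) form1"
  assumes "compact_unitary_group G"
    and "open S" "connected S" "bounded S" "S \<noteq> {}"
    and "\<And>n. mesh_of S (\<T> n)"
    and "shape_regular \<T>"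
    and "(\<lambda>n. mesh_size (\<T> n)) \<longlonglongrightarrow> 0"
    and "\<And>n. edge_orientation (\<T> n) (eo n)"
    and "\<And>n. face_orientation (\<T> n) (fo n)"
    and "A \<in> smooth_form1 S (lie_algebra G)"
  shows "\<exists>C>0. \<forall>n.
    (SUP A' \<in> Xspace G (\<T> n) (eo n) - {\<lambda>x v. 0}.
       ereal (\<bar>dir_deriv (action (\<T> n)) (interpolant (\<T> n) (eo n) A) A'
               - dir_deriv (lattice_action (\<T> n) (fo n)) (interpolant (\<T> n) (eo n) A) A'\<bar>
              / (L2_norm2 S (ext_d A') + L2_norm1 S A')))
    \<le> ereal (C * mesh_size (\<T> n))"
proof -
  note mesh = assms(6)
  obtain r where r: "r > 0" and rb: "\<And>n T. T \<in> simplexes 3 (\<T> n) \<Longrightarrow> \<exists>z. cball z (r * diameter T) \<subseteq> T"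
    using assms(7) unfolding shape_regular_def by blast
  \<comment> \<open>The centre of an inscribed ball depends on the set \<open>T\<close> alone, while
    \<open>r\<close> is common to all meshes.\<close>
  define z where "z T = (SOME z. cball z (r * diameter T) \<subseteq> T)" for T :: "(real^3) set"
  have z: "cball (z T) (r * diameter T) \<subseteq> T" if "T \<in> simplexes 3 (\<T> n)" for n T
    unfolding z_def by (rule someI_ex[OF rb[OF that]])
  define H where "H = diameter (closure S)"
  have T_sub: "T \<subseteq> closure S" if "T \<in> \<T> n" for n T using mesh[of n] that unfolding mesh_of_def by blast
  have bS: "bounded (closure S)" using assms(4) by (rule bounded_closure)
  have H: "diameter T \<le> H" if "T \<in> simplexes 3 (\<T> n)" for n T
    unfolding H_def by (rule diameter_subset[OF T_sub[OF simplexesD(2)[OF that]] bS])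
  have H0: "0 \<le> H" unfolding H_def by (rule diameter_ge_0[OF bS])
  obtain L where L: "L \<ge> 0" "\<And>x v. x \<in> closure S \<Longrightarrow> norm (A x v) \<le> L * norm v"
    "\<And>T x y v. convex T \<Longrightarrow> interior T \<subseteq> S \<Longrightarrow> closure (interior T) = T \<Longrightarrow> x \<in> T \<Longrightarrow> y \<in> T \<Longrightarrow>
       norm (A x v - A y v) \<le> L * norm (x - y) * norm v"
    "\<And>v. continuous_on (closure S) (\<lambda>x. A x v)"
    using smooth_form1_bounds[OF assms(11) assms(2) assms(4)] by blast
  have lin: "linear (A x)" if "x \<in> closure S" for x using assms(11) that by (simp add: smooth_form1_def)
  define b where "b n e = (case eo n e of (i, j) \<Rightarrow> edge_integral A j i)" for n e
  define Kb where "Kb = 32 * L / r ^ 2"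
  define Ka where "Ka = 2 / r * (L + 2 * L * H + 32 * L / r ^ 2 * H)"
  have K0: "Kb \<ge> 0" "Ka \<ge> 0" using L(1) r H0 by (simp_all add: Kb_def Ka_def)
  define K where "K = Kb + Ka"
  have lipT: "norm (A x v - A y v) \<le> L * norm (x - y) * norm v" if "T \<in> simplexes 3 (\<T> n)" "x \<in> T" "y \<in> T" for n T x y v
  proof (rule L(3)[OF _ _ _ that(2,3)])
    show "convex T" by (rule convex_simplex[OF simplexesD(1)[OF that(1)]])
    show "interior T \<subseteq> S" using mesh[of n] that(1) unfolding mesh_of_def by blast
    show "closure (interior T) = T" by (rule tetrahedron_interior(2)[OF simplexesD(1)[OF that(1)]])
  qed
  have al_b: "norm (centre_part (\<T> n) (eo n) T (z T) (b n) v) \<le> K * norm v" if T: "T \<in> simplexes 3 (\<T> n)" for n T v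
  proof -
    have "norm (centre_part (\<T> n) (eo n) T (z T) (b n) v) \<le> Ka * norm v"
      unfolding Ka_def b_def by (rule interpolant_bounds(2)[OF mesh T assms(9) z[OF T] r H[OF T] lin L(1,2) lipT[OF T] L(4)])
    also have "\<dots> \<le> K * norm v" using K0 by (intro mult_right_mono) (auto simp: K_def)
    finally show ?thesis .
  qed
  have be_b: "norm (half_d (\<T> n) (eo n) T (b n) u v) \<le> K * norm u * norm v" if T: "T \<in> simplexes 3 (\<T> n)" for n T u v
  proof -
    have "norm (half_d (\<T> n) (eo n) T (b n) u v) \<le> Kb * norm u * norm v"
      unfolding Kb_def b_def by (rule interpolant_bounds(1)[OF mesh T assms(9) z[OF T] r H[OF T] lin L(1,2) lipT[OF T] L(4)])
    also have "\<dots> \<le> K * norm u * norm v" using K0 by (intro mult_right_mono) (auto simp: K_def)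
    finally show ?thesis .
  qed
  interpret W: whitney_perturbation S \<T> eo fo b z r H K
    by unfold_locales (use mesh assms(10) r z H K0 al_b be_b in \<open>auto simp: K_def\<close>)
  obtain C where C: "C \<ge> 0"
    and est: "\<And>i. i \<in> W.I \<Longrightarrow> \<exists>a l. (W.action_tet i has_real_derivative a) (at 0) \<and> (W.lattice_tet i has_real_derivative l) (at 0) \<and>
      \<bar>a - l\<bar> \<le> C * W.h i ^ 4 * W.N i"
    using W.action_lattice_estimate by blast
  define V where "V = unit_ball_vol 3 * r ^ 3"
  have V: "V > 0" using r by (simp add: V_def unit_ball_vol_pos)
  define vS where "vS = sqrt (LINT x:S|lebesgue. 1 :: real)"
  have vS: "vS \<ge> 0" unfolding vS_def set_lebesgue_integral_def
    by (rule real_sqrt_ge_zero, rule Bochner_Integration.integral_nonneg) simp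
  \<comment> \<open>Adding 1 makes the constant positive even if \<open>C\<close> is 0.\<close>
  define D where "D = C / V * (vS * (10 + 8 * H)) + 1"
  have D: "D > 0" using C V vS H0 by (simp add: D_def add_nonneg_pos)
  define err where "err n A' = \<bar>dir_deriv (action (\<T> n)) (interpolant (\<T> n) (eo n) A) A'
               - dir_deriv (lattice_action (\<T> n) (fo n)) (interpolant (\<T> n) (eo n) A) A'\<bar>" for n A'
  have key: "err n A'
              / (L2_norm2 S (ext_d A') + L2_norm1 S A') \<le> D * mesh_size (\<T> n)"
    if A': "A' \<in> Xspace G (\<T> n) (eo n)" for n A'
  proof -
    obtain c where c: "A' = wcomb (\<T> n) (eo n) c" using Xspace_wcomb[OF A'] by blast
    let ?M = "simplexes 3 (\<T> n)"
    define i where "i T = (n, T, c)" for T :: "(real^3) set"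
    have I: "i T \<in> W.I" if "T \<in> ?M" for T using that by (simp add: i_def W.I_def)
    have fin: "finite (\<T> n)" using mesh[of n] unfolding mesh_of_def simplicial_complex_def by blast
    have form: "(\<lambda>x v. interpolant (\<T> n) (eo n) A x v + t *\<^sub>R A' x v) = W.form (i T) t" for t T
      by (simp add: fun_eq_iff W.form_def W.coeffs_def i_def interpolant_wcomb c wcomb_add_scale b_def)
    have tet: "W.tet (i T) = T" "fst (i T) = n" for T by (simp_all add: W.tet_def i_def)
    have act: "action (\<T> n) (\<lambda>x v. interpolant (\<T> n) (eo n) A x v + t *\<^sub>R A' x v) = (\<Sum>T\<in>?M. W.action_tet (i T) t)" for t
      unfolding action_def W.action_tet_def form[symmetric] tet ..
    have lat: "lattice_action (\<T> n) (fo n) (\<lambda>x v. interpolant (\<T> n) (eo n) A x v + t *\<^sub>R A' x v) = (\<Sum>T\<in>?M. W.lattice_tet (i T) t)" for t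
      unfolding lattice_action_def W.lattice_tet_def form[symmetric] tet ..
    obtain a l where centre_part: "\<And>T. T \<in> ?M \<Longrightarrow> (W.action_tet (i T) has_real_derivative a T) (at 0)"
      "\<And>T. T \<in> ?M \<Longrightarrow> (W.lattice_tet (i T) has_real_derivative l T) (at 0)"
      "\<And>T. T \<in> ?M \<Longrightarrow> \<bar>a T - l T\<bar> \<le> C * W.h (i T) ^ 4 * W.N (i T)"
      using est[OF I] by metis
    have "dir_deriv (action (\<T> n)) (interpolant (\<T> n) (eo n) A) A' = (\<Sum>T\<in>?M. a T)"
      unfolding dir_deriv_def act by (intro DERIV_imp_deriv DERIV_sum centre_part)
    moreover have "dir_deriv (lattice_action (\<T> n) (fo n)) (interpolant (\<T> n) (eo n) A) A' = (\<Sum>T\<in>?M. l T)"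
      unfolding dir_deriv_def lat by (intro DERIV_imp_deriv DERIV_sum centre_part)
    ultimately have "err n A' = \<bar>\<Sum>T\<in>?M. a T - l T\<bar>"
      by (simp add: err_def sum_subtractf)
    \<comment> \<open>One factor of the fourth power of the diameter is bounded by the mesh size,
      the other three by the volume over \<open>V\<close>.\<close>
    also have "\<dots> \<le> (\<Sum>T\<in>?M. (C / V * mesh_size (\<T> n)) * (measure lebesgue T * W.N (i T)))"
    proof (intro order_trans[OF sum_abs] sum_mono)
      fix T assume T: "T \<in> ?M"
      have hT: "W.h (i T) = diameter T" by (simp add: W.h_def W.tet_def i_def)
      have d: "0 < diameter T" using W.h_pos[OF I[OF T]] by (simp add: hT)
      have ms: "diameter T \<le> mesh_size (\<T> n)"
        unfolding mesh_size_def using fin simplexesD(2)[OF T] by (intro Max_ge) auto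
      have "V * diameter T ^ 3 \<le> measure lebesgue T"
        using tetrahedron_volume(1)[OF simplexesD(1)[OF T] z[OF T]] r d by (simp add: V_def power_mult_distrib mult_ac)
      then have v: "diameter T ^ 3 \<le> measure lebesgue T / V" using V by (simp add: field_simps)
      have "diameter T ^ 4 = diameter T ^ 3 * diameter T" by (simp add: eval_nat_numeral)
      also have "\<dots> \<le> (measure lebesgue T / V) * mesh_size (\<T> n)"
        using v ms d V by (intro mult_mono) auto
      finally have "C * diameter T ^ 4 * W.N (i T) \<le> C * ((measure lebesgue T / V) * mesh_size (\<T> n)) * W.N (i T)"
        using C W.N_nonneg(3) by (intro mult_right_mono mult_left_mono) auto
      then show "\<bar>a T - l T\<bar> \<le> (C / V * mesh_size (\<T> n)) * (measure lebesgue T * W.N (i T))"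
        using centre_part(3)[OF T] by (simp add: hT mult_ac)
    qed
    also have "\<dots> = (C / V * mesh_size (\<T> n)) * (\<Sum>T\<in>?M. measure lebesgue T * W.N (i T))"
      by (simp only: sum_distrib_left)
    finally have 1: "err n A'
        \<le> (C / V * mesh_size (\<T> n)) * (\<Sum>T\<in>?M. measure lebesgue T * W.N (i T))" .
    have ms0: "0 \<le> mesh_size (\<T> n)"
    proof -
      have "\<Union>(\<T> n) = closure S" using mesh[of n] unfolding mesh_of_def by blast
      then have "\<Union>(\<T> n) \<noteq> {}" using assms(5) closure_eq_empty by simp
      then obtain T where T: "T \<in> \<T> n" by blast
      have "0 \<le> diameter T" by (rule diameter_ge_0[OF bounded_subset[OF bS T_sub[OF T]]])
      also have "\<dots> \<le> mesh_size (\<T> n)" unfolding mesh_size_def using fin T by (intro Max_ge) auto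
      finally show ?thesis .
    qed
    define Nm where "Nm = L2_norm2 S (ext_d A') + L2_norm1 S A'"
    have Nm0: "0 \<le> Nm" unfolding Nm_def by (intro add_nonneg_nonneg L2_norm_nonneg)
    have "(C / V * mesh_size (\<T> n)) * (\<Sum>T\<in>?M. measure lebesgue T * W.N (i T))
        \<le> (C / V * mesh_size (\<T> n)) * (vS * ((10 + 8 * H) * Nm))"
      using W.sum_volume_N_le[OF H0, of n c] C V ms0
      by (intro mult_left_mono) (simp_all add: i_def vS_def Nm_def c)
    also have "\<dots> \<le> D * mesh_size (\<T> n) * Nm"
      using ms0 Nm0 by (simp add: D_def algebra_simps)
    finally have 2: "err n A' \<le> D * mesh_size (\<T> n) * Nm"
      using 1 by linarith
    show ?thesis
    \<comment> \<open>If the norm is 0, the quotient is 0 by the convention for division, and the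
      bound is nonnegative.\<close>
    proof (cases "Nm = 0")
      case True
      then show ?thesis unfolding Nm_def[symmetric] using D ms0 by simp
    next
      case False
      then have "0 < Nm" using Nm0 by simp
      then show ?thesis unfolding Nm_def[symmetric] using 2 by (simp add: divide_le_eq)
    qed
  qed
  show ?thesis unfolding err_def[symmetric]
  proof (intro exI[of _ D] conjI allI D SUP_least)
    fix n A' assume "A' \<in> Xspace G (\<T> n) (eo n) - {\<lambda>x v. 0}"
    then show "ereal (err n A'
              / (L2_norm2 S (ext_d A') + L2_norm1 S A')) \<le> ereal (D * mesh_size (\<T> n))"
      using key by simp
  qed
qed

end
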